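(* Let $\lambda$ be a partition of $N$ and let $\mathcal{P}$ be a path in $G_\lambda$ from the root to a vertex $(\tau,v)$. Then $J_{\mathcal{P}}$ is a simultaneous eigenfunction of the operators $\tilde\xi_1,\dots,\tilde\xi_N$, with $J_{\mathcal{P}}\tilde\xi_i=\zeta_{v,\tau}[i]J_{\mathcal{P}}$, and its leading monomial is $x^{v,\tau}$. Consequently $J_{\mathcal{P}}$ depends only on the end point $(\tau,v)$ (denote it $J_{v,\tau}$), and the family $(J_{v,\tau})$, over all RSTs $\tau$ of shape $\lambda$ and $v\in\mathbb{N}^N$, is a basis of $M_\lambda$ consisting of simultaneous eigenfunctions of the Cherednik–Dunkl operators. Furthermore, if $\mathcal{P}$ leads to $\varnothing$ then $J_{\mathcal{P}}=0$.
   Context: Partitions in French convention (rows numbered bottom to top, columns from the left). An RST of shape $\lambda\vdash N$ is a bijective filling with $1,\dots,N$ strictly decreasing along rows (left to right) and columns (bottom to top); $\mathrm{CT}_\tau[i]=c-r$ if $i$ is in column $c$, row $r$; $\tau_\lambda$ fills the columns left to right, each bottom to top, with $N,\dots,1$. For $v\in\mathbb{N}^N$: $v^+$ is its decreasing rearrangement; $\sigma_v$ labels positions of $v$ by $1,\dots,N$ in order of decreasing entries, ties left to right; $vs_i$ swaps entries $i,i+1$; $v\Psi=[v[2],\dots,v[N],v[1]+1]$. $\alpha$ is an indeterminate; the spectral vector is $\zeta_{v,\tau}[i]=\alpha v[i]+\mathrm{CT}_\tau[\sigma_v[i]]$. Graph $G_\lambda$: vertices are pairs $(\tau,v)$ reachable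 from the root $(\tau_\lambda,0^N)$, plus a vertex $\varnothing$; from $(\tau,v)$: an edge $\Psi$ to $(\tau,v\Psi)$; for $1\le i<N$, an edge $s_i$ to $(\tau,vs_i)$ if $v[i]<v[i+1]$; if $v[i]=v[i+1]$ and $\mathrm{CT}_\tau[\sigma_v[i]]-\mathrm{CT}_\tau[\sigma_v[i]+1]\ge2$, an edge $s_i$ to $(\tau',v)$ with $\tau'$ obtained by interchanging $\sigma_v[i]$ and $\sigma_v[i]+1$ in $\tau$; if $v[i]=v[i+1]$ and this interchange does not give an RST, an edge $s_i$ to $\varnothing$. A path is a sequence of consecutive edges starting at the root. Polynomials: $V_\lambda$ is the $\mathbb{Q}(\alpha)$-space with basis the RSTs of shape $\lambda$, right $\mathfrak{S}_N$-action: with $b=1/(\mathrm{CT}_\tau[i]-\mathrm{CT}_\tau[i+1])$, $\tau s_i=b\tau$ if $b=\pm1$; $b\tau+\tau^{(i,i+1)}$ if $0<b\le\frac12$; $b\tau+(1-b^2)\tau^{(i,i+1)}$ otherwise ($\tau^{(i,i+1)}$: entries $i,i+1$ interchanged). $M_\lambda=\mathbb{Q}(\alpha)[x_1,\dots,x_N]\otimes V_\lambda$; operators act on the right, products read left to right. $fs_{ij}$ exchanges $x_i,x_j$; $f\partial_{ij}=(f-fs_{ij})/(x_i-x_j)$; $(f\otimes t)(\omega\otimes\omega)=(f\omega)\otimes(t\omega)$; $(f\otimes t)\mathcal{D}_i=\frac{\partial f}{\partial x_i}\otimes t+\frac1\alpha\sum_{j\ne i}(f\partial_{ij})\otimes(ts_{ij})$;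 $P\,\mathcal{U}_i=(x_iP)\mathcal{D}_i-\frac1\alpha\sum_{j<i}P(s_{ij}\otimes s_{ij})$; $\tilde\xi_i=\alpha\mathcal{U}_i-\alpha$; $P\Psi=x_N\cdot(P(\theta\otimes\theta))$, $\theta=s_1\cdots s_{N-1}$. Monomials: $x^{v,\tau}=x^v\otimes(\tau\sigma_v)$ with $x^v=\prod x_i^{v[i]}$. Order: $v\lhd v'$ iff $v^+\prec v'^+$ strictly in dominance order, or $v^+=v'^+$ and $v\prec v'$ strictly ($u\preceq w$ iff $\sum_{j\le k}u[j]\le\sum_{j\le k}w[j]$ for all $k$). $P$ has leading monomial $x^{v,\tau}$ if $P=c\,x^{v,\tau}+\sum_{v'\lhd v}c_{v',\tau'}x^{v',\tau'}$ with $c\ne0$. Definition of $J_{\mathcal{P}}$: $J_{[]}=1\otimes\tau_\lambda$; if $[a_1,\dots,a_{k-1}]$ ends at $(\tau,v)$ and $a_k$ is labeled $s_i$, then $J_{[a_1,\dots,a_k]}=J_{[a_1,\dots,a_{k-1}]}\big(s_i\otimes s_i+\frac{1}{\zeta_{v,\tau}[i+1]-\zeta_{v,\tau}[i]}\big)$; if $a_k$ is labeled $\Psi$, $J_{[a_1,\dots,a_k]}=J_{[a_1,\dots,a_{k-1}]}\Psi$. *)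

theory Defs
  imports Complex_Main "HOL-Library.Poly_Mapping"
    "HOL-Computational_Algebra.Polynomial" "HOL-Computational_Algebra.Fraction_Field"
    "HOL-Combinatorics.Transposition"
begin

hide_const (open) List.transpose

section \<open>Partitions and reverse standard tableaux\<close>

definition partition_of :: "nat list \<Rightarrow> nat \<Rightarrow> bool" where
  "partition_of lam N \<longleftrightarrow> sorted_wrt (\<ge>) lam \<and> 0 \<notin> set lam \<and> sum_list lam = N"

text \<open>Cells are pairs (row, column), both counted from 1; row 1 is the bottom row.\<close>

definition diagram :: "nat list \<Rightarrow> (nat \<times> nat) set" where
  "diagram lam = {(r, c). 1 \<le> r \<and> r \<le> length lam \<and> 1 \<le> c \<and> c \<le> lam ! (r - 1)}"

text \<open>A filling is extended by 0 outside the diagram, so that equality of fillings is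
  equality of functions.\<close>

type_synonym tableau = "nat \<times> nat \<Rightarrow> nat"

definition RST :: "nat list \<Rightarrow> tableau set" where
  "RST lam = {\<tau>. bij_betw \<tau> (diagram lam) {1..sum_list lam} \<and> (\<forall>p. p \<notin> diagram lam \<longrightarrow> \<tau> p = 0) \<and>
     (\<forall>r c c'. (r, c) \<in> diagram lam \<and> (r, c') \<in> diagram lam \<and> c < c' \<longrightarrow> \<tau> (r, c) > \<tau> (r, c')) \<and>
     (\<forall>r r' c. (r, c) \<in> diagram lam \<and> (r', c) \<in> diagram lam \<and> r < r' \<longrightarrow> \<tau> (r, c) > \<tau> (r', c))}"

definition CT :: "tableau \<Rightarrow> nat \<Rightarrow> int" where
  "CT \<tau> i = (THE d. \<exists>r c. \<tau> (r, c) = i \<and> d = int c - int r)"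

definition root_tableau :: "nat list \<Rightarrow> tableau" where
  "root_tableau lam = (\<lambda>(r, c). if (r, c) \<in> diagram lam
     then sum_list lam - card {(r', c') \<in> diagram lam. c' < c \<or> c' = c \<and> r' < r} else 0)"

definition tab_swap :: "nat \<Rightarrow> tableau \<Rightarrow> tableau" where
  "tab_swap i \<tau> = transpose i (Suc i) \<circ> \<tau>"

section \<open>Vectors\<close>

text \<open>Vectors in \<open>\<nat>\<^sup>N\<close> are lists of length \<open>N\<close>; \<open>entry\<close> gives access with indices from 1.\<close>

definition entry :: "'a list \<Rightarrow> nat \<Rightarrow> 'a" where
  "entry v i = v ! (i - 1)"

definition vplus :: "nat list \<Rightarrow> nat list" where
  "vplus v = rev (sort v)"

definition vswap :: "nat \<Rightarrow> nat list \<Rightarrow> nat list" where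
  "vswap i v = v[i - 1 := entry v (Suc i), i := entry v i]"

definition vPsi :: "nat list \<Rightarrow> nat list" where
  "vPsi v = tl v @ [hd v + 1]"

definition sigma :: "nat list \<Rightarrow> nat \<Rightarrow> nat" where
  "sigma v i = (if i \<in> {1..length v}
     then card {j \<in> {1..length v}. entry v j > entry v i \<or> entry v j = entry v i \<and> j \<le> i}
     else i)"

definition dom_le :: "nat list \<Rightarrow> nat list \<Rightarrow> bool" where
  "dom_le u w \<longleftrightarrow> (\<forall>k. sum_list (take k u) \<le> sum_list (take k w))"

definition dom_less :: "nat list \<Rightarrow> nat list \<Rightarrow> bool" where
  "dom_less u w \<longleftrightarrow> dom_le u w \<and> u \<noteq> w"

definition vlhd :: "nat list \<Rightarrow> nat list \<Rightarrow> bool" where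
  "vlhd u w \<longleftrightarrow> dom_less (vplus u) (vplus w) \<or> vplus u = vplus w \<and> dom_less u w"

section \<open>The field \<open>\<rat>(\<alpha>)\<close> and spectral vectors\<close>

type_synonym ratfun = "rat poly fract"

definition alpha :: ratfun where
  "alpha = Fract [:0, 1:] 1"

definition rat_const :: "rat \<Rightarrow> ratfun" where
  "rat_const q = Fract [:q:] 1"

definition zeta :: "nat list \<Rightarrow> tableau \<Rightarrow> nat \<Rightarrow> ratfun" where
  "zeta v \<tau> i = alpha * of_nat (entry v i) + of_int (CT \<tau> (sigma v i))"

section \<open>The graph\<close>

text \<open>The vertex \<open>\<emptyset>\<close> is \<open>None\<close>. Edges are triples (source, label, target).\<close>

type_synonym vertex = "(tableau \<times> nat list) option"

datatype label = S nat | Psi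

inductive edge :: "nat list \<Rightarrow> vertex \<Rightarrow> label \<Rightarrow> vertex \<Rightarrow> bool" for lam where
  affine: "edge lam (Some (\<tau>, v)) Psi (Some (\<tau>, vPsi v))"
| step: "\<lbrakk>1 \<le> i; i < length v; entry v i < entry v (Suc i)\<rbrakk>
    \<Longrightarrow> edge lam (Some (\<tau>, v)) (S i) (Some (\<tau>, vswap i v))"
| tab_step: "\<lbrakk>1 \<le> i; i < length v; entry v i = entry v (Suc i);
      CT \<tau> (sigma v i) - CT \<tau> (sigma v i + 1) \<ge> 2\<rbrakk>
    \<Longrightarrow> edge lam (Some (\<tau>, v)) (S i) (Some (tab_swap (sigma v i) \<tau>, v))"
| fall: "\<lbrakk>1 \<le> i; i < length v; entry v i = entry v (Suc i);
      tab_swap (sigma v i) \<tau> \<notin> RST lam\<rbrakk>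
    \<Longrightarrow> edge lam (Some (\<tau>, v)) (S i) None"

fun walk :: "nat list \<Rightarrow> vertex \<Rightarrow> (vertex \<times> label \<times> vertex) list \<Rightarrow> vertex \<Rightarrow> bool" where
  "walk lam x [] y \<longleftrightarrow> x = y"
| "walk lam x ((a, l, b) # es) y \<longleftrightarrow> a = x \<and> edge lam a l b \<and> walk lam b es y"

definition path_to :: "nat list \<Rightarrow> (vertex \<times> label \<times> vertex) list \<Rightarrow> vertex \<Rightarrow> bool" where
  "path_to lam es y \<longleftrightarrow> walk lam (Some (root_tableau lam, replicate (sum_list lam) 0)) es y"

section \<open>Polynomials over \<open>\<rat>(\<alpha>)\<close>\<close>

text \<open>Polynomials in variables indexed by \<open>nat\<close>; an exponent is a finitely supported map.\<close>

type_synonym mpol = "(nat \<Rightarrow>\<^sub>0 nat) \<Rightarrow>\<^sub>0 ratfun"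

definition var :: "nat \<Rightarrow> mpol" where
  "var i = Poly_Mapping.single (Poly_Mapping.single i 1) 1"

definition pconst :: "ratfun \<Rightarrow> mpol" where
  "pconst a = Poly_Mapping.single 0 a"

definition xpow :: "nat list \<Rightarrow> mpol" where
  "xpow v = (\<Prod>i = 1..length v. var i ^ entry v i)"

text \<open>The right action of permutations, \<open>x\<^sup>m \<omega> = x\<^sup>m\<^sup>\<circ>\<^sup>\<omega>\<close>; the product \<open>\<omega> \<omega>'\<close> is \<open>\<omega> \<circ> \<omega>'\<close>.\<close>

definition pol_act :: "(nat \<Rightarrow> nat) \<Rightarrow> mpol \<Rightarrow> mpol" where
  "pol_act \<omega> f = (\<Sum>m \<in> Poly_Mapping.keys f.
     Poly_Mapping.single (Poly_Mapping.map_key \<omega> m) (Poly_Mapping.lookup f m))"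

definition pol_deriv :: "nat \<Rightarrow> mpol \<Rightarrow> mpol" where
  "pol_deriv i f = (\<Sum>m \<in> Poly_Mapping.keys f.
     Poly_Mapping.single (m - Poly_Mapping.single i 1)
       (of_nat (Poly_Mapping.lookup m i) * Poly_Mapping.lookup f m))"

definition div_diff :: "nat \<Rightarrow> nat \<Rightarrow> mpol \<Rightarrow> mpol" where
  "div_diff i j f = (THE q. (var i - var j) * q = f - pol_act (transpose i j) f)"

section \<open>The representation \<open>V\<^sub>\<lambda>\<close>\<close>

text \<open>\<open>V\<^sub>\<lambda>\<close> consists of the vectors with keys in \<open>RST \<lambda>\<close>.\<close>

type_synonym tabvec = "tableau \<Rightarrow>\<^sub>0 ratfun"

definition tv :: "tableau \<Rightarrow> tabvec" where
  "tv \<tau> = Poly_Mapping.single \<tau> 1"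

definition vscale :: "ratfun \<Rightarrow> tabvec \<Rightarrow> tabvec" where
  "vscale a t = Poly_Mapping.map ((*) a) t"

definition tab_gen :: "nat \<Rightarrow> tableau \<Rightarrow> tabvec" where
  "tab_gen i \<tau> = (let b = 1 / rat_of_int (CT \<tau> i - CT \<tau> (Suc i)) in
     if b = 1 \<or> b = - 1 then vscale (rat_const b) (tv \<tau>)
     else if 0 < b \<and> b \<le> 1 / 2 then vscale (rat_const b) (tv \<tau>) + tv (tab_swap i \<tau>)
     else vscale (rat_const b) (tv \<tau>) + vscale (rat_const (1 - b\<^sup>2)) (tv (tab_swap i \<tau>)))"

definition vec_gen :: "nat \<Rightarrow> tabvec \<Rightarrow> tabvec" where
  "vec_gen i t = (\<Sum>\<tau> \<in> Poly_Mapping.keys t. vscale (Poly_Mapping.lookup t \<tau>) (tab_gen i \<tau>))"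

fun word_perm :: "nat list \<Rightarrow> nat \<Rightarrow> nat" where
  "word_perm [] = id"
| "word_perm (i # w) = transpose i (Suc i) \<circ> word_perm w"

text \<open>The action of \<open>\<omega> = s\<^bsub>i1\<^esub> \<dots> s\<^bsub>ik\<^esub>\<close> is that of \<open>s\<^bsub>i1\<^esub>\<close>, then \<open>s\<^bsub>i2\<^esub>\<close>, and so on. The operators
  \<open>vec_gen i\<close> satisfy the Coxeter relations on \<open>V\<^sub>\<lambda>\<close>, so the choice of the word is immaterial there.\<close>

definition vec_act :: "nat \<Rightarrow> (nat \<Rightarrow> nat) \<Rightarrow> tabvec \<Rightarrow> tabvec" where
  "vec_act N \<omega> t = fold vec_gen (SOME w. set w \<subseteq> {1..<N} \<and> word_perm w = \<omega>) t"

section \<open>The space \<open>M\<^sub>\<lambda>\<close>\<close>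

text \<open>The element \<open>\<Sum>\<^sub>\<tau> f\<^sub>\<tau> \<otimes> \<tau>\<close> is the map \<open>\<tau> \<mapsto> f\<^sub>\<tau>\<close>.\<close>

type_synonym vpol = "tableau \<Rightarrow>\<^sub>0 mpol"

definition tensor :: "mpol \<Rightarrow> tabvec \<Rightarrow> vpol" where
  "tensor f t = Poly_Mapping.map (\<lambda>a. pconst a * f) t"

definition pmul :: "mpol \<Rightarrow> vpol \<Rightarrow> vpol" where
  "pmul f P = Poly_Mapping.map ((*) f) P"

definition mscale :: "ratfun \<Rightarrow> vpol \<Rightarrow> vpol" where
  "mscale a P = pmul (pconst a) P"

definition M_space :: "nat list \<Rightarrow> vpol set" where
  "M_space lam = {P. Poly_Mapping.keys P \<subseteq> RST lam \<and>
     (\<forall>\<tau>. \<forall>m \<in> Poly_Mapping.keys (Poly_Mapping.lookup P \<tau>).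
        Poly_Mapping.keys m \<subseteq> {1..sum_list lam})}"

lemma lookup_mscale:
  "Poly_Mapping.lookup (mscale a P) \<tau> = pconst a * Poly_Mapping.lookup P \<tau>"
  by (simp add: mscale_def pmul_def Poly_Mapping.map.rep_eq when_def)

lemma pconst_simps:
  "pconst (a + b) = pconst a + pconst b" "pconst (a * b) = pconst a * pconst b" "pconst 1 = 1"
  by (simp_all add: pconst_def single_add mult_single)

global_interpretation M: vector_space mscale
  by standard
    (auto intro!: poly_mapping_eqI[where ?'a = tableau]
      simp: lookup_mscale lookup_add distrib_left distrib_right pconst_simps mult.assoc)

definition lin_ext :: "(mpol \<Rightarrow> tableau \<Rightarrow> vpol) \<Rightarrow> vpol \<Rightarrow> vpol" where
  "lin_ext T P = (\<Sum>\<tau> \<in> Poly_Mapping.keys P. T (Poly_Mapping.lookup P \<tau>) \<tau>)"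

definition diag_act :: "nat \<Rightarrow> (nat \<Rightarrow> nat) \<Rightarrow> vpol \<Rightarrow> vpol" where
  "diag_act N \<omega> = lin_ext (\<lambda>f \<tau>. tensor (pol_act \<omega> f) (vec_act N \<omega> (tv \<tau>)))"

definition Dunkl :: "nat \<Rightarrow> nat \<Rightarrow> vpol \<Rightarrow> vpol" where
  "Dunkl N i = lin_ext (\<lambda>f \<tau>. tensor (pol_deriv i f) (tv \<tau>) +
     mscale (1 / alpha)
       (\<Sum>j \<in> {1..N} - {i}. tensor (div_diff i j f) (vec_act N (transpose i j) (tv \<tau>))))"

definition Cherednik :: "nat \<Rightarrow> nat \<Rightarrow> vpol \<Rightarrow> vpol" where
  "Cherednik N i P = Dunkl N i (pmul (var i) P) -
     mscale (1 / alpha) (\<Sum>j \<in> {1..<i}. diag_act N (transpose i j) P)"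

definition xi :: "nat \<Rightarrow> nat \<Rightarrow> vpol \<Rightarrow> vpol" where
  "xi N i P = mscale alpha (Cherednik N i P) - mscale alpha P"

definition MPsi :: "nat \<Rightarrow> vpol \<Rightarrow> vpol" where
  "MPsi N P = pmul (var N) (diag_act N (word_perm [1..<N]) P)"

definition xmon :: "nat list \<Rightarrow> tableau \<Rightarrow> vpol" where
  "xmon v \<tau> = tensor (xpow v) (vec_act (length v) (sigma v) (tv \<tau>))"

definition leading_monomial :: "nat list \<Rightarrow> vpol \<Rightarrow> nat list \<Rightarrow> tableau \<Rightarrow> bool" where
  "leading_monomial lam P v \<tau> \<longleftrightarrow>
     (\<exists>c R. c \<noteq> 0 \<and> P = mscale c (xmon v \<tau>) + R \<and>
        R \<in> M.span {xmon v' \<tau>' |v' \<tau>'. length v' = sum_list lam \<and> \<tau>' \<in> RST lam \<and> vlhd v' v})"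

definition simult_eigenfunction ::
    "nat list \<Rightarrow> (nat \<Rightarrow> vpol \<Rightarrow> vpol) \<Rightarrow> (nat \<Rightarrow> ratfun) \<Rightarrow> vpol \<Rightarrow> bool" where
  "simult_eigenfunction lam T z P \<longleftrightarrow>
     P \<in> M_space lam \<and> P \<noteq> 0 \<and> (\<forall>i \<in> {1..sum_list lam}. T i P = mscale (z i) P)"

section \<open>The polynomials attached to paths\<close>

fun edge_op :: "nat \<Rightarrow> vertex \<times> label \<times> vertex \<Rightarrow> vpol \<Rightarrow> vpol" where
  "edge_op N (Some (\<tau>, v), S i, y) P =
     diag_act N (transpose i (Suc i)) P + mscale (1 / (zeta v \<tau> (Suc i) - zeta v \<tau> i)) P"
| "edge_op N (Some (\<tau>, v), Psi, y) P = MPsi N P"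
| "edge_op N (None, l, y) P = P" \<comment> \<open>no edge starts at \<open>\<emptyset>\<close>\<close>

definition J_path :: "nat list \<Rightarrow> (vertex \<times> label \<times> vertex) list \<Rightarrow> vpol" where
  "J_path lam es = fold (edge_op (sum_list lam)) es (tensor 1 (tv (root_tableau lam)))"

definition J_vertex :: "nat list \<Rightarrow> nat list \<Rightarrow> tableau \<Rightarrow> vpol" where
  "J_vertex lam v \<tau> = J_path lam (SOME es. path_to lam es (Some (\<tau>, v)))"

end

theory Submission
  imports Defs "HOL-Combinatorics.Permutations"
begin

hide_const (open) List.transpose

text \<open>
  The operators \<open>\<xi>\<^sub>i\<close> are triangular on monomials: \<open>\<xi>\<^sub>i\<close> maps \<open>x\<^sup>v \<otimes> \<tau>\<sigma>\<^sub>v\<close> to \<open>\<zeta>\<^sub>v\<^sub>,\<^sub>\<tau>[i]\<close> times itself plus terms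
  with smaller exponent vector, the constant \<open>CT\<^sub>\<tau>[\<sigma>\<^sub>v[i]]\<close> being the eigenvalue of a Jucys--Murphy element.
  Hence the \<open>\<alpha>\<close>-part of the spectrum of a joint eigenfunction determines every maximal exponent in its
  support, so there is exactly one and it dominates all others; an eigenfunction whose coefficient at
  that exponent vanishes is \<open>0\<close>. The exchange relations of \<open>\<xi>\<^sub>i\<close> with \<open>s\<^sub>i \<otimes> s\<^sub>i\<close> and with \<open>\<Psi>\<close> carry
  eigenfunctions along edges, and the coefficient at the expected exponent is followed explicitly: it
  is \<open>\<tau>\<sigma>\<^sub>v\<close> at a vertex \<open>(\<tau>, v)\<close> and \<open>0\<close> at \<open>\<emptyset>\<close>. This gives the leading monomial, the independence of the
  path, the vanishing at \<open>\<emptyset>\<close>, and the basis property. Following leading terms through the edges directly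
  does not work, because the dominance order is not preserved by \<open>s\<^sub>i\<close>.
\<close>

text \<open>The computations with \<open>xi N i\<close> rest on one rewriting: moving x_i through
  the Dunkl operator gives \<alpha> x_i d/dx_i, plus the sum over j \<noteq> i of x_i times the
  divided difference tensored with s_ij, plus the sum over j > i of s_ij \<otimes> s_ij. The first
  two parts are equivariant, so every exchange relation reduces to how a permutation moves the index
  set {i+1..N}. The \<alpha>-part of the spectrum can be isolated because all other contributions to
  the eigenvalues are integers. Path independence is an equality, not merely proportionality,
  because each edge keeps the coefficient at v normalized; at an edge between equal entries this is
  due to the coefficient 1 in the action of s_i when the content difference is at least 2.\<close>

abbreviation lookup :: "('a \<Rightarrow>\<^sub>0 'b::zero) \<Rightarrow> 'a \<Rightarrow> 'b" where
  "lookup \<equiv> Poly_Mapping.lookup"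

abbreviation single :: "'a \<Rightarrow> 'b \<Rightarrow> 'a \<Rightarrow>\<^sub>0 'b::zero" where
  "single \<equiv> Poly_Mapping.single"

abbreviation keys :: "('a \<Rightarrow>\<^sub>0 'b::zero) \<Rightarrow> 'a set" where
  "keys \<equiv> Poly_Mapping.keys"

abbreviation map_key :: "('a \<Rightarrow> 'b) \<Rightarrow> ('b \<Rightarrow>\<^sub>0 'c::zero) \<Rightarrow> 'a \<Rightarrow>\<^sub>0 'c" where
  "map_key \<equiv> Poly_Mapping.map_key"

declare One_nat_def [simp del]

section \<open>Ranks in a finite strict total order\<close>

context
  fixes A :: "'a set" and R :: "'a \<Rightarrow> 'a \<Rightarrow> bool"
  assumes finite: "finite A"
    and irrefl: "\<And>x. x \<in> A \<Longrightarrow> \<not> R x x"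
    and trans: "\<And>x y z. x \<in> A \<Longrightarrow> y \<in> A \<Longrightarrow> z \<in> A \<Longrightarrow> R x y \<Longrightarrow> R y z \<Longrightarrow> R x z"
    and total: "\<And>x y. x \<in> A \<Longrightarrow> y \<in> A \<Longrightarrow> x \<noteq> y \<Longrightarrow> R x y \<or> R y x"
begin

lemma rank_less:
  assumes "x \<in> A" "y \<in> A" "R x y"
  shows "card {z \<in> A. R z x} < card {z \<in> A. R z y}"
proof (rule psubset_card_mono)
  show "finite {z \<in> A. R z y}" using finite by simp
  have "{z \<in> A. R z x} \<subseteq> {z \<in> A. R z y}" using trans assms by blast
  moreover have "x \<in> {z \<in> A. R z y} - {z \<in> A. R z x}" using assms irrefl by blast
  ultimately show "{z \<in> A. R z x} \<subset> {z \<in> A. R z y}" by blast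
qed

lemma rank_less_iff:
  assumes "x \<in> A" "y \<in> A"
  shows "card {z \<in> A. R z x} < card {z \<in> A. R z y} \<longleftrightarrow> R x y"
  using rank_less[OF assms] rank_less[OF assms(2,1)] total[OF assms] by fastforce

text \<open>Ranks are strictly monotone, hence injective, and counting forces them onto an initial
  segment. Serves both the reading order of cells and the standardization
  \<open>sigma\<close>.\<close>

lemma bij_betw_rank: "bij_betw (\<lambda>x. card {z \<in> A. R z x}) A {..<card A}"
proof -
  have inj: "inj_on (\<lambda>x. card {z \<in> A. R z x}) A"
  proof (rule inj_onI)
    fix x y assume xy: "x \<in> A" "y \<in> A" "card {z \<in> A. R z x} = card {z \<in> A. R z y}"
    then show "x = y"
      using rank_less[OF xy(1,2)] rank_less[OF xy(2,1)] total[OF xy(1,2)] by fastforce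
  qed
  have "(\<lambda>x. card {z \<in> A. R z x}) ` A \<subseteq> {..<card A}"
  proof safe
    fix x assume "x \<in> A"
    then have "{z \<in> A. R z x} \<subset> A" using irrefl by auto
    then show "card {z \<in> A. R z x} < card A" by (rule psubset_card_mono[OF finite])
  qed
  then have "(\<lambda>x. card {z \<in> A. R z x}) ` A = {..<card A}"
    by (intro card_subset_eq) (auto simp: card_image[OF inj])
  then show ?thesis using inj by (simp add: bij_betw_def)
qed

end

section \<open>The Coxeter presentation of the symmetric group\<close>

text \<open>Equality of words in the abstract Coxeter group of type A. All generating rules are
  restricted to letters in {1..<n}, so that both sides of a derived relation stay over the alphabet
  whose operators preserve \<open>V_space\<close>.\<close>

inductive coxeter_eq :: "nat \<Rightarrow> nat list \<Rightarrow> nat list \<Rightarrow> bool" for n where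
  cox_refl: "set u \<subseteq> {1..<n} \<Longrightarrow> coxeter_eq n u u"
| cox_sym: "coxeter_eq n u v \<Longrightarrow> coxeter_eq n v u"
| cox_trans: "coxeter_eq n u v \<Longrightarrow> coxeter_eq n v w \<Longrightarrow> coxeter_eq n u w"
| cox_append: "coxeter_eq n u v \<Longrightarrow> coxeter_eq n u' v' \<Longrightarrow> coxeter_eq n (u @ u') (v @ v')"
| cox_involution: "1 \<le> i \<Longrightarrow> i < n \<Longrightarrow> coxeter_eq n [i, i] []"
| cox_commute: "1 \<le> i \<Longrightarrow> Suc i < j \<Longrightarrow> j < n \<Longrightarrow> coxeter_eq n [i, j] [j, i]"
| cox_braid: "1 \<le> i \<Longrightarrow> Suc i < n \<Longrightarrow> coxeter_eq n [i, Suc i, i] [Suc i, i, Suc i]"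

lemma coxeter_eq_letters: "coxeter_eq n u v \<Longrightarrow> set u \<subseteq> {1..<n} \<and> set v \<subseteq> {1..<n}"
  by (induction rule: coxeter_eq.induct) auto

lemma word_perm_append: "word_perm (u @ v) = word_perm u \<circ> word_perm v"
  by (induction u) auto

lemma word_perm_coxeter: "coxeter_eq n u v \<Longrightarrow> word_perm u = word_perm v"
proof (induction rule: coxeter_eq.induct)
  case (cox_append u v u' v')
  then show ?case by (simp add: word_perm_append)
qed (auto simp: fun_eq_iff transpose_def)

lemma coxeter_eq_mono: "coxeter_eq n u v \<Longrightarrow> n \<le> m \<Longrightarrow> coxeter_eq m u v"
proof (induction rule: coxeter_eq.induct)
  case (cox_refl u)
  then show ?case by (intro coxeter_eq.cox_refl) auto
next
  case (cox_sym u v)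
  then show ?case by (auto intro: coxeter_eq.cox_sym)
next
  case (cox_trans u v w)
  then show ?case by (blast intro: coxeter_eq.cox_trans)
next
  case (cox_append u v u' v')
  then show ?case by (auto intro: coxeter_eq.cox_append)
qed (auto intro: coxeter_eq.cox_involution coxeter_eq.cox_commute coxeter_eq.cox_braid)

lemma coxeter_commute_list:
  assumes "1 \<le> i" "i < n" "set w \<subseteq> {1..<n}" "\<And>j. j \<in> set w \<Longrightarrow> Suc i < j \<or> Suc j < i"
  shows "coxeter_eq n (w @ [i]) (i # w)"
  using assms(3,4)
proof (induction w)
  case Nil
  then show ?case using assms by (auto intro: coxeter_eq.cox_refl)
next
  case (Cons a w)
  have 1: "coxeter_eq n ([a] @ (w @ [i])) ([a] @ (i # w))"
    by (rule coxeter_eq.cox_append) (use Cons in \<open>auto intro: coxeter_eq.cox_refl\<close>)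
  have "coxeter_eq n [a, i] [i, a]"
    using Cons.prems(1) Cons.prems(2)[of a] assms(1,2) coxeter_eq.cox_commute[of a i n]
      coxeter_eq.cox_sym[OF coxeter_eq.cox_commute[of i a n]] by auto
  then have 2: "coxeter_eq n ([a, i] @ w) ([i, a] @ w)"
    by (rule coxeter_eq.cox_append) (use Cons in \<open>auto intro: coxeter_eq.cox_refl\<close>)
  show ?case using coxeter_eq.cox_trans[OF 1] 2 by simp
qed

lemma rev_upt_split: "k \<le> j \<Longrightarrow> j \<le> n \<Longrightarrow> rev [k..<n] = rev [j..<n] @ rev [k..<j]"
  by (metis rev_append le_add_diff_inverse upt_add_eq_append)

text \<open>A letter appended to the run s_n ... s_k is absorbed or passes to the left as a letter
  below n: for i < k - 1 it commutes with the run, i = k - 1 lengthens it, i = k shortens it, and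
  for i > k the braid relation lets it through as i - 1.\<close>

lemma coxeter_descending_run_snoc:
  assumes "1 \<le> k" "k \<le> Suc n" "1 \<le> i" "i \<le> n"
  shows "\<exists>w' k'. set w' \<subseteq> {1..<n} \<and> 1 \<le> k' \<and> k' \<le> Suc n \<and>
    coxeter_eq (Suc n) (rev [k..<Suc n] @ [i]) (w' @ rev [k'..<Suc n])"
proof -
  consider "Suc i < k" | "Suc i = k" | "i = k" | "k < i" by linarith
  then show ?thesis
  proof cases
    case 1
    have "coxeter_eq (Suc n) (rev [k..<Suc n] @ [i]) (i # rev [k..<Suc n])"
      by (rule coxeter_commute_list) (use assms 1 in auto)
    then show ?thesis using assms 1 by (intro exI[of _ "[i]"] exI[of _ k]) auto
  next
    case 2
    then have "rev [k..<Suc n] @ [i] = rev [i..<Suc n]"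
      using assms rev_upt_split[of i k "Suc n"] by auto
    moreover have "coxeter_eq (Suc n) (rev [i..<Suc n]) (rev [i..<Suc n])"
      using assms by (intro coxeter_eq.cox_refl) auto
    ultimately show ?thesis using assms 2 by (intro exI[of _ "[]"] exI[of _ i]) auto
  next
    case 3
    then have "rev [k..<Suc n] @ [i] = rev [Suc i..<Suc n] @ [i, i]"
      using assms rev_upt_split[of i "Suc i" "Suc n"] by auto
    moreover have "coxeter_eq (Suc n) (rev [Suc i..<Suc n] @ [i, i]) (rev [Suc i..<Suc n] @ [])"
      by (rule coxeter_eq.cox_append) (use assms in \<open>auto intro!: coxeter_eq.cox_refl
          coxeter_eq.cox_involution\<close>)
    ultimately show ?thesis using assms 3 by (intro exI[of _ "[]"] exI[of _ "Suc i"]) auto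
  next
    case 4
    then obtain j where j: "i = Suc j" "k \<le> j" by (cases i) auto
    define A where "A = rev [Suc i..<Suc n]"
    define B where "B = rev [k..<j]"
    have AB: "set A \<subseteq> {Suc i..n}" "set B \<subseteq> {k..<j}" by (auto simp: A_def B_def)
    \<comment> \<open>The factors i and i - 1 of the run are isolated: \<open>B\<close> commutes
      with s_i, then a braid move applies, then \<open>A\<close> commutes with the resulting letter
      i - 1.\<close>
    have split: "rev [k..<Suc n] = A @ [i, j] @ B"
      using rev_upt_split[of k "Suc i" "Suc n"] j assms unfolding A_def B_def by simp
    have letters: "set A \<subseteq> {1..<Suc n}" "set B \<subseteq> {1..<Suc n}" "1 \<le> j"
      using AB assms j by auto
    have r: "coxeter_eq (Suc n) A A" "coxeter_eq (Suc n) B B"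
      using letters by (auto intro: coxeter_eq.cox_refl)
    have "coxeter_eq (Suc n) (B @ [i]) (i # B)"
      by (rule coxeter_commute_list) (use letters AB j assms in auto)
    then have 1: "coxeter_eq (Suc n) (A @ [i, j] @ (B @ [i])) (A @ [i, j] @ (i # B))"
      by (intro coxeter_eq.cox_append[OF r(1) coxeter_eq.cox_append] coxeter_eq.cox_refl)
        (use assms j letters in auto)
    have "coxeter_eq (Suc n) [i, j, i] [j, i, j]"
      using j assms letters by (auto intro!: coxeter_eq.cox_sym[OF coxeter_eq.cox_braid])
    then have 2: "coxeter_eq (Suc n) (A @ [i, j, i] @ B) (A @ [j, i, j] @ B)"
      by (rule coxeter_eq.cox_append[OF r(1) coxeter_eq.cox_append[OF _ r(2)]])
    have "coxeter_eq (Suc n) (A @ [j]) (j # A)"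
      by (rule coxeter_commute_list) (use letters AB j assms in auto)
    then have 3: "coxeter_eq (Suc n) ((A @ [j]) @ ([i, j] @ B)) ((j # A) @ ([i, j] @ B))"
      by (rule coxeter_eq.cox_append) (use assms j letters(2,3) in \<open>force intro!: coxeter_eq.cox_refl\<close>)
    have "coxeter_eq (Suc n) (rev [k..<Suc n] @ [i]) ([j] @ rev [k..<Suc n])"
      using coxeter_eq.cox_trans[OF coxeter_eq.cox_trans[OF 1[simplified] 2[simplified]] 3[simplified]]
      unfolding split by simp
    then show ?thesis using assms j letters by (intro exI[of _ "[j]"] exI[of _ k]) auto
  qed
qed

text \<open>The runs represent the cosets of the symmetric group on n letters in that on n + 1
  letters. By \<open>coxeter_descending_run_snoc\<close> such products are stable under appending a
  letter, so every word reduces to one.\<close>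

lemma coxeter_normal_form:
  assumes "set w \<subseteq> {1..<Suc n}"
  shows "\<exists>w' k. set w' \<subseteq> {1..<n} \<and> 1 \<le> k \<and> k \<le> Suc n \<and>
    coxeter_eq (Suc n) w (w' @ rev [k..<Suc n])"
  using assms
proof (induction w rule: rev_induct)
  case Nil
  show ?case by (intro exI[of _ "[]"] exI[of _ "Suc n"]) (auto intro: coxeter_eq.cox_refl)
next
  case (snoc i w)
  then obtain w' k where w': "set w' \<subseteq> {1..<n}" "1 \<le> k" "k \<le> Suc n"
    "coxeter_eq (Suc n) w (w' @ rev [k..<Suc n])" by auto
  obtain w'' k' where w'': "set w'' \<subseteq> {1..<n}" "1 \<le> k'" "k' \<le> Suc n"
    "coxeter_eq (Suc n) (rev [k..<Suc n] @ [i]) (w'' @ rev [k'..<Suc n])"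
    using coxeter_descending_run_snoc[OF w'(2,3), of i] snoc.prems by auto
  have 1: "coxeter_eq (Suc n) (w @ [i]) ((w' @ rev [k..<Suc n]) @ [i])"
    by (rule coxeter_eq.cox_append[OF w'(4)]) (use snoc.prems in \<open>auto intro: coxeter_eq.cox_refl\<close>)
  have 2: "coxeter_eq (Suc n) (w' @ (rev [k..<Suc n] @ [i])) (w' @ (w'' @ rev [k'..<Suc n]))"
    by (rule coxeter_eq.cox_append[OF _ w''(4)]) (use w' in \<open>auto intro!: coxeter_eq.cox_refl\<close>)
  show ?case using coxeter_eq.cox_trans[OF 1, of "w' @ (w'' @ rev [k'..<Suc n])"] 2 w' w''
    by (intro exI[of _ "w' @ w''"] exI[of _ k']) auto
qed

lemma word_perm_fixes: "set w \<subseteq> {1..<n} \<Longrightarrow> n < m \<Longrightarrow> word_perm w m = m"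
  by (induction w) (auto simp: transpose_def)

lemma word_perm_permutes: "set w \<subseteq> {1..<n} \<Longrightarrow> word_perm w permutes {1..n}"
proof (induction w)
  case Nil
  then show ?case by (simp add: permutes_def)
next
  case (Cons i w)
  then have "transpose i (Suc i) permutes {1..n}" by (intro permutes_swap_id) auto
  then show ?case unfolding word_perm.simps by (rule permutes_compose[rotated]) (use Cons in auto)
qed

lemma word_perm_run: "k \<le> n \<Longrightarrow> word_perm (rev [k..<n]) k = n"
  by (induction n) (auto simp: le_Suc_eq)

text \<open>In the normal form \<open>w' s\<^sub>n \<dots> s\<^sub>k\<close> the index \<open>k\<close> is the preimage of \<open>n + 1\<close>, so it is determined by the
  permutation.\<close>

theorem coxeter_eq_of_word_perm:
  assumes "set u \<subseteq> {1..<n}" "set v \<subseteq> {1..<n}" "word_perm u = word_perm v"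
  shows "coxeter_eq n u v"
  using assms
proof (induction n arbitrary: u v)
  case 0
  then show ?case by (auto intro: coxeter_eq.cox_refl)
next
  case (Suc n)
  obtain u' k where u': "set u' \<subseteq> {1..<n}" "1 \<le> k" "k \<le> Suc n"
    "coxeter_eq (Suc n) u (u' @ rev [k..<Suc n])" using coxeter_normal_form Suc.prems(1) by metis
  obtain v' l where v': "set v' \<subseteq> {1..<n}" "1 \<le> l" "l \<le> Suc n"
    "coxeter_eq (Suc n) v (v' @ rev [l..<Suc n])" using coxeter_normal_form Suc.prems(2) by metis
  show ?case
  proof (cases "n = 0")
    case True
    then have "u = []" "v = []" using Suc.prems by auto
    then show ?thesis by (auto intro: coxeter_eq.cox_refl)
  next
    case False
    let ?R = "\<lambda>k. word_perm (rev [k..<Suc n])"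
    have eq: "word_perm u' \<circ> ?R k = word_perm v' \<circ> ?R l"
      using word_perm_coxeter[OF u'(4)] word_perm_coxeter[OF v'(4)] Suc.prems(3)
      by (simp only: word_perm_append)
    have "word_perm u' (?R k k) = Suc n" "word_perm v' (?R l l) = Suc n"
      using u' v' by (simp_all only: word_perm_run) (auto intro!: word_perm_fixes[where n = n])
    then have "(word_perm v' \<circ> ?R l) k = (word_perm v' \<circ> ?R l) l"
      using eq by (metis comp_apply)
    moreover have "inj (word_perm v' \<circ> ?R l)"
      unfolding word_perm_append[symmetric]
      by (rule permutes_inj[OF word_perm_permutes[where n = "Suc n"]]) (use v' in auto)
    ultimately have "k = l" by (rule injD[rotated])
    \<comment> \<open>Surjectivity lets the common run be cancelled on the right, and the induction
      hypothesis applies to the prefixes.\<close>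
    have "surj (?R k)"
      by (rule permutes_surj[OF word_perm_permutes[where n = "Suc n"]]) (use u' in auto)
    then have "word_perm u' = word_perm v'"
      using eq \<open>k = l\<close> unfolding fun_eq_iff by (metis comp_apply surjD)
    then have "coxeter_eq n u' v'" using Suc.IH u' v' by blast
    then have "coxeter_eq (Suc n) (u' @ rev [k..<Suc n]) (v' @ rev [l..<Suc n])"
      unfolding \<open>k = l\<close>
      by (intro coxeter_eq.cox_append coxeter_eq_mono[where n = n and m = "Suc n"] coxeter_eq.cox_refl)
        (use v' in auto)
    then show ?thesis
      using coxeter_eq.cox_trans[OF u'(4)] coxeter_eq.cox_sym[OF v'(4)] coxeter_eq.cox_trans by blast
  qed
qed

lemma transposition_word:
  assumes "1 \<le> i" "i < j" "j \<le> n"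
  shows "\<exists>w. set w \<subseteq> {1..<n} \<and> word_perm w = transpose i j"
  using assms
proof (induction "j - i" arbitrary: i)
  case 0
  then show ?case by auto
next
  case (Suc d)
  show ?case
  proof (cases "j = Suc i")
    case True
    then show ?thesis using Suc.prems by (intro exI[of _ "[i]"]) auto
  next
    case False
    then obtain w where w: "set w \<subseteq> {1..<n}" "word_perm w = transpose (Suc i) j"
      using Suc.hyps(1)[of "Suc i"] Suc.hyps(2) Suc.prems by force
    have "word_perm ([i] @ w @ [i]) = transpose i j"
      unfolding word_perm_append w using False Suc.prems
      by (auto simp: fun_eq_iff transpose_def)
    then show ?thesis using w Suc.prems by (intro exI[of _ "[i] @ w @ [i]"]) auto
  qed
qed

lemma permutes_word:
  assumes "p permutes {1..n}"
  shows "\<exists>w. set w \<subseteq> {1..<n} \<and> word_perm w = p"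
proof (induction rule: permutes_induct[OF assms finite_atLeastAtMost])
  case 1
  show ?case by (intro exI[of _ "[]"]) auto
next
  case (2 a b p)
  then obtain w where w: "set w \<subseteq> {1..<n}" "word_perm w = p" by auto
  obtain w' where "set w' \<subseteq> {1..<n}" "word_perm w' = transpose a b"
    using transposition_word[of a b n] transposition_word[of b a n] 2
    by (metis atLeastAtMost_iff linorder_neqE_nat transpose_commute)
  then show ?case using w by (intro exI[of _ "w' @ w"]) (auto simp: word_perm_append)
qed

text \<open>Operators satisfying the Coxeter relations act through the permutation. The invariant
  set \<open>V\<close> is built in because the braid relation for \<open>vec_gen\<close> relies on
  distinct contents, which are guaranteed on the span of the RSTs.\<close>

lemma fold_coxeter:
  assumes "coxeter_eq n u v"
    and closed: "\<And>i x. 1 \<le> i \<Longrightarrow> i < n \<Longrightarrow> x \<in> V \<Longrightarrow> g i x \<in> V"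
    and inv: "\<And>i x. 1 \<le> i \<Longrightarrow> i < n \<Longrightarrow> x \<in> V \<Longrightarrow> g i (g i x) = x"
    and comm: "\<And>i j x. 1 \<le> i \<Longrightarrow> Suc i < j \<Longrightarrow> j < n \<Longrightarrow> x \<in> V \<Longrightarrow> g i (g j x) = g j (g i x)"
    and braid: "\<And>i x. 1 \<le> i \<Longrightarrow> Suc i < n \<Longrightarrow> x \<in> V \<Longrightarrow>
      g i (g (Suc i) (g i x)) = g (Suc i) (g i (g (Suc i) x))"
    and "x \<in> V"
  shows "fold g u x = fold g v x"
proof -
  have V: "fold g w x \<in> V" if "set w \<subseteq> {1..<n}" "x \<in> V" for w x
    using that by (induction w arbitrary: x) (simp_all add: closed)
  show ?thesis using assms(1) \<open>x \<in> V\<close>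
  proof (induction arbitrary: x rule: coxeter_eq.induct)
    case (cox_append u v u' v')
    then show ?case using V coxeter_eq_letters by fastforce
  qed (auto simp: inv comm[symmetric] braid)
qed

section \<open>Reverse standard tableaux\<close>

lemma CT_tab_swap: "CT (tab_swap i \<tau>) j = CT \<tau> (transpose i (Suc i) j)"
proof -
  have "transpose i (Suc i) x = j \<longleftrightarrow> x = transpose i (Suc i) j" for x
    by (auto simp: transpose_def)
  then show ?thesis by (simp add: CT_def tab_swap_def)
qed

lemma tab_swap_tab_swap [simp]: "tab_swap i (tab_swap i \<tau>) = \<tau>"
  by (simp add: tab_swap_def fun_eq_iff)

locale partition_shape =
  fixes lam :: "nat list" and N :: nat
  assumes partition: "partition_of lam N" and N_pos: "N \<ge> 1"
begin

lemma sum_lam [simp]: "sum_list lam = N"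
  using partition by (simp add: partition_of_def)

lemma diagram_down_closed:
  assumes "(r, c) \<in> diagram lam" "1 \<le> r'" "r' \<le> r" "1 \<le> c'" "c' \<le> c"
  shows "(r', c') \<in> diagram lam"
proof -
  have "lam ! (r - 1) \<le> lam ! (r' - 1)"
  proof (cases "r' = r")
    case False
    then have "r' - 1 < r - 1" "r - 1 < length lam"
      using assms by (auto simp: diagram_def)
    then show ?thesis
      using partition by (auto simp: partition_of_def sorted_wrt_iff_nth_less)
  qed simp
  then show ?thesis using assms by (auto simp: diagram_def)
qed

lemma diagram_eq_Sigma: "diagram lam = Sigma {1..length lam} (\<lambda>r. {1..lam ! (r - 1)})"
  by (auto simp: diagram_def)

lemma finite_diagram [simp]: "finite (diagram lam)"
  by (simp add: diagram_eq_Sigma)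

lemma card_diagram: "card (diagram lam) = N"
proof -
  have "card (diagram lam) = (\<Sum>r = 1..length lam. lam ! (r - 1))"
    by (simp add: diagram_eq_Sigma)
  also have "\<dots> = (\<Sum>k < length lam. lam ! k)"
    by (rule sum.reindex_bij_witness[of _ Suc "\<lambda>r. r - 1"]) auto
  also have "\<dots> = N"
    by (metis sum_lam sum_list_sum_nth atLeast0LessThan)
  finally show ?thesis .
qed

lemma corner_in_diagram: "(1, 1) \<in> diagram lam"
proof -
  obtain r c where "(r, c) \<in> diagram lam"
    using card_diagram N_pos by (cases "diagram lam = {}") auto
  then show ?thesis
    using diagram_down_closed[of r c 1 1] by (auto simp: diagram_def)
qed

lemma RST_bij: "\<tau> \<in> RST lam \<Longrightarrow> bij_betw \<tau> (diagram lam) {1..N}"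
  by (simp add: RST_def)

lemma RST_outside: "\<tau> \<in> RST lam \<Longrightarrow> p \<notin> diagram lam \<Longrightarrow> \<tau> p = 0"
  unfolding RST_def by blast

lemma RST_range: "\<tau> \<in> RST lam \<Longrightarrow> p \<in> diagram lam \<Longrightarrow> 1 \<le> \<tau> p \<and> \<tau> p \<le> N"
  using RST_bij bij_betwE by fastforce

lemma RST_inj:
  "\<tau> \<in> RST lam \<Longrightarrow> p \<in> diagram lam \<Longrightarrow> q \<in> diagram lam \<Longrightarrow> \<tau> p = \<tau> q \<Longrightarrow> p = q"
  using RST_bij by (auto simp: bij_betw_def dest: inj_onD)

lemma RST_row:
  "\<tau> \<in> RST lam \<Longrightarrow> (r, c) \<in> diagram lam \<Longrightarrow> (r, c') \<in> diagram lam \<Longrightarrow> c < c' \<Longrightarrow> \<tau> (r, c') < \<tau> (r, c)"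
  by (auto simp: RST_def)

lemma RST_column:
  "\<tau> \<in> RST lam \<Longrightarrow> (r, c) \<in> diagram lam \<Longrightarrow> (r', c) \<in> diagram lam \<Longrightarrow> r < r' \<Longrightarrow> \<tau> (r', c) < \<tau> (r, c)"
  by (auto simp: RST_def)

lemma RST_decreasing:
  assumes \<tau>: "\<tau> \<in> RST lam" and D: "(r, c) \<in> diagram lam" "(r', c') \<in> diagram lam"
    and le: "r \<le> r'" "c \<le> c'" "(r, c) \<noteq> (r', c')"
  shows "\<tau> (r', c') < \<tau> (r, c)"
proof -
  have m: "(r, c') \<in> diagram lam"
    using D le by (intro diagram_down_closed[OF D(2)]) (auto simp: diagram_def)
  have "\<tau> (r, c') \<le> \<tau> (r, c)" using RST_row[OF \<tau> D(1) m] le by (cases "c = c'") auto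
  moreover have "\<tau> (r', c') \<le> \<tau> (r, c')" using RST_column[OF \<tau> m D(2)] le by (cases "r = r'") auto
  moreover have "\<tau> (r', c') \<noteq> \<tau> (r, c)" using RST_inj[OF \<tau> D] le by auto
  ultimately show ?thesis by linarith
qed

lemma RST_cell:
  assumes "\<tau> \<in> RST lam" "1 \<le> i" "i \<le> N"
  obtains r c where "(r, c) \<in> diagram lam" "\<tau> (r, c) = i"
proof -
  have "i \<in> \<tau> ` diagram lam" using RST_bij[OF assms(1)] assms by (simp add: bij_betw_def)
  then show ?thesis using that by auto
qed

lemma CT_cell:
  assumes "\<tau> \<in> RST lam" "(r, c) \<in> diagram lam"
  shows "CT \<tau> (\<tau> (r, c)) = int c - int r"
  unfolding CT_def
proof (rule the_equality)
  fix d assume "\<exists>r' c'. \<tau> (r', c') = \<tau> (r, c) \<and> d = int c' - int r'"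
  then obtain r' c' where *: "\<tau> (r', c') = \<tau> (r, c)" "d = int c' - int r'" by auto
  then have "(r', c') \<in> diagram lam"
    using RST_range[OF assms] RST_outside[OF assms(1), of "(r', c')"] by fastforce
  then show "d = int c - int r" using RST_inj[OF assms(1)] assms(2) * by blast
qed auto

text \<open>Entries decrease away from the corner cell, which therefore carries N. This is the base
  of the downward induction in \<open>jucys_murphy\<close>.\<close>

lemma CT_max: assumes "\<tau> \<in> RST lam" shows "CT \<tau> N = 0"
proof -
  obtain r c where rc: "(r, c) \<in> diagram lam" "\<tau> (r, c) = N"
    using RST_cell[OF assms N_pos] by auto
  have "(r, c) = (1, 1)"
    using RST_decreasing[OF assms corner_in_diagram rc(1)] RST_range[OF assms corner_in_diagram] rc
    by (fastforce simp: diagram_def)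
  then show ?thesis using CT_cell[OF assms rc(1)] rc by simp
qed

text \<open>Cells on one diagonal are comparable, so i + 1 would be the lower left one, and then a
  corner of the rectangle they span would carry an entry strictly between i and i + 1. Hence the
  denominators of the action are nonzero.\<close>

lemma CT_Suc_neq:
  assumes "\<tau> \<in> RST lam" "1 \<le> i" "i < N"
  shows "CT \<tau> i \<noteq> CT \<tau> (Suc i)"
proof
  assume eq: "CT \<tau> i = CT \<tau> (Suc i)"
  obtain r c where rc: "(r, c) \<in> diagram lam" "\<tau> (r, c) = i"
    using RST_cell[OF assms(1,2)] assms by auto
  obtain r' c' where rc': "(r', c') \<in> diagram lam" "\<tau> (r', c') = Suc i"
    using RST_cell[OF assms(1), of "Suc i"] assms by auto
  have e: "int c - int r = int c' - int r'"
    using CT_cell[OF assms(1) rc(1)] CT_cell[OF assms(1) rc'(1)] rc rc' eq by simp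
  have ne: "(r, c) \<noteq> (r', c')" using rc rc' by auto
  show False
  proof (cases "r \<le> r'")
    case True
    then show False using RST_decreasing[OF assms(1) rc(1) rc'(1)] e ne rc rc' by auto
  next
    case False
    then have l: "r' < r" "c' < c" using e by auto
    have m: "(r', c) \<in> diagram lam"
      using rc' l by (intro diagram_down_closed[OF rc(1)]) (auto simp: diagram_def)
    show False using RST_row[OF assms(1) rc'(1) m l(2)] RST_column[OF assms(1) m rc(1) l(1)]
        rc rc' by simp
  qed
qed

text \<open>The rectangle spanned by the two cells has two further corners, both forced to carry i +
  1. Together with \<open>CT_Suc_neq\<close> this makes all three denominators of the braid
  computation nonzero.\<close>

lemma CT_Suc_Suc_neq:
  assumes "\<tau> \<in> RST lam" "1 \<le> i" "Suc i < N"
  shows "CT \<tau> i \<noteq> CT \<tau> (Suc (Suc i))"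
proof
  assume eq: "CT \<tau> i = CT \<tau> (Suc (Suc i))"
  obtain r c where rc: "(r, c) \<in> diagram lam" "\<tau> (r, c) = i"
    using RST_cell[OF assms(1,2)] assms by auto
  obtain r' c' where rc': "(r', c') \<in> diagram lam" "\<tau> (r', c') = Suc (Suc i)"
    using RST_cell[OF assms(1), of "Suc (Suc i)"] assms by auto
  have e: "int c - int r = int c' - int r'"
    using CT_cell[OF assms(1) rc(1)] CT_cell[OF assms(1) rc'(1)] rc rc' eq by simp
  have ne: "(r, c) \<noteq> (r', c')" using rc rc' by auto
  show False
  proof (cases "r \<le> r'")
    case True
    then show False using RST_decreasing[OF assms(1) rc(1) rc'(1)] e ne rc rc' by auto
  next
    case False
    then have l: "r' < r" "c' < c" using e by auto
    have m: "(r', c) \<in> diagram lam" "(r, c') \<in> diagram lam"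
      by (rule diagram_down_closed[OF rc(1)]; use rc rc' l in \<open>simp add: diagram_def\<close>)+
    have "\<tau> (r', c) = Suc i" "\<tau> (r, c') = Suc i"
      using RST_row[OF assms(1) rc'(1) m(1) l(2)] RST_column[OF assms(1) m(1) rc(1) l(1)]
        RST_row[OF assms(1) m(2) rc(1) l(2)] RST_column[OF assms(1) rc'(1) m(2) l(1)] rc rc'
      by simp_all
    then show False using RST_inj[OF assms(1) m] l by simp
  qed
qed

text \<open>Interchanging i and i + 1 reverses no other comparison, so it can fail only for two
  cells of one row or column. These must be adjacent, as no entry is left for a cell between them,
  and their contents then differ by 1.\<close>

lemma tab_swap_RST:
  assumes \<tau>: "\<tau> \<in> RST lam" and i: "1 \<le> i" "i < N"
    and far: "\<bar>CT \<tau> i - CT \<tau> (Suc i)\<bar> \<noteq> 1"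
  shows "tab_swap i \<tau> \<in> RST lam"
proof -
  let ?s = "transpose i (Suc i)"
  have "bij_betw ?s {1..N} {1..N}"
    by (rule permutes_imp_bij[OF permutes_swap_id]) (use i in auto)
  then have bij: "bij_betw (tab_swap i \<tau>) (diagram lam) {1..N}"
    unfolding tab_swap_def by (rule bij_betw_trans[OF RST_bij[OF \<tau>]])
  have mono: "?s x < ?s y" if "x < y" "\<not> (x = i \<and> y = Suc i)" for x y
    using that by (auto simp: transpose_def)
  have row: "\<tau> (r, c') < \<tau> (r, c) \<and> \<not> (\<tau> (r, c') = i \<and> \<tau> (r, c) = Suc i)"
    if D: "(r, c) \<in> diagram lam" "(r, c') \<in> diagram lam" "c < c'" for r c c'
  proof (intro conjI notI)
    assume a: "\<tau> (r, c') = i \<and> \<tau> (r, c) = Suc i"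
    then have "CT \<tau> i - CT \<tau> (Suc i) = int c' - int c"
      using CT_cell[OF \<tau> D(1)] CT_cell[OF \<tau> D(2)] by simp
    then have l: "Suc c < c'" using far D(3) by auto
    then have m: "(r, Suc c) \<in> diagram lam"
      using D by (intro diagram_down_closed[OF D(2)]) (auto simp: diagram_def)
    then show False using RST_row[OF \<tau> D(1) m] RST_row[OF \<tau> m D(2) l] a by auto
  qed (use RST_row[OF \<tau>] D in blast)
  have col: "\<tau> (r', c) < \<tau> (r, c) \<and> \<not> (\<tau> (r', c) = i \<and> \<tau> (r, c) = Suc i)"
    if D: "(r, c) \<in> diagram lam" "(r', c) \<in> diagram lam" "r < r'" for r r' c
  proof (intro conjI notI)
    assume a: "\<tau> (r', c) = i \<and> \<tau> (r, c) = Suc i"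
    then have "CT \<tau> i - CT \<tau> (Suc i) = int r - int r'"
      using CT_cell[OF \<tau> D(1)] CT_cell[OF \<tau> D(2)] by simp
    then have l: "Suc r < r'" using far D(3) by auto
    then have m: "(Suc r, c) \<in> diagram lam"
      using D by (intro diagram_down_closed[OF D(2)]) (auto simp: diagram_def)
    then show False using RST_column[OF \<tau> D(1) m] RST_column[OF \<tau> m D(2) l] a by auto
  qed (use RST_column[OF \<tau>] D in blast)
  have "tab_swap i \<tau> p = 0" if "p \<notin> diagram lam" for p
    using RST_outside[OF \<tau> that] i by (simp add: tab_swap_def transpose_def)
  then show ?thesis
    using bij row col mono unfolding RST_def tab_swap_def by (simp, blast)
qed

section \<open>The column reading order and the root tableau\<close>

abbreviation before :: "nat \<times> nat \<Rightarrow> nat \<times> nat \<Rightarrow> bool" where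
  "before p q \<equiv> snd p < snd q \<or> snd p = snd q \<and> fst p < fst q"

abbreviation reading_rank :: "nat \<times> nat \<Rightarrow> nat" where
  "reading_rank p \<equiv> card {q \<in> diagram lam. before q p}"

lemma reading_rank_bij: "bij_betw reading_rank (diagram lam) {..<N}"
  using bij_betw_rank[of "diagram lam" before] card_diagram by fastforce

lemma reading_rank_less_iff:
  "p \<in> diagram lam \<Longrightarrow> q \<in> diagram lam \<Longrightarrow> reading_rank p < reading_rank q \<longleftrightarrow> before p q"
  by (rule rank_less_iff) auto

lemma reading_rank_less: "p \<in> diagram lam \<Longrightarrow> reading_rank p < N"
  using reading_rank_bij bij_betwE by fastforce

lemma root_tableau_eq:
  "root_tableau lam p = (if p \<in> diagram lam then N - reading_rank p else 0)"
proof -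
  have "{(r', c') \<in> diagram lam. c' < c \<or> c' = c \<and> r' < r} = {q \<in> diagram lam. before q (r, c)}" for r c
    by auto
  then show ?thesis by (cases p) (simp add: root_tableau_def)
qed

lemma root_tableau_RST: "root_tableau lam \<in> RST lam"
proof -
  have "bij_betw (\<lambda>k. N - k) {..<N} {1..N}"
    by (rule bij_betw_byWitness[of _ "\<lambda>k. N - k"]) auto
  then have "bij_betw ((\<lambda>k. N - k) \<circ> reading_rank) (diagram lam) {1..N}"
    by (rule bij_betw_trans[OF reading_rank_bij])
  then have bij: "bij_betw (root_tableau lam) (diagram lam) {1..N}"
    by (rule iffD1[OF bij_betw_cong, rotated]) (simp add: root_tableau_eq)
  have dec: "root_tableau lam q < root_tableau lam p"
    if "p \<in> diagram lam" "q \<in> diagram lam" "before p q" for p q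
  proof -
    have "reading_rank p < reading_rank q" using that reading_rank_less_iff by blast
    then show ?thesis using that reading_rank_less[of q] by (simp add: root_tableau_eq)
  qed
  show ?thesis using bij dec by (auto simp: RST_def root_tableau_eq)
qed

text \<open>If \<open>i\<close> precedes \<open>i + 1\<close> in the column reading order, then \<open>i\<close> lies strictly above and strictly
  to the left of \<open>i + 1\<close>; a tableau without such \<open>i\<close> is the root.\<close>

lemma exists_descent:
  assumes \<tau>: "\<tau> \<in> RST lam" and ne: "\<tau> \<noteq> root_tableau lam"
  obtains i p q where "1 \<le> i" "i < N" "p \<in> diagram lam" "q \<in> diagram lam" "\<tau> p = i" "\<tau> q = Suc i"
    "before p q" "CT \<tau> i - CT \<tau> (Suc i) \<le> - 2"
proof -
  define cell where "cell i = inv_into (diagram lam) \<tau> i" for i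
  have cell: "cell i \<in> diagram lam" "\<tau> (cell i) = i" if "1 \<le> i" "i \<le> N" for i
    using RST_bij[OF \<tau>] that unfolding cell_def bij_betw_def
    by (auto intro!: inv_into_into f_inv_into_f)
  have cell_\<tau>: "cell (\<tau> p) = p" if "p \<in> diagram lam" for p
    using RST_inj[OF \<tau>] cell[of "\<tau> p"] RST_range[OF \<tau> that] that by blast
  have "\<exists>i. 1 \<le> i \<and> i < N \<and> before (cell i) (cell (Suc i))"
  \<comment> \<open>Without such an i, the cells of N, N - 1, ..., 1 appear in reading order, which
    forces the rank N - i at the cell of i, as in the root.\<close>
  proof (rule ccontr)
    assume "\<nexists>i. 1 \<le> i \<and> i < N \<and> before (cell i) (cell (Suc i))"
    then have nb: "\<not> before (cell i) (cell (Suc i))" if "1 \<le> i" "i < N" for i using that by blast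
    have step: "reading_rank (cell (Suc i)) < reading_rank (cell i)" if i: "1 \<le> i" "i < N" for i
    proof -
      have D: "cell (Suc i) \<in> diagram lam" "cell i \<in> diagram lam"
        "\<tau> (cell (Suc i)) = Suc i" "\<tau> (cell i) = i"
        using cell[of i] cell[of "Suc i"] i by simp_all
      then have "cell (Suc i) \<noteq> cell i" by force
      then have "before (cell (Suc i)) (cell i)"
        using nb[OF i] unfolding prod_eq_iff by linarith
      then show ?thesis using reading_rank_less_iff[OF D(1,2)] by blast
    qed
    have desc: "reading_rank (cell j) < reading_rank (cell i)" if "1 \<le> i" "i < j" "j \<le> N" for i j
      using that(2,3)
    proof (induction j)
      case (Suc j)
      then show ?case using step[of j] that(1) by (cases "i = j") auto
    qed simp
    have "reading_rank (cell i) = N - i" if i: "1 \<le> i" "i \<le> N" for i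
    proof -
      have "{q \<in> diagram lam. before q (cell i)} = cell ` {i<..N}"
      proof (intro equalityI subsetI)
        fix q assume q: "q \<in> {q \<in> diagram lam. before q (cell i)}"
        then have "reading_rank q < reading_rank (cell i)"
          using cell[OF i] reading_rank_less_iff[of q "cell i"] by blast
        moreover have q': "q \<in> diagram lam" using q by blast
        ultimately have "\<not> \<tau> q < i" "\<tau> q \<noteq> i"
          using desc[of "\<tau> q" i] RST_range[OF \<tau> q'] cell_\<tau>[OF q'] i by fastforce+
        then show "q \<in> cell ` {i<..N}"
          using RST_range[OF \<tau> q'] cell_\<tau>[OF q'] by (intro image_eqI[of _ _ "\<tau> q"]) auto
      next
        fix q assume "q \<in> cell ` {i<..N}"
        then obtain j where j: "q = cell j" "i < j" "j \<le> N" by auto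
        then have "reading_rank q < reading_rank (cell i)" using desc[of i j] i by auto
        moreover have "q \<in> diagram lam" using cell(1)[of j] j i by simp
        ultimately have "before q (cell i)" "q \<in> diagram lam"
          using reading_rank_less_iff[OF _ cell(1)[OF i]] by blast+
        then show "q \<in> {q \<in> diagram lam. before q (cell i)}" by blast
      qed
      moreover have "inj_on cell {i<..N}"
        by (rule inj_on_inverseI[of _ \<tau>]) (use cell i in auto)
      ultimately show ?thesis by (simp only: card_image card_greaterThanAtMost)
    qed
    then have rank: "reading_rank p = N - \<tau> p" if "p \<in> diagram lam" for p
      using RST_range[OF \<tau> that] cell_\<tau>[OF that] \<open>\<And>i. 1 \<le> i \<Longrightarrow> i \<le> N \<Longrightarrow> reading_rank (cell i) =
          N - i\<close>[of "\<tau> p"]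
      by simp
    have "root_tableau lam p = \<tau> p" for p
    proof (cases "p \<in> diagram lam")
      case True
      then show ?thesis using RST_range[OF \<tau> True] by (simp add: root_tableau_eq rank[OF True])
    qed (simp add: root_tableau_eq RST_outside[OF \<tau>])
    then have "\<tau> = root_tableau lam" by (simp add: fun_eq_iff)
    then show False using ne by blast
  qed
  then obtain i where i: "1 \<le> i" "i < N" "before (cell i) (cell (Suc i))" by auto
  obtain r c where rc: "cell i = (r, c)" by fastforce
  obtain r' c' where rc': "cell (Suc i) = (r', c')" by fastforce
  have D: "(r, c) \<in> diagram lam" "(r', c') \<in> diagram lam" "\<tau> (r, c) = i" "\<tau> (r', c') = Suc i"
    using cell[of i] cell[of "Suc i"] i rc rc' by auto
  \<comment> \<open>Otherwise the cell of i + 1 would lie weakly above and to the right of that of i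
    and carry the smaller entry.\<close>
  have "\<not> (r \<le> r' \<and> c \<le> c')" using RST_decreasing[OF \<tau> D(1,2)] D(3,4) by (cases "(r, c) = (r', c')") auto
  then have "r' < r" "c < c'" using i(3) rc rc' by auto
  then have "CT \<tau> i - CT \<tau> (Suc i) \<le> - 2"
    using CT_cell[OF \<tau> D(1)] CT_cell[OF \<tau> D(2)] D by simp
  then show ?thesis using that[of i "cell i" "cell (Suc i)"] i rc rc' D by auto
qed

end

section \<open>The field of coefficients\<close>

lemma rat_const_simps [simp]:
  "rat_const 0 = 0" "rat_const 1 = 1"
  "rat_const (a + b) = rat_const a + rat_const b" "rat_const (a * b) = rat_const a * rat_const b"
  "rat_const (- a) = - rat_const a" "rat_const (a - b) = rat_const a - rat_const b"
  by (simp_all add: rat_const_def Zero_fract_def One_fract_def one_pCons mult.commute)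

lemma rat_const_eq_iff [simp]: "rat_const a = rat_const b \<longleftrightarrow> a = b"
  by (simp add: rat_const_def eq_fract)

lemma rat_const_of_nat: "rat_const (of_nat n) = of_nat n"
  by (induction n) auto

lemma rat_const_of_int: "rat_const (of_int n) = of_int n"
  by (cases n) (simp_all add: rat_const_of_nat del: of_nat_Suc)

lemma ratfun_of_int_eq_iff [simp]: "(of_int a :: ratfun) = of_int b \<longleftrightarrow> a = b"
  using rat_const_eq_iff[of "of_int a" "of_int b"] by (simp add: rat_const_of_int)

lemma ratfun_of_int_eq_0_iff [simp]: "(of_int a :: ratfun) = 0 \<longleftrightarrow> a = 0"
  using ratfun_of_int_eq_iff[of a 0] by simp

lemma rat_const_inverse_of_int: "rat_const (1 / of_int a) = 1 / of_int a"
proof (cases "a = 0")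
  case False
  have "rat_const (1 / of_int a) * of_int a = 1"
    unfolding rat_const_of_int[symmetric] rat_const_simps(4)[symmetric] using False by simp
  then show ?thesis using False by (simp add: eq_divide_eq)
qed simp

lemma alpha_linear_eq_Fract: "alpha * of_nat m + of_int a = Fract [:of_int a, of_nat m:] 1"
proof -
  have "alpha * of_nat m = Fract [:0, of_nat m:] 1"
    by (simp add: alpha_def rat_const_of_nat[symmetric] rat_const_def)
  moreover have "(of_int a :: ratfun) = Fract [:of_int a:] 1"
    by (simp add: rat_const_of_int[symmetric] rat_const_def)
  ultimately show ?thesis by simp
qed

text \<open>As \<alpha> is transcendental over the rationals, a spectral value determines its
  exponent and its content. This separates maximal exponents later and makes the denominators at the
  edges nonzero.\<close>

lemma alpha_linear_eq_iff:
  "alpha * of_nat m + of_int a = alpha * of_nat n + of_int b \<longleftrightarrow> m = n \<and> a = b"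
  by (auto simp: alpha_linear_eq_Fract eq_fract)

lemma alpha_neq_0 [simp]: "alpha \<noteq> 0"
  using alpha_linear_eq_iff[of 1 0 0 0] by simp

section \<open>The representation on tableau vectors\<close>

lemma lookup_vscale: "lookup (vscale a t) \<tau> = a * lookup t \<tau>"
  by (simp add: vscale_def Poly_Mapping.map.rep_eq when_def)

lemma lookup_sum: "lookup (sum f A) x = (\<Sum>a\<in>A. lookup (f a) x)"
  by (induction A rule: infinite_finite_induct) (auto simp: lookup_add)

lemma vscale_simps [simp]:
  "vscale 0 t = 0" "vscale 1 t = t" "vscale a 0 = 0" "vscale a (vscale b t) = vscale (a * b) t"
  by (auto intro!: poly_mapping_eqI simp: lookup_vscale)

lemma vscale_add: "vscale a (s + t) = vscale a s + vscale a t"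
  "vscale (a + b) t = vscale a t + vscale b t" "vscale (a - b) t = vscale a t - vscale b t"
  by (auto intro!: poly_mapping_eqI simp: lookup_vscale lookup_add lookup_minus algebra_simps)

lemma vscale_sum: "vscale a (sum f A) = (\<Sum>x\<in>A. vscale a (f x))"
  by (induction A rule: infinite_finite_induct) (auto simp: vscale_add)

lemma tv_expansion:
  assumes "finite A" "keys t \<subseteq> A"
  shows "t = (\<Sum>\<tau>\<in>A. vscale (lookup t \<tau>) (tv \<tau>))"
proof (rule poly_mapping_eqI)
  fix \<rho>
  have "(\<Sum>\<tau>\<in>A. lookup t \<tau> * lookup (tv \<tau>) \<rho>)
      = (\<Sum>\<tau>\<in>A. if \<tau> = \<rho> then lookup t \<rho> else 0)"
    by (rule sum.cong) (auto simp: tv_def lookup_single when_def)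
  also have "\<dots> = lookup t \<rho>"
    using assms by (auto simp: sum.delta in_keys_iff)
  finally show "lookup t \<rho> =
      lookup (\<Sum>\<tau>\<in>A. vscale (lookup t \<tau>) (tv \<tau>)) \<rho>"
    by (simp add: lookup_sum lookup_vscale)
qed

definition vlinear :: "(tabvec \<Rightarrow> tabvec) \<Rightarrow> bool" where
  "vlinear F \<longleftrightarrow> (\<forall>s t. F (s + t) = F s + F t) \<and> (\<forall>a t. F (vscale a t) = vscale a (F t))"

lemma vlinear_add: "vlinear F \<Longrightarrow> F (s + t) = F s + F t"
  and vlinear_scale: "vlinear F \<Longrightarrow> F (vscale a t) = vscale a (F t)"
  by (auto simp: vlinear_def)

lemma vlinear_0: "vlinear F \<Longrightarrow> F 0 = 0"
  using vlinear_scale[of F 0 0] by simp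

lemma vlinear_sum: "vlinear F \<Longrightarrow> F (sum f A) = (\<Sum>x\<in>A. F (f x))"
  by (induction A rule: infinite_finite_induct) (auto simp: vlinear_0 vlinear_add)

lemma vlinear_compose: "vlinear F \<Longrightarrow> vlinear G \<Longrightarrow> vlinear (\<lambda>t. F (G t))"
  by (simp add: vlinear_def)

lemma vlinear_eqI:
  assumes "vlinear F" "vlinear G" "\<And>\<tau>. \<tau> \<in> keys t \<Longrightarrow> F (tv \<tau>) = G (tv \<tau>)"
  shows "F t = G t"
proof -
  let ?s = "\<Sum>\<tau>\<in>keys t. vscale (lookup t \<tau>) (tv \<tau>)"
  have t: "t = ?s" by (rule tv_expansion) auto
  have "F ?s = G ?s"
    unfolding vlinear_sum[OF assms(1)] vlinear_sum[OF assms(2)]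
    by (rule sum.cong) (simp_all add: vlinear_scale[OF assms(1)] vlinear_scale[OF assms(2)] assms(3))
  then show ?thesis using t by simp
qed

lemma vec_gen_superset:
  assumes "finite A" "keys t \<subseteq> A"
  shows "vec_gen i t = (\<Sum>\<tau>\<in>A. vscale (lookup t \<tau>) (tab_gen i \<tau>))"
  unfolding vec_gen_def by (rule sum.mono_neutral_left) (use assms in \<open>auto simp: in_keys_iff\<close>)

lemma vlinear_vec_gen: "vlinear (vec_gen i)"
  unfolding vlinear_def
proof (intro conjI allI)
  fix s t :: tabvec and a
  let ?A = "keys s \<union> keys t"
  show "vec_gen i (s + t) = vec_gen i s + vec_gen i t"
    by (subst (1 2 3) vec_gen_superset[of ?A])
      (auto simp: lookup_add vscale_add sum.distrib dest: subsetD[OF Poly_Mapping.keys_add])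
  show "vec_gen i (vscale a t) = vscale a (vec_gen i t)"
    by (subst (1 2) vec_gen_superset[of "keys t"])
      (auto simp: lookup_vscale vscale_sum in_keys_iff)
qed

lemma vec_gen_tv: "vec_gen i (tv \<tau>) = tab_gen i \<tau>"
  by (simp add: vec_gen_def tv_def)

definition diag_coeff :: "nat \<Rightarrow> tableau \<Rightarrow> ratfun" where
  "diag_coeff i \<tau> = 1 / of_int (CT \<tau> i - CT \<tau> (Suc i))"

definition swap_coeff :: "nat \<Rightarrow> tableau \<Rightarrow> ratfun" where
  "swap_coeff i \<tau> = (if CT \<tau> i - CT \<tau> (Suc i) \<ge> 2 then 1 else 1 - (diag_coeff i \<tau>)\<^sup>2)"

text \<open>Since \<open>1 - b\<^sup>2\<close> vanishes at \<open>b = \<plusminus>1\<close>, a single formula covers all cases of the action.\<close>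

lemma tab_gen_eq:
  "tab_gen i \<tau> = vscale (diag_coeff i \<tau>) (tv \<tau>) + vscale (swap_coeff i \<tau>) (tv (tab_swap i \<tau>))"
proof -
  define a where "a = CT \<tau> i - CT \<tau> (Suc i)"
  define b where "b = 1 / rat_of_int a"
  have b: "rat_const b = diag_coeff i \<tau>"
    by (simp add: b_def diag_coeff_def a_def rat_const_inverse_of_int del: of_int_diff)
  consider "a \<ge> 2" | "a = 1" | "a = 0" | "a = - 1" | "a \<le> - 2" by linarith
  then show ?thesis
  proof cases
    case 1
    then have "0 < b" "b \<le> 1 / 2" "b \<noteq> 1"
      by (auto simp: b_def field_simps)
    then show ?thesis using 1
      by (simp add: tab_gen_def Let_def a_def[symmetric] b_def[symmetric] b swap_coeff_def)
  next
    case 5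
    then have "b < 0" "b \<noteq> - 1" by (auto simp: b_def field_simps)
    then show ?thesis using 5
      by (simp add: tab_gen_def Let_def a_def[symmetric] b_def[symmetric] b swap_coeff_def
          power2_eq_square)
  qed (simp_all add: tab_gen_def Let_def a_def[symmetric] swap_coeff_def diag_coeff_def)
qed

lemma diag_coeff_swap: "diag_coeff i (tab_swap i \<tau>) = - diag_coeff i \<tau>"
  by (simp add: diag_coeff_def CT_tab_swap divide_simps)

text \<open>For a content difference of absolute value at least 2, one of the two off-diagonal
  entries is 1 and the other 1 - b^2; for 1 and -1 both vanish. At difference 0 the convention 1/0 =
  0 keeps the formula true.\<close>

lemma swap_coeff_swap: "swap_coeff i \<tau> * swap_coeff i (tab_swap i \<tau>) = 1 - (diag_coeff i \<tau>)\<^sup>2"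
proof -
  define a where "a = CT \<tau> i - CT \<tau> (Suc i)"
  have "a \<ge> 2 \<or> a = 1 \<or> a = 0 \<or> a = - 1 \<or> a \<le> - 2" by linarith
  then show ?thesis
    unfolding swap_coeff_def diag_coeff_swap using CT_tab_swap[of i \<tau>]
    by (auto simp: a_def[symmetric] diag_coeff_def) (auto simp: a_def)
qed

lemma swap_coeff_eq_0: "\<bar>CT \<tau> i - CT \<tau> (Suc i)\<bar> = 1 \<Longrightarrow> swap_coeff i \<tau> = 0"
proof -
  assume "\<bar>CT \<tau> i - CT \<tau> (Suc i)\<bar> = 1"
  then have "CT \<tau> i - CT \<tau> (Suc i) = 1 \<or> CT \<tau> i - CT \<tau> (Suc i) = - 1" by linarith
  then show ?thesis by (auto simp: swap_coeff_def diag_coeff_def simp del: of_int_diff)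
qed

lemmas vec_gen_simps = vlinear_add[OF vlinear_vec_gen] vlinear_scale[OF vlinear_vec_gen] vec_gen_tv

text \<open>The content difference changes sign with the interchange, so the cross terms cancel and
  the diagonal leaves b^2 + (1 - b^2).\<close>

lemma vec_gen_involution: "vec_gen i (vec_gen i t) = t"
proof (rule vlinear_eqI[where G = "\<lambda>t. t"])
  fix \<tau>
  have "vec_gen i (vec_gen i (tv \<tau>)) =
      vscale (diag_coeff i \<tau> * diag_coeff i \<tau> + swap_coeff i \<tau> * swap_coeff i (tab_swap i \<tau>)) (tv \<tau>)"
    by (simp add: vec_gen_simps tab_gen_eq diag_coeff_swap vscale_add)
      (auto intro!: poly_mapping_eqI simp: lookup_vscale lookup_add algebra_simps)
  then show "vec_gen i (vec_gen i (tv \<tau>)) = tv \<tau>"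
    by (simp add: swap_coeff_swap power2_eq_square)
qed (rule vlinear_compose[OF vlinear_vec_gen vlinear_vec_gen], simp add: vlinear_def)

lemma vec_gen_commute:
  assumes "Suc i < j"
  shows "vec_gen i (vec_gen j t) = vec_gen j (vec_gen i t)"
proof (rule vlinear_eqI[where F = "\<lambda>t. vec_gen i (vec_gen j t)" and G = "\<lambda>t. vec_gen j (vec_gen i t)"])
  fix \<tau>
  have c: "CT (tab_swap j \<tau>) i = CT \<tau> i" "CT (tab_swap j \<tau>) (Suc i) = CT \<tau> (Suc i)"
    "CT (tab_swap i \<tau>) j = CT \<tau> j" "CT (tab_swap i \<tau>) (Suc j) = CT \<tau> (Suc j)"
    using assms by (auto simp: CT_tab_swap transpose_def)
  have "tab_swap i (tab_swap j \<tau>) = tab_swap j (tab_swap i \<tau>)"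
    using assms by (auto simp: tab_swap_def fun_eq_iff transpose_def)
  then show "vec_gen i (vec_gen j (tv \<tau>)) = vec_gen j (vec_gen i (tv \<tau>))"
    by (simp add: vec_gen_simps tab_gen_eq diag_coeff_def swap_coeff_def c vscale_add)
      (auto intro!: poly_mapping_eqI simp: lookup_vscale lookup_add algebra_simps)
qed (rule vlinear_compose[OF vlinear_vec_gen vlinear_vec_gen])+

text \<open>The computation takes place on the six fillings obtained from \<tau> by s_i and s_(i+1),
  whether RSTs or not. All coefficients depend only on the pairwise differences of three contents,
  which is why the same values recur at different fillings.\<close>

lemma vec_gen_braid_tv:
  assumes "CT \<tau> i \<noteq> CT \<tau> (Suc i)" "CT \<tau> (Suc i) \<noteq> CT \<tau> (Suc (Suc i))" "CT \<tau> i \<noteq> CT \<tau> (Suc (Suc i))"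
  shows "vec_gen i (vec_gen (Suc i) (vec_gen i (tv \<tau>))) =
    vec_gen (Suc i) (vec_gen i (vec_gen (Suc i) (tv \<tau>)))"
proof -
  let ?j = "Suc i"
  define t1 t2 where "t1 = tab_swap i \<tau>" and "t2 = tab_swap ?j \<tau>"
  define t12 t21 where "t12 = tab_swap ?j t1" and "t21 = tab_swap i t2"
  define t121 where "t121 = tab_swap i t12"
  define p q r where "p = diag_coeff i \<tau>" and "q = diag_coeff ?j \<tau>"
    and "r = 1 / (of_int (CT \<tau> i - CT \<tau> (Suc ?j)) :: ratfun)"
  define P Q R where "P = swap_coeff i \<tau>" and "Q = swap_coeff ?j \<tau>" and "R = swap_coeff ?j t1"
  define P' Q' where "P' = swap_coeff i t1" and "Q' = swap_coeff ?j t2"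
  have t121': "tab_swap ?j t21 = t121"
    by (auto simp: t121_def t12_def t21_def t1_def t2_def tab_swap_def fun_eq_iff transpose_def)
  note ct = t12_def t21_def t1_def t2_def CT_tab_swap transpose_def
  have d: "diag_coeff i t1 = - p" "diag_coeff ?j t2 = - q" "diag_coeff ?j t1 = r"
    "diag_coeff i t2 = r" "diag_coeff i t12 = q" "diag_coeff ?j t21 = p"
    unfolding p_def q_def t1_def t2_def diag_coeff_swap
    by (simp_all add: diag_coeff_def ct r_def)
  have s: "swap_coeff i t2 = R" "swap_coeff i t12 = Q" "swap_coeff ?j t21 = P"
    by (simp_all add: R_def Q_def P_def swap_coeff_def diag_coeff_def ct)
  have g: "vec_gen i (tv \<tau>) = vscale p (tv \<tau>) + vscale P (tv t1)"
    "vec_gen ?j (tv \<tau>) = vscale q (tv \<tau>) + vscale Q (tv t2)"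
    "vec_gen i (tv t1) = vscale (- p) (tv t1) + vscale P' (tv \<tau>)"
    "vec_gen ?j (tv t1) = vscale r (tv t1) + vscale R (tv t12)"
    "vec_gen i (tv t2) = vscale r (tv t2) + vscale R (tv t21)"
    "vec_gen ?j (tv t2) = vscale (- q) (tv t2) + vscale Q' (tv \<tau>)"
    "vec_gen i (tv t12) = vscale q (tv t12) + vscale Q (tv t121)"
    "vec_gen ?j (tv t21) = vscale p (tv t21) + vscale P (tv t121)"
    unfolding vec_gen_tv tab_gen_eq d s t121'
    by (simp_all add: p_def q_def P_def Q_def R_def P'_def Q'_def t121_def t12_def t21_def)
      (simp_all add: t1_def t2_def)
  have PQ: "P * P' = 1 - p * p" "Q * Q' = 1 - q * q"
    unfolding P_def P'_def Q_def Q'_def t1_def t2_def p_def q_def swap_coeff_swap power2_eq_square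
    by simp_all
  \<comment> \<open>Partial fractions for x - y, y - z and their sum x - z; this is the relation
    among the diagonal coefficients behind the braid identity.\<close>
  have pqr: "p * q = r * (p + q)"
  proof -
    define x y z where "x = (of_int (CT \<tau> i) :: ratfun)" and "y = (of_int (CT \<tau> ?j) :: ratfun)"
      and "z = (of_int (CT \<tau> (Suc ?j)) :: ratfun)"
    have "x - y \<noteq> 0" "y - z \<noteq> 0" "x - z \<noteq> 0" using assms by (auto simp: x_def y_def z_def)
    then have "1 / (x - y) * (1 / (y - z)) = 1 / (x - z) * (1 / (x - y) + 1 / (y - z))"
      by (simp add: field_simps)
    then show ?thesis
      by (simp add: p_def q_def r_def diag_coeff_def x_def y_def z_def)
  qed
  \<comment> \<open>Coefficients at \<tau>, \<open>t1\<close> and \<open>t2\<close>; those at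
    \<open>t12\<close>, \<open>t21\<close> and \<open>t121\<close> agree by commutativity
    alone.\<close>
  have key: "(p * p * q + P * P' * r) * u + (p * q * P - p * P * r) * u1 + p * Q * r * u2 =
      (p * q * q + Q * Q' * r) * u + q * P * r * u1 + (p * q * Q - q * Q * r) * u2" for u u1 u2
    unfolding PQ using pqr by algebra
  show ?thesis
  proof (rule poly_mapping_eqI)
    fix k
    let ?l = "\<lambda>\<rho>. lookup (tv \<rho>) k"
    show "lookup (vec_gen i (vec_gen ?j (vec_gen i (tv \<tau>)))) k =
        lookup (vec_gen ?j (vec_gen i (vec_gen ?j (tv \<tau>)))) k"
      using key[of "?l \<tau>" "?l t1" "?l t2"]
      by (simp add: g vec_gen_simps(1,2) vscale_add lookup_add lookup_vscale algebra_simps)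
  qed
qed

section \<open>The right action on tableau vectors and its Jucys-Murphy elements\<close>

context partition_shape
begin

definition V_space :: "tabvec set" where
  "V_space = {t. keys t \<subseteq> RST lam}"

lemma V_space_0 [simp]: "0 \<in> V_space" by (simp add: V_space_def)

lemma V_space_add: "s \<in> V_space \<Longrightarrow> t \<in> V_space \<Longrightarrow> s + t \<in> V_space"
  using Poly_Mapping.keys_add[of s t] by (auto simp: V_space_def)

lemma V_space_scale: "t \<in> V_space \<Longrightarrow> vscale a t \<in> V_space"
  by (auto simp: V_space_def in_keys_iff lookup_vscale)

lemma V_space_sum: "(\<And>x. x \<in> A \<Longrightarrow> f x \<in> V_space) \<Longrightarrow> sum f A \<in> V_space"
  by (induction A rule: infinite_finite_induct) (auto intro: V_space_add)

lemma V_space_tv: "\<tau> \<in> RST lam \<Longrightarrow> tv \<tau> \<in> V_space"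
  by (simp add: V_space_def tv_def)

text \<open>The interchange can leave the set of RSTs only when the contents differ by 1, and there
  \<open>swap_coeff\<close> vanishes.\<close>

lemma tab_gen_V_space:
  assumes "\<tau> \<in> RST lam" "1 \<le> i" "i < N"
  shows "tab_gen i \<tau> \<in> V_space"
proof (cases "\<bar>CT \<tau> i - CT \<tau> (Suc i)\<bar> = 1")
  case True
  then show ?thesis using assms
    by (simp add: tab_gen_eq swap_coeff_eq_0 V_space_scale V_space_tv)
next
  case False
  then show ?thesis using assms tab_swap_RST
    by (auto simp: tab_gen_eq intro!: V_space_add V_space_scale V_space_tv)
qed

lemma vec_gen_V_space: "t \<in> V_space \<Longrightarrow> 1 \<le> i \<Longrightarrow> i < N \<Longrightarrow> vec_gen i t \<in> V_space"
  unfolding vec_gen_def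
  by (auto intro!: V_space_sum V_space_scale tab_gen_V_space) (auto simp: V_space_def)

lemma vec_gen_braid:
  assumes "t \<in> V_space" "1 \<le> i" "Suc i < N"
  shows "vec_gen i (vec_gen (Suc i) (vec_gen i t)) = vec_gen (Suc i) (vec_gen i (vec_gen (Suc i) t))"
proof (rule vlinear_eqI[where F = "\<lambda>t. vec_gen i (vec_gen (Suc i) (vec_gen i t))"
      and G = "\<lambda>t. vec_gen (Suc i) (vec_gen i (vec_gen (Suc i) t))"])
  fix \<tau> assume "\<tau> \<in> keys t"
  then have "\<tau> \<in> RST lam" using assms by (auto simp: V_space_def)
  then show "vec_gen i (vec_gen (Suc i) (vec_gen i (tv \<tau>))) =
    vec_gen (Suc i) (vec_gen i (vec_gen (Suc i) (tv \<tau>)))"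
    using assms CT_Suc_neq[of \<tau> i] CT_Suc_neq[of \<tau> "Suc i"] CT_Suc_Suc_neq[of \<tau> i]
    by (intro vec_gen_braid_tv) auto
qed (rule vlinear_compose[OF vlinear_vec_gen vlinear_compose[OF vlinear_vec_gen vlinear_vec_gen]])+

text \<open>The word picked by \<open>SOME\<close> has the same permutation as \<open>w\<close>, so
  by \<open>coxeter_eq_of_word_perm\<close> the two are linked by relations that
  \<open>vec_gen\<close> satisfies on \<open>V_space\<close>.\<close>

lemma vec_act_word:
  assumes "set w \<subseteq> {1..<N}" "t \<in> V_space"
  shows "vec_act N (word_perm w) t = fold vec_gen w t"
proof -
  let ?P = "\<lambda>u. set u \<subseteq> {1..<N} \<and> word_perm u = word_perm w"
  have "?P (SOME u. ?P u)" by (rule someI[of ?P w]) (use assms in simp)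
  then have "coxeter_eq N (SOME u. ?P u) w"
    using assms by (intro coxeter_eq_of_word_perm) auto
  then show ?thesis unfolding vec_act_def
    by (rule fold_coxeter[where V = V_space])
      (use assms in \<open>auto intro: vec_gen_V_space vec_gen_involution vec_gen_commute vec_gen_braid\<close>)
qed

lemma vlinear_vec_act: "vlinear (vec_act n \<omega>)"
proof -
  have "vlinear (fold vec_gen w)" for w
  proof (induction w)
    case Nil
    show ?case by (simp add: vlinear_def)
  next
    case (Cons i w)
    then show ?case using vlinear_compose[OF Cons vlinear_vec_gen[of i]] by (simp add: comp_def)
  qed
  then show ?thesis unfolding vec_act_def .
qed

text \<open>Concatenating words composes permutations in the same order, whereas \<open>fold\<close>
  applies the left word first: a right action.\<close>

lemma vec_act_compose:
  assumes "\<omega> permutes {1..N}" "\<omega>' permutes {1..N}" "t \<in> V_space"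
  shows "vec_act N (\<omega> \<circ> \<omega>') t = vec_act N \<omega>' (vec_act N \<omega> t)"
    and vec_act_V_space: "vec_act N \<omega> t \<in> V_space"
proof -
  obtain w w' where w: "set w \<subseteq> {1..<N}" "word_perm w = \<omega>" "set w' \<subseteq> {1..<N}" "word_perm w' = \<omega>'"
    using permutes_word assms by meson
  have *: "fold vec_gen w t \<in> V_space" if "set w \<subseteq> {1..<N}" for w
    using that assms(3) by (induction w arbitrary: t) (simp_all add: vec_gen_V_space)
  then show "vec_act N \<omega> t \<in> V_space" using vec_act_word[of w t] w assms by simp
  show "vec_act N (\<omega> \<circ> \<omega>') t = vec_act N \<omega>' (vec_act N \<omega> t)"
    using vec_act_word[of "w @ w'" t] vec_act_word[of w t] vec_act_word[of w' "fold vec_gen w t"]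
      w assms * by (simp add: word_perm_append)
qed

lemma vec_act_id: "t \<in> V_space \<Longrightarrow> vec_act N id t = t"
  using vec_act_word[of "[]" t] by simp

lemma vec_act_simple: "t \<in> V_space \<Longrightarrow> 1 \<le> i \<Longrightarrow> i < N \<Longrightarrow> vec_act N (transpose i (Suc i)) t = vec_gen i t"
  using vec_act_word[of "[i]" t] by simp

lemma transpose_permutes: "i \<in> {1..N} \<Longrightarrow> j \<in> {1..N} \<Longrightarrow> transpose i j permutes {1..N}"
  by (rule permutes_swap_id)

text \<open>Downward induction on i, from content 0 at N: conjugating transpositions shows that the
  Jucys-Murphy element of i is s_i + s_i J s_i, with J that of i + 1. Knowing J on \<tau> and on its
  interchange suffices.\<close>

lemma jucys_murphy:
  assumes "\<tau> \<in> RST lam" "1 \<le> i" "i \<le> N"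
  shows "(\<Sum>k\<in>{i<..N}. vec_act N (transpose i k) (tv \<tau>)) = vscale (of_int (CT \<tau> i)) (tv \<tau>)"
  using assms(3,1,2)
proof (induction i arbitrary: \<tau> rule: inc_induct)
  case base
  then show ?case by (simp add: CT_max)
next
  case (step i)
  let ?T = "tv \<tau>" and ?a = "of_int (CT \<tau> i) :: ratfun" and ?b = "diag_coeff i \<tau>"
  define J where "J t = (\<Sum>k\<in>{Suc i<..N}. vec_act N (transpose (Suc i) k) t)" for t
  have linJ: "vlinear J" unfolding J_def vlinear_def
    by (simp add: vlinear_add[OF vlinear_vec_act] vlinear_scale[OF vlinear_vec_act] vscale_sum
        sum.distrib)
  have J: "J (tv \<rho>) = vscale (of_int (CT \<rho> (Suc i))) (tv \<rho>)" if "\<rho> \<in> RST lam" for \<rho>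
    unfolding J_def using step.IH[OF that] by simp
  have i: "1 \<le> i" "i < N" using step by auto
  have TV: "?T \<in> V_space" using step V_space_tv by auto
  have conj: "vec_act N (transpose i k) ?T =
      vec_gen i (vec_act N (transpose (Suc i) k) (vec_gen i ?T))" if k: "k \<in> {Suc i<..N}" for k
  proof -
    let ?s = "transpose i (Suc i)"
    have "transpose i k = ?s \<circ> transpose (Suc i) k \<circ> ?s"
      using k by (auto simp: fun_eq_iff transpose_def)
    moreover have p: "?s permutes {1..N}" "transpose (Suc i) k permutes {1..N}"
      using k i by (auto intro: transpose_permutes)
    ultimately show ?thesis
      using TV i p by (simp add: vec_act_compose vec_act_V_space permutes_compose vec_act_simple
          vec_gen_V_space del: comp_apply)
  qed
  have "(\<Sum>k\<in>{i<..N}. vec_act N (transpose i k) ?T)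
      = vec_act N (transpose i (Suc i)) ?T + (\<Sum>k\<in>{Suc i<..N}. vec_act N (transpose i k) ?T)"
  proof -
    have "{i<..N} = insert (Suc i) {Suc i<..N}" using i by auto
    then show ?thesis by simp
  qed
  also have "\<dots> = vec_gen i ?T + vec_gen i (J (vec_gen i ?T))"
    using conj TV i by (simp add: vec_act_simple J_def vlinear_sum[OF vlinear_vec_gen])
  \<comment> \<open>\<open>J\<close> scales \<tau> by the content of i + 1 and the interchanged
    tableau by that of i. Rewritten through \<tau> s_i, the remainder is b (CT(i+1) - CT(i)) \<tau>
    = - \<tau>, whose image under s_i cancels the isolated first summand.\<close>
  also have "J (vec_gen i ?T) =
      vscale (?b * of_int (CT \<tau> (Suc i)) - ?a * ?b) ?T + vscale ?a (vec_gen i ?T)"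
  proof (cases "\<bar>CT \<tau> i - CT \<tau> (Suc i)\<bar> = 1")
    case True
    then show ?thesis using step J[of \<tau>]
      by (simp add: vec_gen_tv tab_gen_eq swap_coeff_eq_0 vlinear_scale[OF linJ] vscale_add)
  next
    case False
    then have "tab_swap i \<tau> \<in> RST lam" using step i tab_swap_RST by auto
    moreover have "CT (tab_swap i \<tau>) (Suc i) = CT \<tau> i" by (simp add: CT_tab_swap)
    ultimately show ?thesis using step J[of \<tau>] J[of "tab_swap i \<tau>"]
      by (simp add: vec_gen_tv tab_gen_eq vlinear_scale[OF linJ] vlinear_add[OF linJ] vscale_add
          algebra_simps)
  qed
  also have "?b * of_int (CT \<tau> (Suc i)) - ?a * ?b = - 1"
    using CT_Suc_neq[of \<tau> i] step i by (simp add: diag_coeff_def divide_simps)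
  finally show ?case
    by (simp add: vec_gen_simps(1,2) vec_gen_involution)
      (auto intro!: poly_mapping_eqI simp: lookup_add lookup_vscale)
qed

end

section \<open>Polynomials\<close>

lemma poly_mapping_single_induct [case_names single add]:
  fixes f :: "'a \<Rightarrow>\<^sub>0 'b::monoid_add"
  assumes "\<And>k c. Q (single k c)" "\<And>f g. Q f \<Longrightarrow> Q g \<Longrightarrow> Q (f + g)"
  shows "Q f"
proof (induction f rule: update_induct)
  case (const)
  show ?case using assms(1)[of undefined 0] by simp
next
  case (update f a b)
  have "Poly_Mapping.update a b f = f + single a b"
    using update by (intro poly_mapping_eqI)
      (auto simp: lookup_update lookup_add lookup_single when_def in_keys_iff)
  then show ?case using assms update by simp
qed

lemma lookup_map_key: "inj \<omega> \<Longrightarrow> lookup (map_key \<omega> m) i = lookup m (\<omega> i)"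
  by (simp add: Poly_Mapping.map_key.rep_eq)

lemma pconst_mult_single: "pconst a * single m c = single m (a * c)"
  by (simp add: pconst_def mult_single)

lemma pconst_0 [simp]: "pconst 0 = 0"
  by (simp add: pconst_def)

lemma lookup_pconst_mult: "lookup (pconst a * f) m = a * lookup f m"
  by (induction f rule: poly_mapping_single_induct)
    (auto simp: pconst_mult_single lookup_single when_def distrib_left lookup_add)

definition plinear :: "(mpol \<Rightarrow> mpol) \<Rightarrow> bool" where
  "plinear F \<longleftrightarrow> (\<forall>f g. F (f + g) = F f + F g) \<and> (\<forall>a f. F (pconst a * f) = pconst a * F f)"

lemma plinear_add: "plinear F \<Longrightarrow> F (f + g) = F f + F g"
  and plinear_scale: "plinear F \<Longrightarrow> F (pconst a * f) = pconst a * F f"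
  by (auto simp: plinear_def)

lemma plinear_0: "plinear F \<Longrightarrow> F 0 = 0"
  using plinear_scale[of F 0 0] by simp

lemma plinear_diff: "plinear F \<Longrightarrow> F (f - g) = F f - F g"
  using plinear_add[of F "f - g" g] by simp

lemma plinear_compose: "plinear F \<Longrightarrow> plinear G \<Longrightarrow> plinear (\<lambda>f. F (G f))"
  by (simp add: plinear_def)

lemma plinear_id: "plinear (\<lambda>f. f)"
  by (simp add: plinear_def)

lemma plinearI:
  assumes "\<And>f g. F (f + g) = F f + F g" "\<And>a m c. F (pconst a * single m c) = pconst a * F (single m c)"
  shows "plinear F"
  unfolding plinear_def
proof (intro conjI allI)
  fix a f
  show "F (pconst a * f) = pconst a * F f"
    by (induction f rule: poly_mapping_single_induct) (use assms in \<open>simp_all add: distrib_left\<close>)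
qed (use assms in simp)

lemma plinear_eqI:
  assumes "plinear F" "plinear G" "\<And>m c. F (single m c) = G (single m c)"
  shows "F f = G f"
  by (induction f rule: poly_mapping_single_induct)
    (use assms in \<open>simp_all add: plinear_add\<close>)

lemma pol_act_single: "pol_act \<omega> (single m c) = single (map_key \<omega> m) c"
  by (cases "c = 0") (simp_all add: pol_act_def)

lemma plinear_pol_act: "plinear (pol_act \<omega>)"
proof (rule plinearI)
  show "pol_act \<omega> (f + g) = pol_act \<omega> f + pol_act \<omega> g" for f g
    unfolding pol_act_def by (rule setsum_keys_plus_distrib) (auto simp: single_add)
qed (simp add: pconst_mult_single pol_act_single)

lemma pol_act_mult: assumes "inj \<omega>" shows "pol_act \<omega> (f * g) = pol_act \<omega> f * pol_act \<omega> g"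
proof (induction f rule: poly_mapping_single_induct)
  case (single m c)
  show ?case
    by (induction g rule: poly_mapping_single_induct)
      (auto simp: mult_single pol_act_single map_key_plus[OF assms] distrib_left
        plinear_add[OF plinear_pol_act])
qed (simp add: distrib_right plinear_add[OF plinear_pol_act])

lemma pol_act_compose: assumes "inj \<omega>" "inj \<omega>'" shows "pol_act \<omega>' (pol_act \<omega> f) = pol_act (\<omega> \<circ> \<omega>') f"
  by (rule plinear_eqI[OF plinear_compose[OF plinear_pol_act plinear_pol_act] plinear_pol_act])
    (simp add: pol_act_single map_key_compose assms)

lemma pol_act_id: "pol_act id f = f"
  by (rule plinear_eqI[OF plinear_pol_act plinear_id]) (simp add: pol_act_single id_def map_key_id)

lemma pol_act_var: assumes "inj \<omega>" shows "pol_act \<omega> (var (\<omega> i)) = var i"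
  by (simp add: var_def pol_act_single map_key_single[OF assms])

lemma pol_act_transpose_involution: "pol_act (transpose i j) (pol_act (transpose i j) f) = f"
  by (simp add: pol_act_compose pol_act_id)

lemma pol_act_transpose_var:
  "pol_act (transpose i j) (var i) = var j" "pol_act (transpose i j) (var j) = var i"
  "k \<noteq> i \<Longrightarrow> k \<noteq> j \<Longrightarrow> pol_act (transpose i j) (var k) = var k"
  using pol_act_var[of "transpose i j" j] pol_act_var[of "transpose i j" i]
    pol_act_var[of "transpose i j" k] by (auto simp: transpose_def)

lemma var_mult_single:
  "var i * single m c = single (single i 1 + m) c"
  by (simp add: var_def mult_single)

lemma var_power: "var i ^ n = single (single i n) 1"
proof (induction n)
  case (Suc n)
  then show ?case by (simp add: var_mult_single single_add[symmetric] One_nat_def)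
qed simp

lemma var_eq_iff: "var i = var j \<longleftrightarrow> i = j"
proof
  assume "var i = var j"
  then have "keys (var i) = keys (var j)" by simp
  then have "single i (1::nat) = single j 1" by (simp add: var_def)
  then have "keys (single i (1::nat)) = keys (single j (1::nat))" by simp
  then show "i = j" by simp
qed simp

lemma plinear_mult: "plinear ((*) h)"
  by (simp add: plinear_def algebra_simps)

definition euler :: "nat \<Rightarrow> mpol \<Rightarrow> mpol" where
  "euler i f = var i * pol_deriv i f"

lemma pol_deriv_single: "pol_deriv i (single m c) =
    single (m - single i 1) (of_nat (lookup m i) * c)"
  by (cases "c = 0") (simp_all add: pol_deriv_def)

lemma plinear_pol_deriv: "plinear (pol_deriv i)"
proof (rule plinearI)
  show "pol_deriv i (f + g) = pol_deriv i f + pol_deriv i g" for f g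
    unfolding pol_deriv_def by (rule setsum_keys_plus_distrib) (auto simp: single_add distrib_left)
qed (simp add: pconst_mult_single pol_deriv_single mult.left_commute)

lemma plinear_euler: "plinear (euler i)"
  unfolding euler_def by (rule plinear_compose[OF plinear_mult plinear_pol_deriv])

lemma euler_single: "euler i (single m c) = single m (of_nat (lookup m i) * c)"
proof (cases "lookup m i = 0")
  case False
  then have "single i 1 + (m - single i 1) = m"
    by (intro poly_mapping_eqI) (auto simp: lookup_add lookup_minus lookup_single when_def)
  then show ?thesis by (simp add: euler_def pol_deriv_single var_mult_single)
qed (simp add: euler_def pol_deriv_single)

lemma pol_deriv_var_mult: "pol_deriv i (var i * f) = f + euler i f"
proof (rule plinear_eqI[OF plinear_compose[OF plinear_pol_deriv plinear_mult]])
  show "plinear (\<lambda>f. f + euler i f)"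
    using plinear_euler by (simp add: plinear_def algebra_simps)
  show "pol_deriv i (var i * single m c) = single m c + euler i (single m c)" for m c
    by (simp add: var_mult_single pol_deriv_single euler_single lookup_add lookup_single
        single_add[symmetric] algebra_simps)
qed

lemma euler_var_mult: "euler j (var k * f) = var k * (euler j f + (if j = k then f else 0))"
proof (rule plinear_eqI[OF plinear_compose[OF plinear_euler plinear_mult]])
  show "plinear (\<lambda>f. var k * (euler j f + (if j = k then f else 0)))"
    using plinear_euler[of j] by (simp add: plinear_def algebra_simps)
  show "euler j (var k * single m c) = var k * (euler j (single m c) + (if j =
      k then single m c else 0))" for m c
    by (simp add: var_mult_single euler_single lookup_add lookup_single single_add[symmetric]
        distrib_left algebra_simps)
qed

lemma euler_pol_act:
  assumes "inj \<omega>" shows "euler i (pol_act \<omega> f) = pol_act \<omega> (euler (\<omega> i) f)"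
  by (rule plinear_eqI[OF plinear_compose[OF plinear_euler plinear_pol_act] plinear_compose[OF
      plinear_pol_act plinear_euler]])
    (simp add: pol_act_single euler_single lookup_map_key assms)

subsection \<open>Divided differences\<close>

lemma div_diff_eqI:
  assumes "i \<noteq> j" "(var i - var j) * q = f - pol_act (transpose i j) f"
  shows "div_diff i j f = q"
  unfolding div_diff_def
proof (rule the_equality, rule assms(2))
  fix q' assume "(var i - var j) * q' = f - pol_act (transpose i j) f"
  then show "q' = q" using assms by (metis mult_cancel_left right_minus_eq var_eq_iff)
qed

definition with_exponents :: "nat \<Rightarrow> nat \<Rightarrow> (nat \<Rightarrow>\<^sub>0 nat) \<Rightarrow> nat \<Rightarrow> nat \<Rightarrow> nat \<Rightarrow>\<^sub>0 nat" where
  "with_exponents i j m a b = Poly_Mapping.update i a (Poly_Mapping.update j b m)"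

lemma lookup_with_exponents:
  "lookup (with_exponents i j m a b) k = (if k = i then a else if k = j then b else lookup m k)"
  by (simp add: with_exponents_def lookup_update)

lemma with_exponents_self: "with_exponents i j m (lookup m i) (lookup m j) = m"
  by (rule poly_mapping_eqI) (simp add: lookup_with_exponents)

lemma map_key_transpose_eq: "i \<noteq> j \<Longrightarrow> map_key (transpose i j) m =
    with_exponents i j m (lookup m j) (lookup m i)"
  by (rule poly_mapping_eqI) (auto simp: lookup_with_exponents lookup_map_key transpose_def)

lemma single_with_exponents:
  assumes "i \<noteq> j"
  shows "single (with_exponents i j m a b) c =
    single (with_exponents i j m 0 0) c * var i ^ a * var j ^ b"
proof -
  have "with_exponents i j m a b = with_exponents i j m 0 0 + single i a + single j b"
    using assms by (intro poly_mapping_eqI)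
      (auto simp: lookup_with_exponents lookup_add lookup_single when_def)
  then show ?thesis by (simp add: var_power mult_single)
qed

lemma geometric_difference:
  fixes x y :: "'a::comm_ring_1"
  shows "(x - y) * (\<Sum>k<n. x ^ (b + n - Suc k) * y ^ (b + k)) = x ^ (b + n) * y ^ b - x ^ b * y ^ (b + n)"
proof (induction n)
  case (Suc n)
  have "(\<Sum>k<n. x ^ (b + Suc n - Suc k) * y ^ (b + k)) = x * (\<Sum>k<n. x ^ (b + n - Suc k) * y ^ (b + k))"
    unfolding sum_distrib_left
    by (rule sum.cong) (auto simp: Suc_diff_Suc[symmetric] simp flip: power_Suc mult.assoc intro!:
        arg_cong2[where f = "(*)"] arg_cong2[where f = "(^)"])
  then have "(x - y) * (\<Sum>k<Suc n. x ^ (b + Suc n - Suc k) * y ^ (b + k))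
      = x * ((x - y) * (\<Sum>k<n. x ^ (b + n - Suc k) * y ^ (b + k))) + (x - y) * (x ^ b * y ^ (b + n))"
    by (simp add: algebra_simps)
  then show ?case unfolding Suc by (simp add: algebra_simps)
qed simp

text \<open>A geometric series in x_i and x_j, written for the side where the exponent of x_i is at
  least that of x_j; the other side follows by antisymmetry under s_ij.\<close>

lemma monomial_difference:
  assumes "i \<noteq> j" and n: "lookup m i = lookup m j + n"
  shows "(var i - var j) * (\<Sum>k<n. single
      (with_exponents i j m (lookup m i - Suc k) (lookup m j + k)) c)
    = single m c - pol_act (transpose i j) (single m c)"
proof -
  let ?b = "lookup m j" and ?z = "single (with_exponents i j m 0 0) c"
  have "(var i - var j) * (\<Sum>k<n. single
        (with_exponents i j m (lookup m i - Suc k) (?b + k)) c)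
      = ?z * ((var i - var j) * (\<Sum>k<n. var i ^ (?b + n - Suc k) * var j ^ (?b + k)))"
    by (subst single_with_exponents[OF assms(1)]) (simp add: n sum_distrib_left algebra_simps)
  also have "\<dots> = ?z * var i ^ (?b + n) * var j ^ ?b - ?z * var i ^ ?b * var j ^ (?b + n)"
    unfolding geometric_difference by (simp add: algebra_simps)
  also have "\<dots> = single m c - pol_act (transpose i j) (single m c)"
    unfolding single_with_exponents[OF assms(1), symmetric] pol_act_single
      map_key_transpose_eq[OF assms(1)] n
    using with_exponents_self[of i j m] n by simp
  finally show ?thesis .
qed

lemma div_diff_single_greater:
  assumes "i \<noteq> j" and "lookup m i = lookup m j + n"
  shows "div_diff i j (single m c) = (\<Sum>k<n. single
    (with_exponents i j m (lookup m i - Suc k) (lookup m j + k)) c)"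
  by (rule div_diff_eqI[OF assms(1) monomial_difference[OF assms]])

lemma div_diff_exists:
  assumes "i \<noteq> j" shows "\<exists>q. (var i - var j) * q = f - pol_act (transpose i j) f"
proof (induction f rule: poly_mapping_single_induct)
  case (single m c)
  let ?s = "transpose i j" and ?f = "single m c"
  have *: "\<exists>q. (var i - var j) * q = single m c - pol_act ?s (single m c)"
    if le: "lookup m j \<le> lookup m i" for m c
    using monomial_difference[OF assms, of m "lookup m i - lookup m j" c] le
    by (metis le_add_diff_inverse)
  show ?case
  proof (cases "lookup m j \<le> lookup m i")
    case False
    then obtain q where "(var i - var j) * q = pol_act ?s ?f - pol_act ?s (pol_act ?s ?f)"
      using *[of "map_key ?s m" c] by (auto simp: pol_act_single lookup_map_key)
    then have "(var i - var j) * (- q) = ?f - pol_act ?s ?f"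
      by (simp add: pol_act_transpose_involution algebra_simps)
    then show ?thesis by blast
  qed (use * in blast)
next
  case (add f g)
  then obtain q q' where "(var i - var j) * q = f - pol_act (transpose i j) f"
    "(var i - var j) * q' = g - pol_act (transpose i j) g" by auto
  then have "(var i - var j) * (q + q') = (f + g) - pol_act (transpose i j) (f + g)"
    by (simp add: distrib_left plinear_add[OF plinear_pol_act])
  then show ?case by blast
qed

lemma div_diff_mult:
  "i \<noteq> j \<Longrightarrow> (var i - var j) * div_diff i j f = f - pol_act (transpose i j) f"
  using div_diff_exists[of i j f] div_diff_eqI[of i j _ f] by metis

lemma plinear_div_diff: assumes "i \<noteq> j" shows "plinear (div_diff i j)"
  unfolding plinear_def
proof (intro conjI allI)
  fix f g a
  show "div_diff i j (f + g) = div_diff i j f + div_diff i j g"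
    by (rule div_diff_eqI[OF assms])
      (simp add: distrib_left div_diff_mult assms plinear_add[OF plinear_pol_act])
  show "div_diff i j (pconst a * f) = pconst a * div_diff i j f"
    by (rule div_diff_eqI[OF assms])
      (simp add: mult.left_commute[of _ "pconst a"] div_diff_mult assms plinear_scale[OF plinear_pol_act]
        right_diff_distrib)
qed

text \<open>Multiplication by x_i restores the degree lost by the divided difference. The
  commutation rules of this operator are proved after multiplying by x_i - x_j, which can be
  cancelled in the polynomial ring.\<close>

definition weighted_diff :: "nat \<Rightarrow> nat \<Rightarrow> mpol \<Rightarrow> mpol" where
  "weighted_diff i j f = var i * div_diff i j f"

lemma plinear_weighted_diff: "i \<noteq> j \<Longrightarrow> plinear (weighted_diff i j)"
  unfolding weighted_diff_def by (rule plinear_compose[OF plinear_mult plinear_div_diff])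

lemma weighted_diff_mult:
  "i \<noteq> j \<Longrightarrow> (var i - var j) * weighted_diff i j f = var i * (f - pol_act (transpose i j) f)"
  by (simp add: weighted_diff_def mult.left_commute[of _ "var i"] div_diff_mult)

lemma weighted_diff_eqI:
  assumes "i \<noteq> j" "(var i - var j) * q = var i * (f - pol_act (transpose i j) f)"
  shows "weighted_diff i j f = q"
  using assms weighted_diff_mult[OF assms(1), of f]
  by (metis mult_cancel_left right_minus_eq var_eq_iff)

text \<open>Leibniz rule for the divided difference. The exchange term that it produces for every j
  \<noteq> i is the source of the sum over j > i in \<open>xi_eq\<close>.\<close>

lemma div_diff_var_mult:
  assumes "i \<noteq> j" shows "div_diff i j (var i * f) = weighted_diff i j f + pol_act (transpose i j) f"
proof (rule div_diff_eqI[OF assms])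
  show "(var i - var j) * (weighted_diff i j f + pol_act (transpose i j) f) =
      var i * f - pol_act (transpose i j) (var i * f)"
    unfolding pol_act_mult[OF inj_transpose] pol_act_transpose_var
    using weighted_diff_mult[OF assms, of f] by algebra
qed

text \<open>Rules for moving a variable out of the operator; with k, j or i equal to N they govern
  the multiplication by x_N in \<open>MPsi\<close>.\<close>

lemma weighted_diff_var_mult:
  assumes "i \<noteq> j"
  shows "k \<noteq> i \<Longrightarrow> k \<noteq> j \<Longrightarrow> weighted_diff i j (var k * f) = var k * weighted_diff i j f"
    and "weighted_diff i j (var j * f) = var j * weighted_diff i j f - var i * pol_act (transpose i j) f"
    and "weighted_diff i j (var i * f) = var i * (weighted_diff i j f + pol_act (transpose i j) f)"
proof -
  note h = weighted_diff_mult[OF assms, of f]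
  show "weighted_diff i j (var k * f) = var k * weighted_diff i j f" if k: "k \<noteq> i" "k \<noteq> j"
  proof (rule weighted_diff_eqI[OF assms])
    show "(var i - var j) * (var k * weighted_diff i j f) =
        var i * (var k * f - pol_act (transpose i j) (var k * f))"
      unfolding pol_act_mult[OF inj_transpose] pol_act_transpose_var(3)[OF k] using h by algebra
  qed
  show "weighted_diff i j (var j * f) = var j * weighted_diff i j f - var i * pol_act (transpose i j) f"
  proof (rule weighted_diff_eqI[OF assms])
    show "(var i - var j) * (var j * weighted_diff i j f - var i * pol_act (transpose i j) f) =
        var i * (var j * f - pol_act (transpose i j) (var j * f))"
      unfolding pol_act_mult[OF inj_transpose] pol_act_transpose_var using h by algebra
  qed
  show "weighted_diff i j (var i * f) = var i * (weighted_diff i j f + pol_act (transpose i j) f)"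
  proof (rule weighted_diff_eqI[OF assms])
    show "(var i - var j) * (var i * (weighted_diff i j f + pol_act (transpose i j) f)) =
        var i * (var i * f - pol_act (transpose i j) (var i * f))"
      unfolding pol_act_mult[OF inj_transpose] pol_act_transpose_var using h by algebra
  qed
qed

lemma weighted_diff_pol_act:
  assumes "i \<noteq> j" "bij \<omega>"
  shows "weighted_diff i j (pol_act \<omega> f) = pol_act \<omega> (weighted_diff (\<omega> i) (\<omega> j) f)"
proof (rule weighted_diff_eqI[OF assms(1)])
  have inj: "inj \<omega>" using assms(2) by (rule bij_is_inj)
  have ne: "\<omega> i \<noteq> \<omega> j" using inj assms(1) by (auto dest: injD)
  have c: "transpose (\<omega> i) (\<omega> j) \<circ> \<omega> = \<omega> \<circ> transpose i j"
    using inj by (auto simp: fun_eq_iff transpose_def dest: injD)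
  have "pol_act \<omega> (pol_act (transpose (\<omega> i) (\<omega> j)) f) = pol_act (transpose i j) (pol_act \<omega> f)"
    using inj c by (simp add: pol_act_compose)
  then have "pol_act \<omega> ((var (\<omega> i) - var (\<omega> j)) * weighted_diff (\<omega> i) (\<omega> j) f)
      = var i * (pol_act \<omega> f - pol_act (transpose i j) (pol_act \<omega> f))"
    unfolding weighted_diff_mult[OF ne]
    by (simp add: pol_act_mult inj plinear_diff[OF plinear_pol_act] pol_act_var)
  then show "(var i - var j) * pol_act \<omega> (weighted_diff (\<omega> i) (\<omega> j) f)
      = var i * (pol_act \<omega> f - pol_act (transpose i j) (pol_act \<omega> f))"
    by (simp add: pol_act_mult inj plinear_diff[OF plinear_pol_act] pol_act_var)
qed

lemma weighted_diff_transpose: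
  assumes "i \<noteq> j" shows "weighted_diff i j (pol_act (transpose i j) f) = - weighted_diff i j f"
proof (rule weighted_diff_eqI[OF assms])
  show "(var i - var j) * - weighted_diff i j f = var i * (pol_act (transpose i j) f -
      pol_act (transpose i j) (pol_act (transpose i j) f))"
    unfolding pol_act_transpose_involution using weighted_diff_mult[OF assms, of f] by algebra
qed

lemma weighted_diff_single_equal:
  assumes "i \<noteq> j" "lookup m i = lookup m j"
  shows "weighted_diff i j (single m c) = 0"
  using div_diff_single_greater[of i j m 0 c] assms by (simp add: weighted_diff_def)

text \<open>The geometric series contributes the string from m towards its exchange, without the
  exchanged monomial itself: the exponents differ by n + 1, so at k = n that of x_i is still one
  more than the original exponent of x_j.\<close>

lemma weighted_diff_single_greater:
  assumes "i \<noteq> j" and n: "lookup m i = lookup m j + Suc n"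
  shows "weighted_diff i j (single m c) = single m c + (\<Sum>k\<in>{1..n}. single
    (with_exponents i j m (lookup m i - k) (lookup m j + k)) c)"
proof -
  let ?e = "\<lambda>k. single (with_exponents i j m (lookup m i - k) (lookup m j + k)) c"
  have "weighted_diff i j (single m c) = (\<Sum>k<Suc n. ?e k)"
    unfolding weighted_diff_def div_diff_single_greater[OF assms] sum_distrib_left
  proof (rule sum.cong[OF refl])
    fix k assume "k \<in> {..<Suc n}"
    then have "single i 1 + with_exponents i j m (lookup m i - Suc k) (lookup m j + k)
        = with_exponents i j m (lookup m i - k) (lookup m j + k)"
      using n assms(1) by (intro poly_mapping_eqI)
        (auto simp: lookup_add lookup_single when_def lookup_with_exponents)
    then show "var i * single (with_exponents i j m (lookup m i - Suc k) (lookup m j + k)) c = ?e k"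
      by (simp add: var_mult_single)
  qed
  also have "{..<Suc n} = insert 0 {1..n}" by auto
  finally show ?thesis by (simp add: with_exponents_self)
qed

section \<open>Operators on vector-valued polynomials\<close>

lemma lookup_tensor: "lookup (tensor f t) \<tau> = pconst (lookup t \<tau>) * f"
  by (simp add: tensor_def Poly_Mapping.map.rep_eq when_def)

lemma lookup_pmul: "lookup (pmul f P) \<tau> = f * lookup P \<tau>"
  by (simp add: pmul_def Poly_Mapping.map.rep_eq when_def)

lemma tensor_simps:
  "tensor (f + g) t = tensor f t + tensor g t" "tensor f (s + t) = tensor f s + tensor f t"
  "tensor (f - g) t = tensor f t - tensor g t" "tensor (- f) t = - tensor f t"
  "tensor (pconst a * f) t = mscale a (tensor f t)" "tensor f (vscale a t) = mscale a (tensor f t)"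
  "tensor 0 t = 0" "tensor f 0 = 0"
  by (auto intro!: poly_mapping_eqI simp: lookup_tensor lookup_add lookup_minus lookup_mscale
      lookup_vscale pconst_simps algebra_simps)

lemma tensor_sum_right: "tensor f (sum t A) = (\<Sum>x\<in>A. tensor f (t x))"
  by (induction A rule: infinite_finite_induct) (auto simp: tensor_simps)

lemma pmul_tensor: "pmul f (tensor g t) = tensor (f * g) t"
  by (rule poly_mapping_eqI) (simp add: lookup_pmul lookup_tensor mult.left_commute)

definition mlinear :: "(vpol \<Rightarrow> vpol) \<Rightarrow> bool" where
  "mlinear F \<longleftrightarrow> (\<forall>P Q. F (P + Q) = F P + F Q) \<and> (\<forall>a P. F (mscale a P) = mscale a (F P))"

lemma mlinear_add: "mlinear F \<Longrightarrow> F (P + Q) = F P + F Q"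
  and mlinear_scale: "mlinear F \<Longrightarrow> F (mscale a P) = mscale a (F P)"
  by (auto simp: mlinear_def)

lemma mlinear_0: "mlinear F \<Longrightarrow> F 0 = 0"
  using mlinear_scale[of F 0 0] by simp

lemma mlinear_diff: "mlinear F \<Longrightarrow> F (P - Q) = F P - F Q"
  using mlinear_add[of F "P - Q" Q] by simp

lemma mlinear_sum: "mlinear F \<Longrightarrow> F (sum f A) = (\<Sum>x\<in>A. F (f x))"
  by (induction A rule: infinite_finite_induct) (auto simp: mlinear_0 mlinear_add)

lemma mlinear_compose: "mlinear F \<Longrightarrow> mlinear G \<Longrightarrow> mlinear (\<lambda>P. F (G P))"
  by (simp add: mlinear_def)

lemma mlinear_plus: "mlinear F \<Longrightarrow> mlinear G \<Longrightarrow> mlinear (\<lambda>P. F P + G P)"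
  by (simp add: mlinear_def algebra_simps M.scale_right_distrib)

lemma mlinear_minus: "mlinear F \<Longrightarrow> mlinear G \<Longrightarrow> mlinear (\<lambda>P. F P - G P)"
  by (simp add: mlinear_def algebra_simps M.scale_right_diff_distrib)

lemma mlinear_sum_fun: "(\<And>x. x \<in> A \<Longrightarrow> mlinear (F x)) \<Longrightarrow> mlinear (\<lambda>P. \<Sum>x\<in>A. F x P)"
  by (simp add: mlinear_def sum.distrib M.scale_sum_right)

lemma mlinear_mscale: "mlinear (mscale a)"
  by (simp add: mlinear_def M.scale_right_distrib M.scale_scale mult.commute)

lemma mlinear_id: "mlinear (\<lambda>P. P)"
  by (simp add: mlinear_def)

lemma mlinear_pmul: "mlinear (pmul f)"
  unfolding mlinear_def
  by (auto intro!: poly_mapping_eqI simp: lookup_pmul lookup_add lookup_mscale algebra_simps)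

lemma vpol_expansion: "P = (\<Sum>\<tau>\<in>keys P. tensor (lookup P \<tau>) (tv \<tau>))"
proof (rule poly_mapping_eqI)
  fix \<rho>
  have "(\<Sum>\<tau>\<in>keys P. lookup (tensor (lookup P \<tau>) (tv \<tau>)) \<rho>)
      = (\<Sum>\<tau>\<in>keys P. if \<tau> = \<rho> then lookup P \<rho> else 0)"
    by (rule sum.cong) (auto simp: tv_def lookup_tensor lookup_single when_def pconst_simps)
  also have "\<dots> = lookup P \<rho>" by (auto simp: sum.delta in_keys_iff)
  finally show "lookup P \<rho> = lookup
      (\<Sum>\<tau>\<in>keys P. tensor (lookup P \<tau>) (tv \<tau>)) \<rho>"
    by (simp add: lookup_sum)
qed

lemma mlinear_eqI:
  assumes "mlinear F" "mlinear G"
    "\<And>f \<tau>. \<tau> \<in> keys P \<Longrightarrow> F (tensor f (tv \<tau>)) = G (tensor f (tv \<tau>))"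
  shows "F P = G P"
  by (subst (1 2) vpol_expansion[of P])
    (simp add: mlinear_sum[OF assms(1)] mlinear_sum[OF assms(2)] assms(3))

lemma mlinear_lin_ext:
  assumes "\<And>f g \<tau>. T (f + g) \<tau> = T f \<tau> + T g \<tau>" "\<And>a f \<tau>. T (pconst a * f) \<tau> = mscale a (T f \<tau>)"
  shows "mlinear (lin_ext T)"
proof -
  have T0: "T 0 \<tau> = 0" for \<tau> using assms(2)[of 0 0 \<tau>] by simp
  have sup: "lin_ext T P = (\<Sum>\<tau>\<in>A. T (lookup P \<tau>) \<tau>)"
    if "finite A" "keys P \<subseteq> A" for A P
    unfolding lin_ext_def by (rule sum.mono_neutral_left) (use that T0 in \<open>auto simp: in_keys_iff\<close>)
  show ?thesis
    unfolding mlinear_def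
  proof (intro conjI allI)
    fix P Q :: vpol and a
    let ?A = "keys P \<union> keys Q"
    show "lin_ext T (P + Q) = lin_ext T P + lin_ext T Q"
      by (subst (1 2 3) sup[of ?A])
        (auto simp: lookup_add assms sum.distrib dest: subsetD[OF Poly_Mapping.keys_add])
    show "lin_ext T (mscale a P) = mscale a (lin_ext T P)"
      by (subst (1 2) sup[of "keys P"])
        (auto simp: lookup_mscale assms M.scale_sum_right in_keys_iff)
  qed
qed

lemma lin_ext_tensor_tv:
  assumes "T 0 \<tau> = 0"
  shows "lin_ext T (tensor f (tv \<tau>)) = T f \<tau>"
proof (cases "f = 0")
  case False
  then have "keys (tensor f (tv \<tau>)) = {\<tau>}"
    by (auto simp: in_keys_iff lookup_tensor tv_def lookup_single when_def pconst_simps split: if_splits)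
  then show ?thesis by (simp add: lin_ext_def lookup_tensor tv_def pconst_simps)
qed (simp add: tensor_simps lin_ext_def assms)

definition tensor_op :: "(mpol \<Rightarrow> mpol) \<Rightarrow> (tabvec \<Rightarrow> tabvec) \<Rightarrow> vpol \<Rightarrow> vpol" where
  "tensor_op F G = lin_ext (\<lambda>f \<tau>. tensor (F f) (G (tv \<tau>)))"

lemma mlinear_tensor_op: "plinear F \<Longrightarrow> mlinear (tensor_op F G)"
  unfolding tensor_op_def
  by (rule mlinear_lin_ext) (simp_all add: plinear_add plinear_scale tensor_simps)

lemma tensor_op_tensor:
  assumes "plinear F" "vlinear G"
  shows "tensor_op F G (tensor f t) = tensor (F f) (G t)"
proof -
  have tv: "tensor_op F G (tensor f (tv \<tau>)) = tensor (F f) (G (tv \<tau>))" for f \<tau>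
    unfolding tensor_op_def by (rule lin_ext_tensor_tv) (simp add: plinear_0[OF assms(1)] tensor_simps)
  let ?s = "\<Sum>\<tau>\<in>keys t. vscale (lookup t \<tau>) (tv \<tau>)"
  have t: "t = ?s" by (rule tv_expansion) auto
  have "tensor_op F G (tensor f ?s) = tensor (F f) (G ?s)"
    by (simp add: tensor_sum_right tensor_simps mlinear_sum[OF mlinear_tensor_op[OF assms(1)]]
        mlinear_scale[OF mlinear_tensor_op[OF assms(1)]] tv vlinear_sum[OF assms(2)]
        vlinear_scale[OF assms(2)])
  then show ?thesis using t by simp
qed

lemma diag_act_eq: "diag_act N \<omega> = tensor_op (pol_act \<omega>) (vec_act N \<omega>)"
  by (simp add: diag_act_def tensor_op_def)

lemma mlinear_diag_act: "mlinear (diag_act N \<omega>)"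
  unfolding diag_act_eq by (rule mlinear_tensor_op[OF plinear_pol_act])

lemma mlinear_Dunkl: "mlinear (Dunkl N i)"
  unfolding Dunkl_def
proof (rule mlinear_lin_ext, goal_cases)
  case (1 f g \<tau>)
  show ?case
    by (simp add: plinear_add[OF plinear_pol_deriv] plinear_add[OF plinear_div_diff] tensor_simps
        sum.distrib M.scale_right_distrib)
next
  case (2 a f \<tau>)
  show ?case
    by (simp add: plinear_scale[OF plinear_pol_deriv] plinear_scale[OF plinear_div_diff] tensor_simps
        M.scale_sum_right M.scale_right_distrib)
qed

lemma mlinear_MPsi: "mlinear (MPsi N)"
  unfolding MPsi_def by (rule mlinear_compose[OF mlinear_pmul mlinear_diag_act])

lemma Dunkl_tensor_tv:
  "Dunkl N i (tensor f (tv \<tau>)) = tensor (pol_deriv i f) (tv \<tau>) + mscale (1 / alpha)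
     (\<Sum>j \<in> {1..N} - {i}. tensor (div_diff i j f) (vec_act N (transpose i j) (tv \<tau>)))"
  unfolding Dunkl_def
  by (rule lin_ext_tensor_tv)
    (simp add: plinear_0[OF plinear_pol_deriv] plinear_0[OF plinear_div_diff] tensor_simps)

context partition_shape
begin

lemma diag_act_tensor: "diag_act n \<omega> (tensor f t) = tensor (pol_act \<omega> f) (vec_act n \<omega> t)"
  unfolding diag_act_eq by (rule tensor_op_tensor[OF plinear_pol_act vlinear_vec_act])

text \<open>Only the tableaux are restricted: the relations among the operators depend on
  \<open>vec_act\<close> being an action, not on the range of the variables.\<close>

definition W_space :: "vpol set" where
  "W_space = {P. keys P \<subseteq> RST lam}"

lemma W_spaceI: "P \<in> W_space \<Longrightarrow> \<tau> \<in> keys P \<Longrightarrow> tv \<tau> \<in> V_space"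
  by (auto simp: W_space_def intro: V_space_tv)

text \<open>The part of \<open>xi N i\<close> that commutes with permutations up to renaming i; the
  rest is the sum over j > i in \<open>xi_eq\<close>.\<close>

definition equivariant_part :: "nat \<Rightarrow> vpol \<Rightarrow> vpol" where
  "equivariant_part i P = mscale alpha (tensor_op (euler i) (\<lambda>t. t) P) +
     (\<Sum>j\<in>{1..N} - {i}. tensor_op (weighted_diff i j) (vec_act N (transpose i j)) P)"

lemma vlinear_id: "vlinear (\<lambda>t. t)"
  by (simp add: vlinear_def)

lemma mlinear_equivariant_part: "mlinear (equivariant_part i)"
  unfolding equivariant_part_def
  by (intro mlinear_plus mlinear_compose[OF mlinear_mscale] mlinear_sum_fun mlinear_tensor_op
      plinear_euler plinear_weighted_diff) auto

lemma equivariant_part_tensor: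
  "equivariant_part i (tensor f t) = mscale alpha (tensor (euler i f) t) +
     (\<Sum>j\<in>{1..N} - {i}. tensor (weighted_diff i j f) (vec_act N (transpose i j) t))"
proof -
  have "tensor_op (weighted_diff i j) (vec_act N (transpose i j)) (tensor f t) =
      tensor (weighted_diff i j f) (vec_act N (transpose i j) t)" if "j \<in> {1..N} - {i}" for j
    by (rule tensor_op_tensor[OF plinear_weighted_diff vlinear_vec_act]) (use that in auto)
  then show ?thesis
    unfolding equivariant_part_def tensor_op_tensor[OF plinear_euler vlinear_id] by simp
qed

lemma mlinear_xi: "mlinear (xi N i)"
  unfolding xi_def Cherednik_def
  by (intro mlinear_minus mlinear_compose[OF mlinear_mscale] mlinear_mscale mlinear_sum_fun
      mlinear_diag_act mlinear_compose[OF mlinear_Dunkl mlinear_pmul])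

text \<open>Differentiating x_i f yields an extra f, and the resulting \<alpha> f is subtracted in
  \<open>xi\<close>. The divided differences yield f s_ij for all j \<noteq> i, of which
  \<open>Cherednik\<close> removes those with j < i.\<close>

lemma xi_eq:
  assumes i: "i \<in> {1..N}"
  shows "xi N i P = equivariant_part i P + (\<Sum>j\<in>{i<..N}. diag_act N (transpose i j) P)"
proof (rule mlinear_eqI[OF mlinear_xi, where G = "\<lambda>P. equivariant_part i P +
    (\<Sum>j\<in>{i<..N}. diag_act N (transpose i j) P)"])
  show "mlinear (\<lambda>P. equivariant_part i P + (\<Sum>j\<in>{i<..N}. diag_act N (transpose i j) P))"
    by (intro mlinear_plus mlinear_equivariant_part mlinear_sum_fun mlinear_diag_act)
  fix f \<tau>
  let ?t = "tv \<tau>" and ?d = "\<lambda>j. diag_act N (transpose i j) (tensor f (tv \<tau>))"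
  have "(\<Sum>j\<in>{1..N} - {i}. tensor (div_diff i j (var i * f)) (vec_act N (transpose i j) ?t))
      = (\<Sum>j\<in>{1..N} - {i}. tensor (weighted_diff i j f) (vec_act N (transpose i j) ?t)) +
        (\<Sum>j\<in>{1..N} - {i}. ?d j)"
    by (simp add: div_diff_var_mult tensor_simps diag_act_tensor sum.distrib)
  moreover have "(\<Sum>j\<in>{1..N} - {i}. ?d j) = (\<Sum>j\<in>{1..<i}. ?d j) + (\<Sum>j\<in>{i<..N}. ?d j)"
  proof -
    have A: "{1..N} - {i} = {1..<i} \<union> {i<..N}" using i by auto
    have B: "{1..<i} \<inter> {i<..N} = {}" by (simp add: disjoint_iff)
    show ?thesis unfolding A
      by (rule sum.union_disjoint[OF finite_atLeastLessThan finite_greaterThanAtMost B])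
  qed
  ultimately show "xi N i (tensor f ?t) =
      equivariant_part i (tensor f ?t) + (\<Sum>j\<in>{i<..N}. diag_act N (transpose i j) (tensor f ?t))"
    unfolding xi_def Cherednik_def pmul_tensor Dunkl_tensor_tv pol_deriv_var_mult
      equivariant_part_tensor
    by (simp add: tensor_simps M.scale_right_distrib M.scale_right_diff_distrib)
qed

section \<open>Exchange relations with permutations\<close>

lemma diag_act_compose:
  assumes "\<omega> permutes {1..N}" "\<omega>' permutes {1..N}" "P \<in> W_space"
  shows "diag_act N \<omega>' (diag_act N \<omega> P) = diag_act N (\<omega> \<circ> \<omega>') P"
proof (rule mlinear_eqI[OF mlinear_compose[OF mlinear_diag_act mlinear_diag_act] mlinear_diag_act])
  fix f \<tau> assume "\<tau> \<in> keys P"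
  then have "tv \<tau> \<in> V_space" using assms W_spaceI by blast
  then show "diag_act N \<omega>' (diag_act N \<omega> (tensor f (tv \<tau>))) = diag_act N (\<omega> \<circ> \<omega>') (tensor f (tv \<tau>))"
    using assms by (simp add: diag_act_tensor vec_act_compose pol_act_compose permutes_inj)
qed

lemma diag_act_id: "P \<in> W_space \<Longrightarrow> diag_act N id P = P"
  by (rule mlinear_eqI[OF mlinear_diag_act mlinear_id])
    (auto simp: diag_act_tensor vec_act_id pol_act_id dest: W_spaceI)

lemma diag_act_transpose_involution:
  assumes "i \<in> {1..N}" "j \<in> {1..N}" "P \<in> W_space"
  shows "diag_act N (transpose i j) (diag_act N (transpose i j) P) = P"
  using assms by (simp add: diag_act_compose transpose_permutes diag_act_id)

lemma transpose_permutes_conj: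
  assumes "\<omega> permutes A"
  shows "\<omega> \<circ> transpose a b = transpose (\<omega> a) (\<omega> b) \<circ> \<omega>"
  using permutes_inj[OF assms] by (auto simp: fun_eq_iff transpose_def dest: injD)

lemma diag_act_transpose_conj:
  assumes "\<omega> permutes {1..N}" "a \<in> {1..N}" "b \<in> {1..N}" "P \<in> W_space"
  shows "diag_act N (transpose a b) (diag_act N \<omega> P) = diag_act N \<omega> (diag_act N (transpose (\<omega> a) (\<omega>
      b)) P)"
proof -
  have "\<omega> a \<in> {1..N}" "\<omega> b \<in> {1..N}" using assms permutes_in_image by metis+
  then show ?thesis
    using assms by (simp add: diag_act_compose transpose_permutes transpose_permutes_conj)
qed

lemma equivariant_part_diag_act:
  assumes \<omega>: "\<omega> permutes {1..N}" and i: "i \<in> {1..N}" and P: "P \<in> W_space"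
  shows "equivariant_part i (diag_act N \<omega> P) = diag_act N \<omega> (equivariant_part (\<omega> i) P)"
proof (rule mlinear_eqI[OF mlinear_compose[OF mlinear_equivariant_part mlinear_diag_act]
      mlinear_compose[OF mlinear_diag_act mlinear_equivariant_part]])
  fix f \<tau> assume "\<tau> \<in> keys P"
  then have t: "tv \<tau> \<in> V_space" using P W_spaceI by blast
  let ?t = "tv \<tau>"
  have inj: "inj \<omega>" and bij: "bij \<omega>" using permutes_inj[OF \<omega>] permutes_bij[OF \<omega>] by auto
  have img: "\<omega> ` ({1..N} - {i}) = {1..N} - {\<omega> i}"
    using inj permutes_image[OF \<omega>] by (simp add: image_set_diff)
  have "diag_act N \<omega> (equivariant_part (\<omega> i) (tensor f ?t)) =
     mscale alpha (tensor (pol_act \<omega> (euler (\<omega> i) f)) (vec_act N \<omega> ?t)) +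
     (\<Sum>j\<in>\<omega> ` ({1..N} - {i}). tensor (pol_act \<omega> (weighted_diff (\<omega> i) j f))
        (vec_act N \<omega> (vec_act N (transpose (\<omega> i) j) ?t)))"
    unfolding equivariant_part_tensor img
    by (simp add: mlinear_add[OF mlinear_diag_act] mlinear_scale[OF mlinear_diag_act]
        mlinear_sum[OF mlinear_diag_act] diag_act_tensor)
  also have "(\<Sum>j\<in>\<omega> ` ({1..N} - {i}). tensor (pol_act \<omega> (weighted_diff (\<omega> i) j f))
        (vec_act N \<omega> (vec_act N (transpose (\<omega> i) j) ?t)))
     = (\<Sum>j\<in>{1..N} - {i}. tensor (weighted_diff i j (pol_act \<omega> f))
        (vec_act N (transpose i j) (vec_act N \<omega> ?t)))"
  proof (subst sum.reindex)
    show "inj_on \<omega> ({1..N} - {i})" using inj inj_on_subset by blast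
    show "sum ((\<lambda>j. tensor (pol_act \<omega> (weighted_diff (\<omega> i) j f)) (vec_act N \<omega> (vec_act N (transpose
        (\<omega> i) j) ?t))) \<circ> \<omega>) ({1..N} - {i}) =
        (\<Sum>j\<in>{1..N} - {i}. tensor (weighted_diff i j (pol_act \<omega> f)) (vec_act N (transpose i j)
            (vec_act N \<omega> ?t)))"
    proof (rule sum.cong[OF refl])
      fix j assume j: "j \<in> {1..N} - {i}"
      have "\<omega> i \<in> {1..N}" "\<omega> j \<in> {1..N}" using permutes_in_image[OF \<omega>] i j by auto
      then have "vec_act N \<omega> (vec_act N (transpose (\<omega> i) (\<omega> j)) ?t) =
          vec_act N (transpose i j) (vec_act N \<omega> ?t)"
        using t i j \<omega> by (simp add: vec_act_compose(1)[symmetric] transpose_permutes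
            transpose_permutes_conj[OF \<omega>] del: comp_apply)
      then show "((\<lambda>j. tensor (pol_act \<omega> (weighted_diff (\<omega> i) j f)) (vec_act N \<omega> (vec_act N
          (transpose (\<omega> i) j) ?t))) \<circ> \<omega>) j =
          tensor (weighted_diff i j (pol_act \<omega> f)) (vec_act N (transpose i j) (vec_act N \<omega> ?t))"
        using weighted_diff_pol_act[of i j \<omega> f] bij j by simp
    qed
  qed
  finally show "equivariant_part i (diag_act N \<omega> (tensor f ?t)) =
      diag_act N \<omega> (equivariant_part (\<omega> i) (tensor f ?t))"
    unfolding diag_act_tensor equivariant_part_tensor euler_pol_act[OF inj] by simp
qed

text \<open>The index set K is left arbitrary because \<omega> need not carry {i<..N} to {\<omega>
  i<..N}; the discrepancy between the two sets is the correction term of each exchange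
  relation.\<close>

lemma xi_like_diag_act:
  assumes \<omega>: "\<omega> permutes {1..N}" and i: "i \<in> {1..N}" and K: "K \<subseteq> {1..N}" and P: "P \<in> W_space"
  shows "equivariant_part i (diag_act N \<omega> P) + (\<Sum>k\<in>K. diag_act N (transpose i k) (diag_act N \<omega> P))
    = diag_act N \<omega> (equivariant_part (\<omega> i) P + (\<Sum>k\<in>\<omega> ` K. diag_act N (transpose (\<omega> i) k) P))"
proof -
  have "(\<Sum>k\<in>\<omega> ` K. diag_act N (transpose (\<omega> i) k) P) = (\<Sum>k\<in>K. diag_act N (transpose (\<omega> i) (\<omega> k)) P)"
    by (subst sum.reindex) (use permutes_inj[OF \<omega>] inj_on_subset in \<open>auto simp: comp_def\<close>)
  moreover have "(\<Sum>k\<in>K. diag_act N (transpose i k) (diag_act N \<omega> P)) =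
      (\<Sum>k\<in>K. diag_act N \<omega> (diag_act N (transpose (\<omega> i) (\<omega> k)) P))"
    by (rule sum.cong[OF refl]) (use assms in \<open>auto intro!: diag_act_transpose_conj\<close>)
  ultimately show ?thesis
    using assms by (simp add: equivariant_part_diag_act mlinear_add[OF mlinear_diag_act]
        mlinear_sum[OF mlinear_diag_act])
qed

lemma simple_permutes: "1 \<le> i \<Longrightarrow> i < N \<Longrightarrow> transpose i (Suc i) permutes {1..N}"
  by (rule transpose_permutes) auto

lemma xi_diag_act_other:
  assumes "1 \<le> i" "i < N" "j \<in> {1..N}" "j \<noteq> i" "j \<noteq> Suc i" "P \<in> W_space"
  shows "xi N j (diag_act N (transpose i (Suc i)) P) = diag_act N (transpose i (Suc i)) (xi N j P)"
proof -
  let ?s = "transpose i (Suc i)"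
  have "?s ` {j<..N} = {j<..N}"
  proof (cases "j < i")
    case True
    then show ?thesis using assms by (intro permutes_image[OF permutes_swap_id]) auto
  next
    case False
    then show ?thesis using assms by (auto simp: transpose_def image_iff)
  qed
  moreover have "{j<..N} \<subseteq> {1..N}" by auto
  ultimately show ?thesis
    using xi_like_diag_act[OF simple_permutes, of i j "{j<..N}" P] assms by (simp add: xi_eq)
qed

text \<open>The image of {i<..N} under s_i is {i+1<..N} with i added. The extra summand is s_i
  \<otimes> s_i, whose square is the identity.\<close>

lemma xi_diag_act_left:
  assumes "1 \<le> i" "i < N" "P \<in> W_space"
  shows "xi N i (diag_act N (transpose i (Suc i)) P) = diag_act N (transpose i (Suc i)) (xi N (Suc
      i) P) + P"
proof -
  let ?s = "transpose i (Suc i)"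
  have "?s ` {i<..N} = insert i {Suc i<..N}"
  proof -
    have "{i<..N} = insert (Suc i) {Suc i<..N}" using assms by auto
    moreover have "?s ` {Suc i<..N} = {Suc i<..N}" by (auto simp: transpose_def image_iff)
    ultimately show ?thesis by simp
  qed
  moreover have "{i<..N} \<subseteq> {1..N}" by auto
  ultimately have "xi N i (diag_act N ?s P) =
      diag_act N ?s (equivariant_part (Suc i) P + (\<Sum>k\<in>insert i {Suc i<..N}. diag_act N (transpose
          (Suc i) k) P))"
    using xi_like_diag_act[OF simple_permutes, of i i "{i<..N}" P] assms by (simp add: xi_eq)
  also have "equivariant_part (Suc i) P + (\<Sum>k\<in>insert i {Suc i<..N}. diag_act N (transpose (Suc i) k) P)
      = xi N (Suc i) P + diag_act N ?s P"
    using assms by (simp add: xi_eq transpose_commute add.commute add.left_commute)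
  finally show ?thesis
    using assms by (simp add: mlinear_add[OF mlinear_diag_act] diag_act_transpose_involution)
qed

text \<open>Here s_i fixes {i+1<..N}, which lacks the index i + 1 occurring in
  \<open>xi N i\<close>; the missing summand gives - P.\<close>

lemma xi_diag_act_right:
  assumes "1 \<le> i" "i < N" "P \<in> W_space"
  shows "xi N (Suc i) (diag_act N (transpose i (Suc i)) P) =
      diag_act N (transpose i (Suc i)) (xi N i P) - P"
proof -
  let ?s = "transpose i (Suc i)"
  have "?s ` {Suc i<..N} = {Suc i<..N}" by (auto simp: transpose_def image_iff)
  moreover have "{Suc i<..N} \<subseteq> {1..N}" by auto
  ultimately have "xi N (Suc i) (diag_act N ?s P) =
      diag_act N ?s (equivariant_part i P + (\<Sum>k\<in>{Suc i<..N}. diag_act N (transpose i k) P))"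
    using xi_like_diag_act[OF simple_permutes, of i "Suc i" "{Suc i<..N}" P] assms by (simp add: xi_eq)
  also have "equivariant_part i P + (\<Sum>k\<in>{Suc i<..N}. diag_act N (transpose i k) P)
      = xi N i P - diag_act N ?s P"
  proof -
    have "{i<..N} = insert (Suc i) {Suc i<..N}" using assms by auto
    then show ?thesis using assms by (simp add: xi_eq)
  qed
  finally show ?thesis
    using assms by (simp add: mlinear_diff[OF mlinear_diag_act] diag_act_transpose_involution)
qed

section \<open>Exchange relations with the affine operator\<close>

abbreviation rotation :: "nat \<Rightarrow> nat" where
  "rotation \<equiv> word_perm [1..<N]"

lemma rotation_permutes: "rotation permutes {1..N}"
  by (rule word_perm_permutes) auto

lemma word_perm_upt: "k \<le> n \<Longrightarrow> word_perm [k..<n] j = (if k \<le> j \<and> j < n then Suc j else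
    if j = n then k else j)"
proof (induction "n - k" arbitrary: k)
  case (Suc d)
  then have "[k..<n] = k # [Suc k..<n]" by (simp add: upt_conv_Cons)
  then show ?case using Suc.hyps(1)[of "Suc k"] Suc.hyps(2) Suc.prems by (auto simp: transpose_def)
qed simp

lemma rotation_eq: "j \<in> {1..N} \<Longrightarrow> rotation j = (if j = N then 1 else Suc j)"
  using word_perm_upt[OF N_pos, of j] by auto

text \<open>Pulling x_N out of the divided difference for j, N leaves the term - x_j (f s_jN), and
  the exchange s_jN applied to x_N f is the same term with opposite sign. So the summand k = N
  disappears from the second sum.\<close>

lemma xi_pmul_less:
  assumes "1 \<le> j" "j < N"
  shows "xi N j (pmul (var N) P) = pmul (var N) (equivariant_part j P +
      (\<Sum>k\<in>{j<..<N}. diag_act N (transpose j k) P))"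
proof (rule mlinear_eqI[OF mlinear_compose[OF mlinear_xi mlinear_pmul]])
  show "mlinear (\<lambda>P. pmul (var N) (equivariant_part j P + (\<Sum>k\<in>{j<..<N}. diag_act N (transpose j k) P)))"
    by (intro mlinear_compose[OF mlinear_pmul] mlinear_plus mlinear_equivariant_part mlinear_sum_fun
        mlinear_diag_act)
  fix f \<tau>
  let ?t = "tv \<tau>"
  have 1: "(\<Sum>k\<in>{1..N} - {j}. tensor (weighted_diff j k (var N * f)) (vec_act N (transpose j k) ?t)) =
      (\<Sum>k\<in>{1..N} - {j}. tensor (var N * weighted_diff j k f) (vec_act N (transpose j k) ?t))
      - tensor (var j * pol_act (transpose j N) f) (vec_act N (transpose j N) ?t)"
  proof -
    have A: "{1..N} - {j} = insert N ({1..<N} - {j})" using assms by auto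
    have "(\<Sum>k\<in>{1..<N} - {j}. tensor (weighted_diff j k (var N * f)) (vec_act N (transpose j k) ?t)) =
      (\<Sum>k\<in>{1..<N} - {j}. tensor (var N * weighted_diff j k f) (vec_act N (transpose j k) ?t))"
      by (rule sum.cong[OF refl]) (use assms in \<open>auto simp: weighted_diff_var_mult(1)\<close>)
    then show ?thesis unfolding A using assms
      by (simp add: weighted_diff_var_mult(2) tensor_simps)
  qed
  have 2: "(\<Sum>k\<in>{j<..N}. diag_act N (transpose j k) (tensor (var N * f) ?t)) =
      (\<Sum>k\<in>{j<..<N}. pmul (var N) (diag_act N (transpose j k) (tensor f ?t)))
      + tensor (var j * pol_act (transpose j N) f) (vec_act N (transpose j N) ?t)"
  proof -
    have A: "{j<..N} = insert N {j<..<N}" using assms by auto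
    have "(\<Sum>k\<in>{j<..<N}. diag_act N (transpose j k) (tensor (var N * f) ?t)) =
      (\<Sum>k\<in>{j<..<N}. pmul (var N) (diag_act N (transpose j k) (tensor f ?t)))"
      by (rule sum.cong[OF refl])
        (use assms in \<open>auto simp: diag_act_tensor pmul_tensor pol_act_mult pol_act_transpose_var\<close>)
    then show ?thesis unfolding A
      by (simp add: diag_act_tensor pol_act_mult pol_act_transpose_var)
  qed
  show "xi N j (pmul (var N) (tensor f ?t)) = pmul (var N) (equivariant_part j (tensor f ?t)
      + (\<Sum>k\<in>{j<..<N}. diag_act N (transpose j k) (tensor f ?t)))"
    using assms
    by (simp add: xi_eq pmul_tensor 2 equivariant_part_tensor 1 euler_var_mult mlinear_add[OF
        mlinear_pmul]
        mlinear_scale[OF mlinear_pmul] mlinear_sum[OF mlinear_pmul])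
qed

text \<open>For the index N every divided difference releases an exchange term, which supplies the
  sum over all k < N, and the Euler operator releases \<alpha> P.\<close>

lemma xi_pmul_last:
  "xi N N (pmul (var N) P) = pmul (var N) (equivariant_part N P +
      (\<Sum>k\<in>{1..<N}. diag_act N (transpose N k) P) + mscale alpha P)"
proof (rule mlinear_eqI[OF mlinear_compose[OF mlinear_xi mlinear_pmul]])
  show "mlinear (\<lambda>P. pmul (var N) (equivariant_part N P +
      (\<Sum>k\<in>{1..<N}. diag_act N (transpose N k) P) + mscale alpha P))"
    by (intro mlinear_compose[OF mlinear_pmul] mlinear_plus mlinear_equivariant_part mlinear_sum_fun
        mlinear_diag_act
        mlinear_mscale)
  fix f \<tau>
  let ?t = "tv \<tau>"
  have A: "{1..N} - {N} = {1..<N}" by auto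
  have 1: "(\<Sum>k\<in>{1..<N}. tensor (weighted_diff N k (var N * f)) (vec_act N (transpose N k) ?t)) =
      (\<Sum>k\<in>{1..<N}. tensor (var N * weighted_diff N k f) (vec_act N (transpose N k) ?t))
      + (\<Sum>k\<in>{1..<N}. pmul (var N) (diag_act N (transpose N k) (tensor f ?t)))"
    unfolding sum.distrib[symmetric]
    by (rule sum.cong[OF refl])
      (auto simp: weighted_diff_var_mult(3) distrib_left tensor_simps diag_act_tensor pmul_tensor)
  show "xi N N (pmul (var N) (tensor f ?t)) = pmul (var N) (equivariant_part N (tensor f ?t)
      + (\<Sum>k\<in>{1..<N}. diag_act N (transpose N k) (tensor f ?t)) + mscale alpha (tensor f ?t))"
    using N_pos
    by (simp add: xi_eq pmul_tensor equivariant_part_tensor A 1 euler_var_mult mlinear_add[OF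
        mlinear_pmul]
        mlinear_scale[OF mlinear_pmul] mlinear_sum[OF mlinear_pmul] distrib_left tensor_simps
            M.scale_right_distrib)
qed

text \<open>The rotation carries j to j + 1 and {j<..<N} to {j+1<..N}, so the truncated sum left by
  \<open>xi_pmul_less\<close> becomes the full one for j + 1.\<close>

lemma xi_MPsi_less:
  assumes "1 \<le> j" "j < N" "P \<in> W_space"
  shows "xi N j (MPsi N P) = MPsi N (xi N (Suc j) P)"
proof -
  have r: "rotation j = Suc j" using rotation_eq[of j] assms by auto
  have "rotation ` {j<..<N} = Suc ` {j<..<N}"
    by (rule image_cong[OF refl]) (use assms rotation_eq in auto)
  also have "\<dots> = {Suc j<..N}" by (rule set_eqI, case_tac x) auto
  finally have "rotation ` {j<..<N} = {Suc j<..N}" .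
  moreover have "{j<..<N} \<subseteq> {1..N}" by auto
  ultimately have "equivariant_part j (diag_act N rotation P) +
      (\<Sum>k\<in>{j<..<N}. diag_act N (transpose j k) (diag_act N rotation P)) =
          diag_act N rotation (xi N (Suc j) P)"
    using xi_like_diag_act[OF rotation_permutes, of j "{j<..<N}" P] assms by (simp add: r xi_eq)
  then show ?thesis unfolding MPsi_def xi_pmul_less[OF assms(1,2)] by simp
qed

text \<open>The rotation carries N to 1 and {1..<N} to {1<..N}, while the extra \<alpha> records the
  increased exponent.\<close>

lemma xi_MPsi_last:
  assumes "P \<in> W_space"
  shows "xi N N (MPsi N P) = MPsi N (xi N 1 P) + mscale alpha (MPsi N P)"
proof -
  have r: "rotation N = 1" using rotation_eq[of N] N_pos by auto
  have "rotation ` {1..<N} = Suc ` {1..<N}"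
    by (rule image_cong[OF refl]) (use rotation_eq in auto)
  also have "\<dots> = {1<..N}" by (rule set_eqI, case_tac x) auto
  finally have i: "rotation ` {1..<N} = {1<..N}" .
  have "xi N N (MPsi N P) = pmul (var N) ((equivariant_part N (diag_act N rotation P) +
      (\<Sum>k\<in>{1..<N}. diag_act N (transpose N k) (diag_act N rotation P))) +
          mscale alpha (diag_act N rotation P))"
    unfolding MPsi_def by (rule xi_pmul_last)
  also have "equivariant_part N (diag_act N rotation P) +
      (\<Sum>k\<in>{1..<N}. diag_act N (transpose N k) (diag_act N rotation P)) = diag_act N rotation (xi N 1 P)"
    using assms N_pos by (subst xi_like_diag_act[OF rotation_permutes]) (auto simp: r i xi_eq)
  finally show ?thesis
    unfolding MPsi_def by (simp add: mlinear_add[OF mlinear_pmul] mlinear_scale[OF mlinear_pmul])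
qed

end

section \<open>The order on exponent vectors\<close>

lemma length_vplus [simp]: "length (vplus v) = length v"
  by (simp add: vplus_def)

lemma mset_vplus [simp]: "mset (vplus v) = mset v"
  by (simp add: vplus_def)

lemma vplus_cong: "mset u = mset v \<Longrightarrow> vplus u = vplus v"
  unfolding vplus_def by (metis sorted_list_of_multiset_mset)

lemma dom_le_refl: "dom_le u u"
  by (simp add: dom_le_def)

lemma dom_le_trans: "dom_le u v \<Longrightarrow> dom_le v w \<Longrightarrow> dom_le u w"
  unfolding dom_le_def using order_trans by blast

lemma dom_le_antisym:
  assumes "length u = length v" "dom_le u v" "dom_le v u"
  shows "u = v"
proof (rule nth_equalityI[OF assms(1)])
  fix k assume k: "k < length u"
  have eq: "sum_list (take j u) = sum_list (take j v)" for j
    using assms(2,3) by (simp add: dom_le_def order_antisym)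
  show "u ! k = v ! k"
    using eq[of k] eq[of "Suc k"] k assms(1) by (simp add: take_Suc_conv_app_nth)
qed

lemma vlhd_irrefl: "\<not> vlhd u u"
  by (simp add: vlhd_def dom_less_def)

lemma vlhd_trans:
  assumes "vlhd u v" "vlhd v w" "length u = n" "length v = n" "length w = n"
  shows "vlhd u w"
proof -
  have trans: "dom_less x z" if "dom_less x y" "dom_less y z" "length x = n" "length y =
      n" "length z = n" for x y z
    using that dom_le_trans dom_le_antisym unfolding dom_less_def by metis
  show ?thesis
    using assms trans[of "vplus u" "vplus v" "vplus w"] trans[of u v w] unfolding vlhd_def by auto
qed

lemma vlhd_sum_le: assumes "vlhd u v" "length u = length v" shows "sum_list u \<le> sum_list v"
proof -
  have s: "sum_list (vplus w) = sum_list w" for w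
    by (metis mset_vplus sum_mset_sum_list)
  have "dom_le (vplus u) (vplus v)"
    using assms by (auto simp: vlhd_def dom_less_def dom_le_refl)
  then have "sum_list (take (length v) (vplus u)) \<le> sum_list (take (length v) (vplus v))"
    unfolding dom_le_def by blast
  then show ?thesis using assms(2) by (simp add: s)
qed

text \<open>All smaller vectors have sum at most that of v. Finiteness turns the number of
  predecessors into an induction measure.\<close>

lemma finite_vlhd: "finite {u. length u = length v \<and> vlhd u v}"
proof (rule finite_subset)
  show "{u. length u = length v \<and> vlhd u v} \<subseteq> {u. set u \<subseteq> {..sum_list v} \<and> length u = length v}"
    using vlhd_sum_le member_le_sum_list order_trans by fastforce
qed (rule finite_lists_length_eq, simp)

section \<open>Moves that lower an exponent vector\<close>

lemma sum_list_map_mset_cong: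
  fixes f :: "'a \<Rightarrow> nat"
  assumes "mset u = mset v"
  shows "sum_list (map f u) = sum_list (map f v)"
proof -
  have "sum_mset (image_mset f (mset u)) = sum_mset (image_mset f (mset v))" using assms by simp
  then show ?thesis unfolding mset_map[symmetric] sum_mset_sum_list .
qed

lemma sum_list_map_update:
  fixes f :: "'a \<Rightarrow> nat"
  shows "p < length u \<Longrightarrow> sum_list (map f (u[p := a])) + f (u ! p) = sum_list (map f u) + f a"
proof (induction u arbitrary: p)
  case (Cons x u)
  then show ?case by (cases p) auto
qed simp

text \<open>The rearrangement is unchanged, and moving the larger entry to the right lowers exactly
  the partial sums that include position p but not q.\<close>

lemma vlhd_swap:
  assumes "p < q" "q < length u" "u ! q < u ! p"
  shows "vlhd (u[p := u ! q, q := u ! p]) u"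
proof -
  let ?w = "u[p := u ! q, q := u ! p]"
  have m: "vplus ?w = vplus u"
    using mset_swap[of q u p] assms by (intro vplus_cong) simp
  have "sum_list (take k ?w) + (if p < k \<and> k \<le> q then u ! p - u ! q else 0) = sum_list (take k u)" for k
  proof (induction k)
    case (Suc k)
    show ?case
    proof (cases "k < length u")
      case True
      then have *: "take (Suc k) ?w = take k ?w @ [?w ! k]" "take (Suc k) u = take k u @ [u ! k]"
        by (simp_all add: take_Suc_conv_app_nth)
      have "?w ! k = (if k = q then u ! p else if k = p then u ! q else u ! k)"
        using assms True by (auto simp: nth_list_update)
      then show ?thesis using Suc assms unfolding * by (auto split: if_splits)
    qed (use Suc assms in \<open>auto split: if_splits\<close>)
  qed simp
  then have "dom_le ?w u" unfolding dom_le_def by (metis le_add1)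
  moreover have "?w ! p \<noteq> u ! p" using assms by simp
  ultimately show ?thesis unfolding vlhd_def m dom_less_def by auto
qed

text \<open>The sum of the \<open>k\<close> largest entries of \<open>u\<close> is the minimum over \<open>c\<close> of
  \<open>k c + \<Sum>\<^sub>x max (x - c) 0\<close>, which is convex and symmetric in the entries.\<close>

lemma sum_take_le_threshold: "sum_list (take k d) \<le> k * c + (\<Sum>x\<leftarrow>d. x - c)" for c :: nat
proof (induction d arbitrary: k)
  case (Cons x d)
  show ?case
  proof (cases k)
    case (Suc k')
    then show ?thesis using Cons[of k'] by simp
  qed simp
qed simp

text \<open>The bound of \<open>sum_take_le_threshold\<close> is attained when the threshold is the
  entry following the k largest ones.\<close>

lemma threshold_le_sum_take:
  "sorted_wrt (\<ge>) d \<Longrightarrow> k < length d \<Longrightarrow> k * (d ! k) + (\<Sum>x\<leftarrow>d. x - d ! k) \<le> sum_list (take k d)"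
      for d :: "nat list"
proof (induction d arbitrary: k)
  case (Cons x d)
  show ?case
  proof (cases k)
    case 0
    have "(\<Sum>y\<leftarrow>d. y - x) = (\<Sum>y\<leftarrow>d. 0)"
      using Cons.prems by (intro arg_cong[where f = sum_list] map_cong) auto
    then show ?thesis using 0 by simp
  next
    case (Suc k')
    define c where "c = d ! k'"
    have "c \<le> x" using Cons.prems Suc by (auto simp: c_def)
    moreover have "k' * c + (\<Sum>y\<leftarrow>d. y - c) \<le> sum_list (take k' d)"
      using Cons.IH[of k'] Cons.prems Suc by (auto simp: c_def)
    ultimately have "(c + k' * c) + ((x - c) + (\<Sum>y\<leftarrow>d. y - c)) \<le> x + sum_list (take k' d)" by linarith
    then show ?thesis using Suc by (simp add: c_def)
  qed
qed simp

text \<open>The threshold sums are symmetric in the entries, so dominance of the rearrangements can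
  be tested without sorting the modified vector.\<close>

lemma dom_le_vplusI:
  assumes "length w = length u" "\<And>c::nat. (\<Sum>x\<leftarrow>w. x - c) \<le> (\<Sum>x\<leftarrow>u. x - c)"
  shows "dom_le (vplus w) (vplus u)"
  unfolding dom_le_def
proof
  fix k
  have m: "(\<Sum>x\<leftarrow>vplus v. x - c) = (\<Sum>x\<leftarrow>v. x - c)" for v and c :: nat
    by (rule sum_list_map_mset_cong) simp
  have s: "sorted_wrt (\<ge>) (vplus u)" by (simp add: vplus_def sorted_wrt_rev)
  \<comment> \<open>For k at least the length, threshold 0 turns the bound into the full
    sum.\<close>
  define c where "c = (if k < length u then vplus u ! k else 0)"
  have "sum_list (take k (vplus w)) \<le> k * c + (\<Sum>x\<leftarrow>vplus w. x - c)"
    by (rule sum_take_le_threshold)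
  also have "\<dots> \<le> k * c + (\<Sum>x\<leftarrow>vplus u. x - c)" using assms(2)[of c] by (simp add: m)
  also have "\<dots> \<le> sum_list (take k (vplus u))"
    using threshold_le_sum_take[OF s, of k] by (auto simp: c_def)
  finally show "sum_list (take k (vplus w)) \<le> sum_list (take k (vplus u))" .
qed

lemma square_sum_strict:
  fixes b k d :: nat
  assumes "0 < k" "0 < d"
  shows "(b + d) * (b + d) + (b + k) * (b + k) < (b + k + d) * (b + k + d) + b * b"
proof -
  have "(b + k + d) * (b + k + d) + b * b = (b + d) * (b + d) + (b + k) * (b + k) + 2 * (k * d)"
    by (simp add: algebra_simps)
  then show ?thesis using assms by simp
qed

text \<open>The truncated difference x - c is convex in x, so moving two entries towards each other
  cannot raise a threshold sum. Strictness is seen on the sum of squares, which depends only on the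
  multiset of entries.\<close>

lemma vlhd_squeeze:
  assumes "p \<noteq> q" "p < length u" "q < length u" "0 < k" "u ! q + k < u ! p"
  shows "vlhd (u[p := u ! p - k, q := u ! q + k]) u"
proof -
  let ?w = "u[p := u ! p - k, q := u ! q + k]"
  have f: "sum_list (map f ?w) + f (u ! p) + f (u ! q) = sum_list (map f u) + f (u ! p - k) +
      f (u ! q + k)" for f :: "nat \<Rightarrow> nat"
    using sum_list_map_update[of p u f "u ! p - k"] sum_list_map_update[of q "u[p := u ! p - k]"
        f "u ! q + k"] assms
    by simp
  have "dom_le (vplus ?w) (vplus u)"
  proof (rule dom_le_vplusI)
    fix c
    have "u ! p - k - c + (u ! q + k - c) \<le> u ! p - c + (u ! q - c)" using assms(5) by linarith
    then show "(\<Sum>x\<leftarrow>?w. x - c) \<le> (\<Sum>x\<leftarrow>u. x - c)" using f[of "\<lambda>x. x - c"] by linarith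
  qed simp
  moreover have "vplus ?w \<noteq> vplus u"
  proof
    assume "vplus ?w = vplus u"
    then have "mset ?w = mset u" by (metis mset_vplus)
    then have "sum_list (map (\<lambda>x. x * x) ?w) = sum_list (map (\<lambda>x. x * x) u)"
      by (rule sum_list_map_mset_cong)
    then have e: "u ! p * (u ! p) + u ! q * (u ! q) = (u ! p - k) * (u ! p - k) + (u ! q +
        k) * (u ! q + k)"
      using f[of "\<lambda>x. x * x"] by simp
    define d where "d = u ! p - (u ! q + k)"
    have d: "u ! p = u ! q + k + d" "d > 0" using assms(5) by (simp_all add: d_def)
    have "u ! p - k = u ! q + d" using d(1) by simp
    then show False using e square_sum_strict[OF assms(4) d(2), of "u ! q"] unfolding d(1) by simp
  qed
  ultimately show ?thesis by (simp add: vlhd_def dom_less_def)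
qed

text \<open>Transitivity is asked within A, as that of \<open>vlhd\<close> is proved for vectors of
  a common length.\<close>

lemma exists_maximal_above:
  assumes "finite A" "x \<in> A" and irrefl: "\<And>x. \<not> R x x"
    and trans: "\<And>x y z. x \<in> A \<Longrightarrow> y \<in> A \<Longrightarrow> z \<in> A \<Longrightarrow> R x y \<Longrightarrow> R y z \<Longrightarrow> R x z"
  obtains y where "y \<in> A" "y = x \<or> R x y" "\<And>z. z \<in> A \<Longrightarrow> \<not> R y z"
proof -
  have "\<exists>y\<in>A. (y = x \<or> R x y) \<and> (\<forall>z\<in>A. \<not> R y z)"
    using assms(2)
  proof (induction "card {z \<in> A. R x z}" arbitrary: x rule: less_induct)
    case less
    show ?case
    proof (cases "\<exists>z\<in>A. R x z")
      case True
      then obtain z where z: "z \<in> A" "R x z" by blast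
      have "{w \<in> A. R z w} \<subset> {w \<in> A. R x w}"
      proof
        show "{w \<in> A. R z w} \<subseteq> {w \<in> A. R x w}"
          using trans[OF less.prems z(1)] z by blast
        show "{w \<in> A. R z w} \<noteq> {w \<in> A. R x w}" using irrefl z by blast
      qed
      then have "card {w \<in> A. R z w} < card {w \<in> A. R x w}"
        using assms(1) by (intro psubset_card_mono) auto
      then obtain y where "y \<in> A" "y = z \<or> R z y" "\<forall>w\<in>A. \<not> R y w" using less.hyps z(1) by blast
      then show ?thesis using trans[OF less.prems z(1)] z by blast
    qed (use less.prems in blast)
  qed
  then show ?thesis using that by blast
qed

section \<open>Exponents and coefficients\<close>

definition exponent_list :: "nat \<Rightarrow> (nat \<Rightarrow>\<^sub>0 nat) \<Rightarrow> nat list" where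
  "exponent_list N m = map (lookup m) [1..<Suc N]"

definition list_exponent :: "nat list \<Rightarrow> nat \<Rightarrow>\<^sub>0 nat" where
  "list_exponent v = (\<Sum>i = 1..length v. single i (entry v i))"

lemma length_exponent_list [simp]: "length (exponent_list N m) = N"
  by (simp add: exponent_list_def)

lemma nth_exponent_list: "p < N \<Longrightarrow> exponent_list N m ! p = lookup m (Suc p)"
  by (simp add: exponent_list_def One_nat_def del: upt_Suc)

lemma entry_exponent_list: "i \<in> {1..N} \<Longrightarrow> entry (exponent_list N m) i = lookup m i"
  by (cases i) (auto simp: entry_def nth_exponent_list)

lemma lookup_list_exponent:
  "lookup (list_exponent v) i = (if i \<in> {1..length v} then entry v i else 0)"
proof -
  have "lookup (list_exponent v) i = (\<Sum>k = 1..length v. if k = i then entry v i else 0)"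
    unfolding list_exponent_def lookup_sum
    by (rule sum.cong) (auto simp: lookup_single when_def)
  then show ?thesis by (simp add: sum.delta)
qed

lemma keys_list_exponent: "keys (list_exponent v) \<subseteq> {1..length v}"
  by (auto simp: in_keys_iff lookup_list_exponent split: if_splits)

lemma exponent_list_list_exponent: "length v = N \<Longrightarrow> exponent_list N (list_exponent v) = v"
  by (rule nth_equalityI) (auto simp: nth_exponent_list lookup_list_exponent entry_def One_nat_def)

lemma list_exponent_exponent_list:
  assumes "keys m \<subseteq> {1..N}" shows "list_exponent (exponent_list N m) = m"
proof (rule poly_mapping_eqI)
  fix i
  have "i \<notin> {1..N} \<Longrightarrow> lookup m i = 0" using assms by (meson in_keys_iff subsetD)
  then show "lookup (list_exponent (exponent_list N m)) i = lookup m i"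
    by (auto simp: lookup_list_exponent entry_exponent_list)
qed

lemma xpow_eq_single: "xpow v = single (list_exponent v) 1"
proof -
  have "(\<Prod>i\<in>A. var i ^ e i) = single (\<Sum>i\<in>A. single i (e i)) 1" for A e
    by (induction A rule: infinite_finite_induct) (auto simp: var_power mult_single)
  then show ?thesis by (simp add: xpow_def list_exponent_def)
qed

lemma exponent_list_with_exponents:
  assumes "i \<in> {1..N}" "j \<in> {1..N}" "i \<noteq> j"
  shows "exponent_list N (with_exponents i j m a b) = (exponent_list N m)[i - 1 := a, j - 1 := b]"
  by (rule nth_equalityI)
    (use assms in \<open>auto simp: nth_exponent_list lookup_with_exponents nth_list_update\<close>)

lemma vlhd_exponent_swap:
  assumes "i \<in> {1..N}" "j \<in> {1..N}" "i < j" "lookup m j < lookup m i"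
  shows "vlhd (exponent_list N (with_exponents i j m (lookup m j) (lookup m i))) (exponent_list N m)"
  using vlhd_swap[of "i - 1" "j - 1" "exponent_list N m"] assms
  by (simp add: exponent_list_with_exponents nth_exponent_list)

lemma vlhd_exponent_squeeze:
  assumes "i \<in> {1..N}" "j \<in> {1..N}" "i \<noteq> j" "0 < k" "lookup m j + k < lookup m i"
  shows "vlhd (exponent_list N (with_exponents i j m (lookup m i - k) (lookup m j +
      k))) (exponent_list N m)"
proof -
  have "i - 1 \<noteq> j - 1" "i - 1 < N" "j - 1 < N" using assms by auto
  then show ?thesis
    using vlhd_squeeze[of "i - 1" "j - 1" "exponent_list N m" k] assms
    by (simp add: exponent_list_with_exponents nth_exponent_list)
qed

lemma with_exponents_commute: "i \<noteq> j \<Longrightarrow> with_exponents i j m a b = with_exponents j i m b a"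
  by (rule poly_mapping_eqI) (auto simp: lookup_with_exponents)

text \<open>\<open>vpol\<close> stores a polynomial for every tableau; this is the other reading, as
  a polynomial with coefficients in the representation, to which leading terms refer.\<close>

definition coefficient :: "(nat \<Rightarrow>\<^sub>0 nat) \<Rightarrow> vpol \<Rightarrow> tabvec" where
  "coefficient m P = Poly_Mapping.map (\<lambda>f. lookup f m) P"

lemma lookup_coefficient:
  "lookup (coefficient m P) \<tau> = lookup (lookup P \<tau>) m"
  by (simp add: coefficient_def Poly_Mapping.map.rep_eq when_def)

lemma coefficient_simps:
  "coefficient m (P + Q) = coefficient m P + coefficient m Q"
  "coefficient m (P - Q) = coefficient m P - coefficient m Q"
  "coefficient m (mscale a P) = vscale a (coefficient m P)"
  "coefficient m (tensor f t) = vscale (lookup f m) t"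
  "coefficient m 0 = 0"
  by (auto intro!: poly_mapping_eqI simp: lookup_coefficient lookup_add lookup_minus lookup_mscale
      lookup_vscale lookup_tensor lookup_pconst_mult)

lemma coefficient_sum: "coefficient m (sum f A) = (\<Sum>x\<in>A. coefficient m (f x))"
  by (induction A rule: infinite_finite_induct) (auto simp: coefficient_simps)

definition support :: "vpol \<Rightarrow> (nat \<Rightarrow>\<^sub>0 nat) set" where
  "support P = {m. coefficient m P \<noteq> 0}"

lemma support_eq: "support P = (\<Union>\<tau>\<in>keys P. keys (lookup P \<tau>))"
proof (intro set_eqI)
  fix m
  have "coefficient m P \<noteq> 0 \<longleftrightarrow> (\<exists>\<tau>. lookup (lookup P \<tau>) m \<noteq> 0)"
    by (auto simp: lookup_coefficient[symmetric] intro!: poly_mapping_eqI)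
  also have "\<dots> \<longleftrightarrow> (\<exists>\<tau>\<in>keys P. m \<in> keys (lookup P \<tau>))"
    by (metis in_keys_iff lookup_zero)
  finally show "m \<in> support P \<longleftrightarrow> m \<in> (\<Union>\<tau>\<in>keys P. keys (lookup P \<tau>))"
    by (simp add: support_def)
qed

lemma finite_support [simp]: "finite (support P)"
  by (simp add: support_eq)

lemma coefficient_eqI: "(\<And>m. coefficient m P = coefficient m Q) \<Longrightarrow> P = Q"
  by (intro poly_mapping_eqI) (metis lookup_coefficient)

lemma coefficient_expansion: "P = (\<Sum>m\<in>support P. tensor (single m 1) (coefficient m P))"
proof (rule coefficient_eqI)
  fix m
  have "(\<Sum>k\<in>support P. coefficient m (tensor (single k 1) (coefficient k P))) =
      (\<Sum>k\<in>support P. if k = m then coefficient m P else 0)"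
    by (rule sum.cong) (auto simp: coefficient_simps lookup_single when_def)
  also have "\<dots> = coefficient m P" by (simp add: sum.delta) (simp add: support_def)
  finally show "coefficient m P = coefficient m (\<Sum>k\<in>support P. tensor (single k 1) (coefficient k P))"
    by (simp add: coefficient_sum)
qed

section \<open>The standardization of a vector\<close>

definition vrank_less :: "nat list \<Rightarrow> nat \<Rightarrow> nat \<Rightarrow> bool" where
  "vrank_less v i j \<longleftrightarrow> entry v i > entry v j \<or> entry v i = entry v j \<and> i < j"

lemma sigma_eq_rank:
  assumes "i \<in> {1..length v}"
  shows "sigma v i = Suc (card {j \<in> {1..length v}. vrank_less v j i})"
proof -
  have "{j \<in> {1..length v}. entry v j > entry v i \<or> entry v j = entry v i \<and> j \<le> i} =
      insert i {j \<in> {1..length v}. vrank_less v j i}"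
    using assms unfolding vrank_less_def by (rule_tac set_eqI) (auto simp: le_less)
  then show ?thesis using assms by (simp add: sigma_def) (simp add: vrank_less_def)
qed

lemma sigma_permutes: "sigma v permutes {1..length v}"
proof (rule bij_imp_permutes)
  have "bij_betw (\<lambda>i. card {j \<in> {1..length v}. vrank_less v j i}) {1..length v} {..<card {1..length v}}"
    by (rule bij_betw_rank) (auto simp: vrank_less_def)
  moreover have "bij_betw Suc {..<card {1..length v}} {1..length v}"
    by (rule bij_betw_byWitness[of _ "\<lambda>i. i - 1"]) auto
  ultimately have "bij_betw (Suc \<circ> (\<lambda>i. card {j \<in> {1..length v}. vrank_less v j i})) {1..length v}
      {1..length v}"
    by (rule bij_betw_trans)
  then show "bij_betw (sigma v) {1..length v} {1..length v}"
    by (rule iffD1[OF bij_betw_cong, rotated]) (simp add: sigma_eq_rank)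
qed (auto simp: sigma_def)

lemma sigma_less_iff:
  assumes "i \<in> {1..length v}" "j \<in> {1..length v}"
  shows "sigma v i < sigma v j \<longleftrightarrow> vrank_less v i j"
proof -
  have "card {k \<in> {1..length v}. vrank_less v k i} < card {k \<in> {1..length v}. vrank_less v k j} \<longleftrightarrow>
      vrank_less v i j"
    by (rule rank_less_iff) (use assms in \<open>auto simp: vrank_less_def\<close>)
  then show ?thesis using assms by (simp add: sigma_eq_rank)
qed

text \<open>A permutation with this monotonicity is the rank function of \<open>vrank_less\<close>.
  It identifies \<open>sigma\<close> after a move of the graph without recounting.\<close>

lemma sigma_unique:
  assumes \<omega>: "\<omega> permutes {1..length v}"
    and less: "\<And>i j. i \<in> {1..length v} \<Longrightarrow> j \<in> {1..length v} \<Longrightarrow> \<omega> i < \<omega> j \<longleftrightarrow> vrank_less v i j"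
  shows "sigma v = \<omega>"
proof
  fix i
  show "sigma v i = \<omega> i"
  proof (cases "i \<in> {1..length v}")
    case True
    have inv: "k \<in> \<omega> ` {1..length v}" if "k \<in> {1..length v}" for k
      using permutes_image[OF \<omega>] that by simp
    have "\<omega> ` {j \<in> {1..length v}. vrank_less v j i} = {1..<\<omega> i}"
    proof (intro equalityI subsetI)
      fix k assume "k \<in> \<omega> ` {j \<in> {1..length v}. vrank_less v j i}"
      then obtain j where j: "k = \<omega> j" "j \<in> {1..length v}" "vrank_less v j i" by auto
      then show "k \<in> {1..<\<omega> i}" using less[OF j(2) True] permutes_in_image[OF \<omega>, of j] by simp
    next
      fix k assume k: "k \<in> {1..<\<omega> i}"
      then have "k \<in> {1..length v}" using permutes_in_image[OF \<omega>, of i] True by simp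
      then obtain j where "k = \<omega> j" "j \<in> {1..length v}" using inv by blast
      then show "k \<in> \<omega> ` {j \<in> {1..length v}. vrank_less v j i}" using k less[OF _ True] by auto
    qed
    moreover have "inj_on \<omega> {j \<in> {1..length v}. vrank_less v j i}"
      using permutes_inj[OF \<omega>] inj_on_subset by blast
    ultimately have "card {j \<in> {1..length v}. vrank_less v j i} = \<omega> i - 1"
      using card_image[of \<omega> "{j \<in> {1..length v}. vrank_less v j i}"] by simp
    moreover have "1 \<le> \<omega> i" using permutes_in_image[OF \<omega>, of i] True by simp
    ultimately show ?thesis using sigma_eq_rank[OF True] by simp
  next
    case False
    then show ?thesis using permutes_not_in[OF \<omega> False] by (simp only: sigma_def if_False)
  qed
qed

text \<open>No position can come between i and i + 1 in the order, so their labels are consecutive;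
  hence s_i at a tie becomes a simple transposition of tableau entries.\<close>

lemma sigma_Suc:
  assumes "1 \<le> i" "i < length v" "entry v i = entry v (Suc i)"
  shows "sigma v (Suc i) = Suc (sigma v i)"
proof -
  have "{j \<in> {1..length v}. vrank_less v j (Suc i)} = insert i {j \<in> {1..length v}. vrank_less v j i}"
    using assms unfolding vrank_less_def by (rule_tac set_eqI) (auto simp: less_Suc_eq)
  moreover have "i \<notin> {j \<in> {1..length v}. vrank_less v j i}" by (simp add: vrank_less_def)
  ultimately show ?thesis using assms by (simp add: sigma_eq_rank)
qed

lemma length_vswap [simp]: "length (vswap i v) = length v"
  by (simp add: vswap_def)

lemma entry_vswap:
  assumes "1 \<le> i" "i < length v" "j \<in> {1..length v}"
  shows "entry (vswap i v) j = entry v (transpose i (Suc i) j)"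
  using assms by (auto simp: vswap_def entry_def transpose_def nth_list_update)

lemma sigma_vswap:
  assumes "1 \<le> i" "i < length v" "entry v i \<noteq> entry v (Suc i)"
  shows "sigma (vswap i v) = sigma v \<circ> transpose i (Suc i)"
proof -
  let ?s = "transpose i (Suc i)"
  have s: "?s permutes {1..length v}" using assms by (intro permutes_swap_id) auto
  show ?thesis
  proof (rule sigma_unique)
    show "sigma v \<circ> ?s permutes {1..length (vswap i v)}"
      using permutes_compose[OF s sigma_permutes] by simp
    fix a b assume ab: "a \<in> {1..length (vswap i v)}" "b \<in> {1..length (vswap i v)}"
    then have "?s a \<in> {1..length v}" "?s b \<in> {1..length v}" using permutes_in_image[OF s] by auto
    then have "(sigma v \<circ> ?s) a < (sigma v \<circ> ?s) b \<longleftrightarrow> vrank_less v (?s a) (?s b)"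
      by (simp add: sigma_less_iff)
    also have "\<dots> \<longleftrightarrow> vrank_less (vswap i v) a b"
    proof -
      \<comment> \<open>s_i changes the relative order of positions only for the pair i, i + 1,
        whose entries differ, so ties keep their order.\<close>
      have "entry v (?s a) = entry v (?s b) \<Longrightarrow> ?s a < ?s b \<longleftrightarrow> a < b"
        using assms(3) by (auto simp: transpose_def split: if_splits)
      then show ?thesis using ab assms by (auto simp: vrank_less_def entry_vswap)
    qed
    finally show "(sigma v \<circ> ?s) a < (sigma v \<circ> ?s) b \<longleftrightarrow> vrank_less (vswap i v) a b" .
  qed
qed

lemma length_vPsi: "v \<noteq> [] \<Longrightarrow> length (vPsi v) = length v"
  by (cases v) (auto simp: vPsi_def)

lemma entry_vPsi:
  assumes "j \<in> {1..length v}"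
  shows "entry (vPsi v) j = (if j = length v then entry v 1 + 1 else entry v (Suc j))"
proof (cases v)
  case (Cons a w)
  then show ?thesis using assms by (cases j) (auto simp: entry_def vPsi_def nth_append)
qed (use assms in simp)

lemma sigma_replicate: "sigma (replicate n a) = id"
proof (rule sigma_unique)
  fix i j assume "i \<in> {1..length (replicate n a)}" "j \<in> {1..length (replicate n a)}"
  then have "i - 1 < n" "j - 1 < n" by auto
  then show "id i < id j \<longleftrightarrow> vrank_less (replicate n a) i j"
    by (auto simp: vrank_less_def entry_def)
qed (rule permutes_id)

section \<open>Triangularity of the operators\<close>

context partition_shape
begin

text \<open>Moving v[1] to the end would cost it its priority in ties, and the increment
  compensates: it stays ahead of the entries equal to v[1] and still comes after those equal to v[1]
  + 1.\<close>

lemma sigma_vPsi: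
  assumes "length v = N"
  shows "sigma (vPsi v) = sigma v \<circ> rotation"
proof (rule sigma_unique)
  have ne: "v \<noteq> []" using assms N_pos by auto
  have len: "length (vPsi v) = N" using length_vPsi[OF ne] assms by simp
  have \<sigma>: "sigma v permutes {1..N}" using sigma_permutes[of v] assms by simp
  show "sigma v \<circ> rotation permutes {1..length (vPsi v)}"
    using permutes_compose[OF rotation_permutes \<sigma>] len by simp
  fix a b assume "a \<in> {1..length (vPsi v)}" "b \<in> {1..length (vPsi v)}"
  then have ab: "a \<in> {1..N}" "b \<in> {1..N}" using len by auto
  then have r: "rotation a \<in> {1..N}" "rotation b \<in> {1..N}"
      using permutes_in_image[OF rotation_permutes] by auto
  have "(sigma v \<circ> rotation) a < (sigma v \<circ> rotation) b \<longleftrightarrow> vrank_less v (rotation a) (rotation b)"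
    using r assms by (simp add: sigma_less_iff)
  also have "\<dots> \<longleftrightarrow> vrank_less (vPsi v) a b"
    using ab assms unfolding vrank_less_def rotation_eq[OF ab(1)] rotation_eq[OF ab(2)]
    by (auto simp: entry_vPsi)
  finally show "(sigma v \<circ> rotation) a < (sigma v \<circ> rotation) b \<longleftrightarrow> vrank_less (vPsi v) a b" .
qed

definition lower_terms :: "(nat \<Rightarrow>\<^sub>0 nat) \<Rightarrow> mpol set" where
  "lower_terms m = {r. \<forall>m' \<in> keys r. vlhd (exponent_list N m') (exponent_list N m)}"

lemma lower_terms_0: "0 \<in> lower_terms m"
  by (simp add: lower_terms_def)

lemma lower_terms_add: "r \<in> lower_terms m \<Longrightarrow> s \<in> lower_terms m \<Longrightarrow> r + s \<in> lower_terms m"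
  using Poly_Mapping.keys_add[of r s] by (auto simp: lower_terms_def)

lemma lower_terms_uminus: "r \<in> lower_terms m \<Longrightarrow> - r \<in> lower_terms m"
  by (simp add: lower_terms_def)

lemma lower_terms_sum: "(\<And>x. x \<in> A \<Longrightarrow> f x \<in> lower_terms m) \<Longrightarrow> sum f A \<in> lower_terms m"
  by (induction A rule: infinite_finite_induct) (auto intro: lower_terms_0 lower_terms_add)

lemma lower_terms_single:
  "vlhd (exponent_list N m') (exponent_list N m) \<Longrightarrow> single m' c \<in> lower_terms m"
  by (simp add: lower_terms_def)

text \<open>Let a, b be the exponents of x_i, x_j. If a > b, the string starts at x^m and continues
  below it. If a = b, only the exchange survives. If a < b, the string is negative and contains the
  exchanged monomial, which lies above x^m for i < j and is then cancelled by the exchange. So x^m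
  appears exactly when i has a smaller label than j.\<close>

lemma xi_polynomial_part:
  assumes ij: "i \<in> {1..N}" "j \<in> {1..N}" "i \<noteq> j"
  shows "\<exists>r \<in> lower_terms m. weighted_diff i j (single m 1) +
      (if i < j then pol_act (transpose i j) (single m 1) else 0) =
      (if lookup m j < lookup m i \<or> lookup m j = lookup m i \<and> i < j
       then single m 1 else 0) + r"
proof -
  let ?a = "lookup m i" and ?b = "lookup m j"
  let ?x = "single m 1 :: mpol" and ?s = "transpose i j"
  let ?y = "single (with_exponents i j m ?b ?a) 1 :: mpol"
  have sx: "pol_act ?s ?x = ?y" by (simp add: pol_act_single map_key_transpose_eq[OF ij(3)])
  consider "?b < ?a" | "?b = ?a" | "?a < ?b" by linarith
  then show ?thesis
  proof cases
    case 1
    then obtain n where n: "?a = ?b + Suc n" using less_iff_Suc_add by auto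
    define r where "r = (\<Sum>k\<in>{1..n}. single (with_exponents i j m (?a - k) (?b + k)) 1 :: mpol)"
    have "r \<in> lower_terms m"
      unfolding r_def
      by (intro lower_terms_sum lower_terms_single vlhd_exponent_squeeze) (use ij n in auto)
    moreover have "i < j \<Longrightarrow> ?y \<in> lower_terms m"
      by (intro lower_terms_single vlhd_exponent_swap) (use ij 1 in auto)
    ultimately have "r + (if i < j then ?y else 0) \<in> lower_terms m"
      by (auto intro: lower_terms_add)
    then show ?thesis
      using 1 unfolding weighted_diff_single_greater[OF ij(3) n] r_def[symmetric] sx
      by (intro bexI[of _ "r + (if i < j then ?y else 0)"]) auto
  next
    case 2
    then have "with_exponents i j m ?b ?a = m" using with_exponents_self[of i j m] by simp
    then show ?thesis
      using 2 lower_terms_0 weighted_diff_single_equal[OF ij(3), of m] sx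
      by (intro bexI[of _ 0]) auto
  next
    case 3
    then obtain n where n: "?b = ?a + Suc n" using less_iff_Suc_add by auto
    let ?m = "with_exponents i j m ?b ?a"
    define r where "r = (\<Sum>k\<in>{1..n}. single (with_exponents i j ?m (?b - k) (?a + k)) 1 :: mpol)"
    have w: "weighted_diff i j ?y = ?y + r"
      using weighted_diff_single_greater[OF ij(3), of ?m n 1] n ij(3)
      by (simp add: r_def lookup_with_exponents)
    have "weighted_diff i j ?x = - (?y + r)"
      using weighted_diff_transpose[OF ij(3), of ?x] w sx by simp
    moreover have A: "r \<in> lower_terms m"
      unfolding r_def
    proof (intro lower_terms_sum lower_terms_single)
      fix k assume k: "k \<in> {1..n}"
      \<comment> \<open>Seen from m the string runs backwards: step k from the exchanged monomial is
        step n + 1 - k from m.\<close>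
      then have "with_exponents i j ?m (?b - k) (?a + k) =
          with_exponents j i m (?b - (Suc n - k)) (?a + (Suc n - k))"
        using n ij(3) by (intro poly_mapping_eqI) (auto simp: lookup_with_exponents)
      then show "vlhd (exponent_list N (with_exponents i j ?m (?b - k) (?a + k))) (exponent_list N m)"
        using vlhd_exponent_squeeze[of j N i "Suc n - k" m] ij k n by auto
    qed
    have B: "?y \<in> lower_terms m" if "\<not> i < j"
      using vlhd_exponent_swap[of j N i m] ij 3 with_exponents_commute[OF ij(3)] that
      by (intro lower_terms_single) auto
    have "- r + (if i < j then 0 else - ?y) \<in> lower_terms m"
      by (intro lower_terms_add lower_terms_uminus A, cases "i < j")
        (use B in \<open>simp_all add: lower_terms_0 lower_terms_uminus\<close>)
    ultimately show ?thesis
      using 3 sx by (intro bexI[of _ "- r + (if i < j then 0 else - ?y)"]) auto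
  qed
qed

text \<open>What \<open>xi N i\<close> does to the coefficient at m modulo lower monomials; the
  comparison of labels is the condition found in \<open>xi_polynomial_part\<close>.\<close>

definition diagonal_part :: "(nat \<Rightarrow>\<^sub>0 nat) \<Rightarrow> nat \<Rightarrow> tabvec \<Rightarrow> tabvec" where
  "diagonal_part m i t = vscale (alpha * of_nat (lookup m i)) t +
    (\<Sum>j\<in>{j \<in> {1..N}. sigma (exponent_list N m) i < sigma (exponent_list N m) j}. vec_act N
        (transpose i j) t)"

lemma xi_monomial:
  assumes i: "i \<in> {1..N}"
  shows "coefficient m (xi N i (tensor (single m 1) t)) = diagonal_part m i t"
    and "m' \<noteq> m \<Longrightarrow> coefficient m' (xi N i (tensor (single m 1) t)) \<noteq> 0 \<Longrightarrow>
      vlhd (exponent_list N m') (exponent_list N m)"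
proof -
  let ?x = "single m 1 :: mpol"
  let ?T = "\<lambda>j. vec_act N (transpose i j) t"
  let ?L = "\<lambda>j. lookup m j < lookup m i \<or> lookup m j = lookup m i \<and> i < j"
  define c where "c j = weighted_diff i j ?x + (if i < j then pol_act (transpose i j) ?x else 0)" for j
  have "\<forall>j\<in>{1..N} - {i}. \<exists>r. r \<in> lower_terms m \<and> c j = (if ?L j then ?x else 0) + r"
    using xi_polynomial_part[OF i] unfolding c_def by blast
  then obtain r where r: "\<And>j. j \<in> {1..N} - {i} \<Longrightarrow> r j \<in> lower_terms m"
    "\<And>j. j \<in> {1..N} - {i} \<Longrightarrow> c j = (if ?L j then ?x else 0) + r j"
    using bchoice[of "{1..N} - {i}" "\<lambda>j r. r \<in> lower_terms m \<and> c j = (if ?L j then ?x else 0) + r"]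
        by blast
  have "xi N i (tensor ?x t) = mscale alpha (tensor (euler i ?x) t) +
      (\<Sum>j\<in>{1..N} - {i}. tensor (weighted_diff i j ?x) (?T j)) +
          (\<Sum>j\<in>{i<..N}. tensor (pol_act (transpose i j) ?x) (?T j))"
    using i by (simp add: xi_eq equivariant_part_tensor diag_act_tensor)
  also have "(\<Sum>j\<in>{i<..N}. tensor (pol_act (transpose i j) ?x) (?T j)) =
      (\<Sum>j\<in>{1..N} - {i}. if i < j then tensor (pol_act (transpose i j) ?x) (?T j) else 0)"
    by (rule sum.mono_neutral_cong_left) (use i in auto)
  also have "mscale alpha (tensor (euler i ?x) t) +
      (\<Sum>j\<in>{1..N} - {i}. tensor (weighted_diff i j ?x) (?T j)) + \<dots> =
      mscale alpha (tensor (euler i ?x) t) + (\<Sum>j\<in>{1..N} - {i}. tensor (c j) (?T j))"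
    unfolding add.assoc sum.distrib[symmetric]
    by (intro arg_cong2[where f = "(+)"] refl sum.cong) (auto simp: c_def tensor_simps)
  finally have X: "xi N i (tensor ?x t) = mscale alpha (tensor (euler i ?x) t) +
      (\<Sum>j\<in>{1..N} - {i}. tensor (c j) (?T j))" .
  have co: "coefficient k (xi N i (tensor ?x t)) =
      vscale (alpha * lookup (euler i ?x) k) t +
      (\<Sum>j\<in>{1..N} - {i}. vscale (lookup (c j) k) (?T j))" for k
    unfolding X by (simp add: coefficient_simps coefficient_sum)
  have "lookup (r j) m = 0" if "j \<in> {1..N} - {i}" for j
  proof -
    have "m \<notin> keys (r j)"
      using r(1)[OF that] vlhd_irrefl unfolding lower_terms_def by blast
    then show ?thesis by (simp add: in_keys_iff)
  qed
  then have "lookup (c j) m = (if ?L j then 1 else 0)" if "j \<in> {1..N} - {i}" for j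
    using r(2)[OF that] that by (simp add: lookup_add)
  then have "(\<Sum>j\<in>{1..N} - {i}. vscale (lookup (c j) m) (?T j)) =
      (\<Sum>j\<in>{1..N} - {i}. if ?L j then ?T j else 0)"
    by (intro sum.cong) auto
  also have "\<dots> = (\<Sum>j\<in>{j \<in> {1..N} - {i}. ?L j}. ?T j)"
    by (rule sum.inter_filter[symmetric]) simp
  also have "{j \<in> {1..N} - {i}. ?L j} = {j \<in> {1..N}. sigma (exponent_list N m) i < sigma
      (exponent_list N m) j}"
    using i by (intro set_eqI) (auto simp: sigma_less_iff vrank_less_def entry_exponent_list)
  finally show "coefficient m (xi N i (tensor ?x t)) = diagonal_part m i t"
    unfolding co diagonal_part_def by (simp add: euler_single)
  assume m': "m' \<noteq> m" "coefficient m' (xi N i (tensor ?x t)) \<noteq> 0"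
  have "lookup (euler i ?x) m' = 0" using m' by (simp add: euler_single lookup_single)
  then have "(\<Sum>j\<in>{1..N} - {i}. vscale (lookup (c j) m') (?T j)) \<noteq> 0"
    using m'(2) unfolding co by simp
  then obtain j where j: "j \<in> {1..N} - {i}" "vscale (lookup (c j) m') (?T j) \<noteq> 0"
    using sum.not_neutral_contains_not_neutral by blast
  then have "lookup (c j) m' \<noteq> 0" by auto
  then have "m' \<in> keys (r j)"
    using r(2)[OF j(1)] m'(1) by (auto simp: lookup_add lookup_single in_keys_iff split: if_splits)
  then show "vlhd (exponent_list N m') (exponent_list N m)"
      using r(1)[OF j(1)] by (auto simp: lower_terms_def)
qed

lemma vlinear_diagonal_part: "vlinear (diagonal_part m i)"
  unfolding vlinear_def diagonal_part_def
  by (simp add: vlinear_add[OF vlinear_vec_act] vlinear_scale[OF vlinear_vec_act] vscale_add vscale_sum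
      sum.distrib mult.commute add.assoc add.left_commute)

lemma sigma_exponent_permutes: "sigma (exponent_list N m) permutes {1..N}"
  using sigma_permutes[of "exponent_list N m"] by simp

text \<open>Conjugating by \<sigma> turns the transpositions (i j) with \<sigma> i < \<sigma> j into
  those of \<sigma> i with all larger k, that is, into the Jucys-Murphy element of \<sigma>
  i.\<close>

lemma diagonal_part_standard:
  fixes m :: "nat \<Rightarrow>\<^sub>0 nat"
  assumes "\<tau> \<in> RST lam" "i \<in> {1..N}"
  defines "\<sigma> \<equiv> sigma (exponent_list N m)"
  shows "diagonal_part m i (vec_act N \<sigma> (tv \<tau>)) =
    vscale (alpha * of_nat (lookup m i) + of_int (CT \<tau> (\<sigma> i))) (vec_act N \<sigma> (tv \<tau>))"
proof -
  have \<sigma>: "\<sigma> permutes {1..N}" unfolding \<sigma>_def by (rule sigma_exponent_permutes)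
  have t: "tv \<tau> \<in> V_space" using assms V_space_tv by blast
  have \<sigma>i: "\<sigma> i \<in> {1..N}" using permutes_in_image[OF \<sigma>] assms by blast
  have img: "\<sigma> ` {j \<in> {1..N}. \<sigma> i < \<sigma> j} = {\<sigma> i<..N}"
  proof (intro equalityI subsetI)
    fix k assume "k \<in> \<sigma> ` {j \<in> {1..N}. \<sigma> i < \<sigma> j}"
    then obtain j where j: "k = \<sigma> j" "j \<in> {1..N}" "\<sigma> i < \<sigma> j" by auto
    then show "k \<in> {\<sigma> i<..N}" using permutes_in_image[OF \<sigma>, of j] by auto
  next
    fix k assume k: "k \<in> {\<sigma> i<..N}"
    then have "k \<in> \<sigma> ` {1..N}" using permutes_image[OF \<sigma>] by simp
    then show "k \<in> \<sigma> ` {j \<in> {1..N}. \<sigma> i < \<sigma> j}" using k by auto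
  qed
  have "(\<Sum>j\<in>{j \<in> {1..N}. \<sigma> i < \<sigma> j}. vec_act N (transpose i j) (vec_act N \<sigma> (tv \<tau>))) =
      (\<Sum>j\<in>{j \<in> {1..N}. \<sigma> i < \<sigma> j}. vec_act N \<sigma> (vec_act N (transpose (\<sigma> i) (\<sigma> j)) (tv \<tau>)))"
  proof (rule sum.cong[OF refl])
    fix j assume "j \<in> {j \<in> {1..N}. \<sigma> i < \<sigma> j}"
    then have j: "j \<in> {1..N}" by simp
    then have "\<sigma> j \<in> {1..N}" using permutes_in_image[OF \<sigma>] by blast
    then show "vec_act N (transpose i j) (vec_act N \<sigma> (tv \<tau>)) =
        vec_act N \<sigma> (vec_act N (transpose (\<sigma> i) (\<sigma> j)) (tv \<tau>))"
      using t j \<sigma> \<sigma>i assms(2)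
      by (simp add: vec_act_compose(1)[symmetric] transpose_permutes transpose_permutes_conj[OF \<sigma>]
          del: comp_apply)
  qed
  also have "\<dots> = vec_act N \<sigma> (\<Sum>j\<in>{j \<in> {1..N}. \<sigma> i < \<sigma> j}. vec_act N (transpose (\<sigma> i) (\<sigma> j)) (tv \<tau>))"
    by (rule vlinear_sum[OF vlinear_vec_act, symmetric])
  also have "(\<Sum>j\<in>{j \<in> {1..N}. \<sigma> i < \<sigma> j}. vec_act N (transpose (\<sigma> i) (\<sigma> j)) (tv \<tau>)) =
      (\<Sum>k\<in>{\<sigma> i<..N}. vec_act N (transpose (\<sigma> i) k) (tv \<tau>))"
    unfolding img[symmetric]
    by (rule sum.reindex_cong[OF inj_on_subset[OF permutes_inj[OF \<sigma>] subset_UNIV] refl refl, symmetric])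
  also have "\<dots> = vscale (of_int (CT \<tau> (\<sigma> i))) (tv \<tau>)"
    using \<sigma>i assms by (intro jucys_murphy) auto
  finally show ?thesis
    unfolding diagonal_part_def \<sigma>_def[symmetric] by (simp add: vlinear_scale[OF vlinear_vec_act]
        vscale_add)
qed

lemma vec_act_inverse:
  assumes "\<omega> permutes {1..N}" "t \<in> V_space"
  shows "vec_act N \<omega> (vec_act N (inv \<omega>) t) = t" "vec_act N (inv \<omega>) (vec_act N \<omega> t) = t"
  using assms vec_act_compose(1)[OF permutes_inv[OF assms(1)] assms(1,2)]
    vec_act_compose(1)[OF assms(1) permutes_inv[OF assms(1)] assms(2)]
  by (simp_all add: permutes_inv_o vec_act_id)

lemma V_space_keys: "t \<in> V_space \<Longrightarrow> \<tau> \<in> keys t \<Longrightarrow> \<tau> \<in> RST lam"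
  by (auto simp: V_space_def)

text \<open>The vectors \<tau> \<sigma> diagonalize \<open>diagonal_part m i\<close>, with
  eigenvalues \<alpha> m[i] plus an integer. Any tableau occurring in t \<sigma>^(-1) allows the
  comparison of eigenvalues, and their \<alpha>-parts must agree.\<close>

lemma diagonal_part_eigenvalue:
  assumes t: "t \<in> V_space" "t \<noteq> 0"
    and eig: "\<And>i. i \<in> {1..N} \<Longrightarrow> diagonal_part m i t = vscale (alpha * of_nat (a i) + of_int (c i)) t"
    and i: "i \<in> {1..N}"
  shows "lookup m i = a i"
proof -
  define \<sigma> where "\<sigma> = sigma (exponent_list N m)"
  have \<sigma>: "\<sigma> permutes {1..N}" unfolding \<sigma>_def by (rule sigma_exponent_permutes)
  define s where "s = vec_act N (inv \<sigma>) t"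
  have sV: "s \<in> V_space" unfolding s_def by (rule vec_act_V_space[OF permutes_inv[OF \<sigma>]
      permutes_inv[OF \<sigma>] t(1)])
  have ts: "t = vec_act N \<sigma> s" unfolding s_def using vec_act_inverse[OF \<sigma> t(1)] by simp
  have "s \<noteq> 0" using ts t(2) vlinear_0[OF vlinear_vec_act] by auto
  then obtain \<tau> where \<tau>: "\<tau> \<in> keys s" using Poly_Mapping.keys_eq_empty by blast
  have exp: "s = (\<Sum>\<tau>\<in>keys s. vscale (lookup s \<tau>) (tv \<tau>))"
    by (rule tv_expansion) auto
  let ?e = "\<lambda>\<tau>. alpha * of_nat (lookup m i) + of_int (CT \<tau> (\<sigma> i))"
  let ?s' = "\<Sum>\<tau>\<in>keys s. vscale (?e \<tau> * lookup s \<tau>) (tv \<tau>)"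
  have "diagonal_part m i t = (\<Sum>\<tau>\<in>keys s. vscale (lookup s \<tau>) (diagonal_part m i (vec_act N \<sigma> (tv \<tau>))))"
    unfolding ts by (subst exp) (simp add: vlinear_sum[OF vlinear_vec_act] vlinear_scale[OF
        vlinear_vec_act]
        vlinear_sum[OF vlinear_diagonal_part] vlinear_scale[OF vlinear_diagonal_part])
  also have "\<dots> = vec_act N \<sigma> ?s'"
    unfolding vlinear_sum[OF vlinear_vec_act] vlinear_scale[OF vlinear_vec_act]
  proof (rule sum.cong[OF refl])
    fix \<rho> assume "\<rho> \<in> keys s"
    then show "vscale (lookup s \<rho>) (diagonal_part m i (vec_act N \<sigma> (tv \<rho>))) =
        vscale (?e \<rho> * lookup s \<rho>) (vec_act N \<sigma> (tv \<rho>))"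
      using diagonal_part_standard[OF V_space_keys[OF sV] i, of \<rho> m] by (simp add: \<sigma>_def mult.commute)
  qed
  finally have E: "vec_act N \<sigma> ?s' = vec_act N \<sigma> (vscale (alpha * of_nat (a i) + of_int (c i)) s)"
    using eig[OF i] ts vlinear_scale[OF vlinear_vec_act] by simp
  have s'V: "?s' \<in> V_space"
    using V_space_keys[OF sV] by (auto intro!: V_space_sum V_space_scale V_space_tv)
  have "?s' = vec_act N (inv \<sigma>) (vec_act N \<sigma> ?s')"
    by (rule vec_act_inverse(2)[OF \<sigma> s'V, symmetric])
  also have "\<dots> = vec_act N (inv \<sigma>) (vec_act N \<sigma> (vscale (alpha * of_nat (a i) + of_int (c i)) s))"
    by (rule arg_cong[OF E])
  also have "\<dots> = vscale (alpha * of_nat (a i) + of_int (c i)) s"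
    by (rule vec_act_inverse(2)[OF \<sigma> V_space_scale[OF sV]])
  finally have "lookup ?s' \<tau> = (alpha * of_nat (a i) + of_int (c i)) * lookup s \<tau>"
    by (simp add: lookup_vscale)
  moreover have "lookup ?s' \<tau> = ?e \<tau> * lookup s \<tau>"
  proof -
    have "lookup ?s' \<tau> = (\<Sum>\<rho>\<in>keys s. if \<rho> = \<tau> then ?e \<tau> * lookup s \<tau> else 0)"
      unfolding lookup_sum lookup_vscale by (rule sum.cong) (auto simp: tv_def lookup_single when_def)
    then show ?thesis using \<tau> by (simp add: sum.delta)
  qed
  ultimately have "?e \<tau> = alpha * of_nat (a i) + of_int (c i)" using \<tau> by (simp add: in_keys_iff)
  then show ?thesis by (simp add: alpha_linear_eq_iff)
qed

lemma M_space_iff: "P \<in> M_space lam \<longleftrightarrow> P \<in> W_space \<and> (\<forall>m\<in>support P. keys m \<subseteq> {1..N})"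
proof -
  have "(\<forall>\<tau>. \<forall>m\<in>keys (lookup P \<tau>). Q m) \<longleftrightarrow> (\<forall>m\<in>support P. Q m)" for Q
    unfolding support_eq by (metis (no_types, lifting) UN_iff in_keys_iff keys_zero empty_iff)
  then show ?thesis by (simp add: M_space_def W_space_def)
qed

lemma coefficient_V_space: "P \<in> W_space \<Longrightarrow> coefficient m P \<in> V_space"
  unfolding W_space_def V_space_def mem_Collect_eq subset_iff in_keys_iff lookup_coefficient
  by (metis lookup_zero)

text \<open>The \<open>\<alpha>\<close>-part of the spectrum determines every maximal exponent of an eigenfunction, so there is
  only one such exponent and it dominates all others.\<close>

lemma eigenfunction_maximal_exponent:
  assumes Q: "Q \<in> M_space lam"
    and eig: "\<And>i. i \<in> {1..N} \<Longrightarrow> xi N i Q = mscale (alpha * of_nat (entry v i) + of_int (c i)) Q"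
    and v: "length v = N"
    and u: "u \<in> support Q" "\<And>m. m \<in> support Q \<Longrightarrow> \<not> vlhd (exponent_list N u) (exponent_list N m)"
  shows "u = list_exponent v"
proof -
  have QW: "Q \<in> W_space" using Q M_space_iff by blast
  have D: "diagonal_part u i (coefficient u Q) = vscale (alpha * of_nat (entry v i) +
      of_int (c i)) (coefficient u Q)"
    if i: "i \<in> {1..N}" for i
  proof -
    have "coefficient u (xi N i Q) = (\<Sum>m\<in>support Q. coefficient u (xi N i (tensor (single m 1)
        (coefficient m Q))))"
      by (subst coefficient_expansion[of Q]) (simp add: mlinear_sum[OF mlinear_xi] coefficient_sum)
    \<comment> \<open>Another m could contribute at u only if u lay below m, which maximality
      excludes.\<close>
    also have "\<dots> = (\<Sum>m\<in>support Q. if m = u then diagonal_part u i (coefficient u Q) else 0)"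
    proof (rule sum.cong[OF refl])
      fix m assume "m \<in> support Q"
      then show "coefficient u (xi N i (tensor (single m 1) (coefficient m Q))) =
          (if m = u then diagonal_part u i (coefficient u Q) else 0)"
        using xi_monomial(1)[OF i] xi_monomial(2)[OF i, of u m] u(2) by auto
    qed
    also have "\<dots> = diagonal_part u i (coefficient u Q)" using u(1) by (simp add: sum.delta)
    finally show ?thesis using eig[OF i] by (simp add: coefficient_simps)
  qed
  have "lookup u i = entry v i" if "i \<in> {1..N}" for i
    using diagonal_part_eigenvalue[OF coefficient_V_space[OF QW] _ D that] u(1)
        by (simp add: support_def)
  moreover have "lookup u i = 0" if "i \<notin> {1..N}" for i
  proof -
    have "keys u \<subseteq> {1..N}" using Q u(1) M_space_iff by blast
    then show ?thesis using that by (meson in_keys_iff subsetD)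
  qed
  ultimately show ?thesis using v by (intro poly_mapping_eqI) (simp add: lookup_list_exponent)
qed

text \<open>Above every exponent of the finite support there is a maximal one, and
  \<open>eigenfunction_maximal_exponent\<close> identifies it with v.\<close>

lemma eigenfunction_support:
  assumes Q: "Q \<in> M_space lam"
    and eig: "\<And>i. i \<in> {1..N} \<Longrightarrow> xi N i Q = mscale (alpha * of_nat (entry v i) + of_int (c i)) Q"
    and v: "length v = N" and m: "m \<in> support Q"
  shows "list_exponent v \<in> support Q \<and> (m = list_exponent v \<or> vlhd (exponent_list N m) v)"
proof -
  obtain u where u: "u \<in> support Q" "u = m \<or> vlhd (exponent_list N m) (exponent_list N u)"
    "\<And>k. k \<in> support Q \<Longrightarrow> \<not> vlhd (exponent_list N u) (exponent_list N k)"
    by (rule exists_maximal_above[OF finite_support m, of "\<lambda>a b. vlhd (exponent_list N a)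
        (exponent_list N b)"])
      (auto simp: vlhd_irrefl intro: vlhd_trans[where n = N])
  have "u = list_exponent v" using eigenfunction_maximal_exponent[OF Q eig v u(1,3)] by blast
  then show ?thesis using u exponent_list_list_exponent[OF v] by auto
qed

lemma eigenfunction_eq_0:
  assumes "Q \<in> M_space lam"
    "\<And>i. i \<in> {1..N} \<Longrightarrow> xi N i Q = mscale (alpha * of_nat (entry v i) + of_int (c i)) Q"
    "length v = N" "coefficient (list_exponent v) Q = 0"
  shows "Q = 0"
proof (rule coefficient_eqI)
  fix m
  have "m \<notin> support Q" using eigenfunction_support[OF assms(1,2,3)] assms(4) by (auto simp: support_def)
  then show "coefficient m Q = coefficient m 0" by (simp add: support_def coefficient_simps)
qed

end

section \<open>Eigenfunctions along paths\<close>

context partition_shape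
begin

lemma M_space_iff_coefficient:
  "P \<in> M_space lam \<longleftrightarrow> (\<forall>m\<in>support P. coefficient m P \<in> V_space \<and> keys m \<subseteq> {1..N})"
proof -
  have "P \<in> W_space" if "\<forall>m\<in>support P. coefficient m P \<in> V_space"
    unfolding W_space_def
  proof safe
    fix \<tau> assume "\<tau> \<in> keys P"
    then have "lookup P \<tau> \<noteq> 0" by (simp add: in_keys_iff)
    then obtain m where "m \<in> keys (lookup P \<tau>)"
      using Poly_Mapping.keys_eq_empty by blast
    then have l: "lookup (coefficient m P) \<tau> \<noteq> 0" by (simp add: lookup_coefficient in_keys_iff)
    then have "m \<in> support P" by (auto simp: support_def)
    then show "\<tau> \<in> RST lam" using that V_space_keys[of "coefficient m P" \<tau>] l by (simp add: in_keys_iff)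
  qed
  then show ?thesis using M_space_iff coefficient_V_space by blast
qed

lemma M_space_W_space: "P \<in> M_space lam \<Longrightarrow> P \<in> W_space"
  by (simp add: M_space_iff)

lemma M_space_subspace: "M.subspace (M_space lam)"
proof (rule M.subspaceI)
  fix P Q assume P: "P \<in> M_space lam" and Q: "Q \<in> M_space lam"
  show "P + Q \<in> M_space lam"
    unfolding M_space_iff_coefficient
  proof safe
    fix m assume m: "m \<in> support (P + Q)"
    show "coefficient m (P + Q) \<in> V_space"
      using P Q coefficient_V_space[OF M_space_W_space] by (simp add: coefficient_simps V_space_add)
    have "m \<in> support P \<or> m \<in> support Q" using m by (auto simp: support_def coefficient_simps)
    then show "k \<in> {1..N}" if "k \<in> keys m" for k
      using P Q that unfolding M_space_iff by blast
  qed
next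
  fix c P assume P: "P \<in> M_space lam"
  show "mscale c P \<in> M_space lam"
    unfolding M_space_iff_coefficient
  proof safe
    fix m assume m: "m \<in> support (mscale c P)"
    show "coefficient m (mscale c P) \<in> V_space"
      using P coefficient_V_space[OF M_space_W_space] by (simp add: coefficient_simps V_space_scale)
    have "m \<in> support P" using m by (auto simp: support_def coefficient_simps)
    then show "k \<in> {1..N}" if "k \<in> keys m" for k
      using P that unfolding M_space_iff by blast
  qed
qed (simp add: M_space_def)

text \<open>Permutations and multiplication by a variable both relabel monomials and act by a fixed
  map on coefficients. Injectivity of the relabelling keeps contributions from colliding.\<close>

lemma monomial_operator:
  assumes lin: "mlinear F" "vlinear G" and "inj \<phi>"
    and F: "\<And>k t. F (tensor (single k 1) t) = tensor (single (\<phi> k) 1) (G t)"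
  shows "coefficient (\<phi> k) (F P) = G (coefficient k P)" "support (F P) \<subseteq> \<phi> ` support P"
proof -
  have co: "coefficient m (F P) = (\<Sum>k\<in>support P. if \<phi> k = m then G (coefficient k P) else 0)" for m
    by (subst coefficient_expansion[of P], unfold mlinear_sum[OF lin(1)] F coefficient_sum)
      (auto intro!: sum.cong simp: coefficient_simps lookup_single when_def)
  have "coefficient (\<phi> k) (F P) = (\<Sum>k'\<in>support P. if k' = k then G (coefficient k P) else 0)"
    unfolding co using \<open>inj \<phi>\<close> by (intro sum.cong) (auto dest: injD)
  also have "\<dots> = G (coefficient k P)"
    by (simp add: sum.delta) (simp add: support_def vlinear_0[OF lin(2)])
  finally show "coefficient (\<phi> k) (F P) = G (coefficient k P)" .
  show "support (F P) \<subseteq> \<phi> ` support P"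
  proof
    fix m assume "m \<in> support (F P)"
    then have "(\<Sum>k\<in>support P. if \<phi> k = m then G (coefficient k P) else 0) \<noteq> 0"
      by (simp add: support_def co)
    then obtain k where "k \<in> support P" "(if \<phi> k = m then G (coefficient k P) else 0) \<noteq> 0"
      using sum.not_neutral_contains_not_neutral by blast
    then show "m \<in> \<phi> ` support P" by (auto split: if_splits)
  qed
qed

lemma inj_map_key:
  assumes "bij \<omega>" shows "inj (map_key \<omega> :: (nat \<Rightarrow>\<^sub>0 nat) \<Rightarrow> _)"
proof (rule injI)
  fix m m' :: "nat \<Rightarrow>\<^sub>0 nat" assume eq: "map_key \<omega> m = map_key \<omega> m'"
  show "m = m'"
  proof (rule poly_mapping_eqI)
    fix i
    obtain j where "i = \<omega> j" using assms by (metis bij_pointE)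
    then show "lookup m i = lookup m' i"
      using arg_cong[OF eq, of "\<lambda>m. lookup m j"] bij_is_inj[OF assms] by (simp add: lookup_map_key)
  qed
qed

lemma diag_act_coefficient:
  assumes "\<omega> permutes {1..N}"
  shows "coefficient (map_key \<omega> k) (diag_act N \<omega> P) = vec_act N \<omega> (coefficient k P)"
    and "support (diag_act N \<omega> P) \<subseteq> map_key \<omega> ` support P"
  by (rule monomial_operator[OF mlinear_diag_act vlinear_vec_act inj_map_key[OF permutes_bij[OF assms]]],
      simp add: diag_act_tensor pol_act_single)+

lemma pmul_var_coefficient:
  shows "coefficient (single i 1 + k) (pmul (var i) P) = coefficient k P"
    and "support (pmul (var i) P) \<subseteq> (+) (single i 1) ` support P"
  by (rule monomial_operator[OF mlinear_pmul vlinear_id], simp add: inj_def,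
      simp add: pmul_tensor var_mult_single)+

lemma diag_act_M_space:
  assumes \<omega>: "\<omega> permutes {1..N}" and P: "P \<in> M_space lam"
  shows "diag_act N \<omega> P \<in> M_space lam"
  unfolding M_space_iff_coefficient
proof
  fix m assume "m \<in> support (diag_act N \<omega> P)"
  then obtain k where k: "m = map_key \<omega> k" "k \<in> support P"
    using diag_act_coefficient(2)[OF \<omega>] by blast
  have "coefficient k P \<in> V_space" "keys k \<subseteq> {1..N}"
    using P k(2) unfolding M_space_iff_coefficient by blast+
  then show "coefficient m (diag_act N \<omega> P) \<in> V_space \<and> keys m \<subseteq> {1..N}"
    using vec_act_V_space[OF \<omega> \<omega>] permutes_in_image[OF \<omega>]
    unfolding k(1) diag_act_coefficient(1)[OF \<omega>] keys_map_key[OF permutes_inj[OF \<omega>]] by blast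
qed

lemma pmul_var_M_space:
  assumes P: "P \<in> M_space lam" and i: "i \<in> {1..N}"
  shows "pmul (var i) P \<in> M_space lam"
  unfolding M_space_iff_coefficient
proof
  fix m assume "m \<in> support (pmul (var i) P)"
  then obtain k where k: "m = single i 1 + k" "k \<in> support P"
    using pmul_var_coefficient(2) by blast
  have "coefficient k P \<in> V_space" "keys k \<subseteq> {1..N}"
    using P k(2) unfolding M_space_iff_coefficient by blast+
  moreover have "keys (single i 1 + k) \<subseteq> {i} \<union> keys k"
    using Poly_Mapping.keys_add[of "single i 1" k] by (simp split: if_splits)
  ultimately show "coefficient m (pmul (var i) P) \<in> V_space \<and> keys m \<subseteq> {1..N}"
    using i unfolding k(1) pmul_var_coefficient(1) by blast
qed

lemma list_exponent_vswap:
  assumes "1 \<le> i" "i < N" "length v = N"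
  shows "list_exponent (vswap i v) = map_key (transpose i (Suc i)) (list_exponent v)"
proof (rule poly_mapping_eqI)
  fix j
  have "transpose i (Suc i) j \<in> {1..N} \<longleftrightarrow> j \<in> {1..N}"
    using permutes_in_image[OF simple_permutes] assms by blast
  then show "lookup (list_exponent (vswap i v)) j =
      lookup (map_key (transpose i (Suc i)) (list_exponent v)) j"
    using assms entry_vswap[of i v j] by (simp add: lookup_map_key lookup_list_exponent)
qed

lemma list_exponent_vPsi:
  assumes "length v = N"
  shows "list_exponent (vPsi v) = single N 1 + map_key rotation (list_exponent v)"
proof (rule poly_mapping_eqI)
  fix j
  have ne: "v \<noteq> []" using assms N_pos by auto
  show "lookup (list_exponent (vPsi v)) j =
      lookup (single N 1 + map_key rotation (list_exponent v)) j"
  proof (cases "j \<in> {1..N}")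
    case True
    then have "rotation j \<in> {1..N}" using permutes_in_image[OF rotation_permutes] by blast
    then show ?thesis
      using True assms length_vPsi[OF ne] entry_vPsi[of j v] rotation_eq[OF True]
      by (simp add: lookup_add lookup_map_key permutes_inj[OF rotation_permutes]
          lookup_list_exponent lookup_single)
  next
    case False
    then have "rotation j = j" by (rule permutes_not_in[OF rotation_permutes])
    then show ?thesis
      using False assms N_pos length_vPsi[OF ne]
      by (auto simp: lookup_add lookup_map_key permutes_inj[OF rotation_permutes]
          lookup_list_exponent lookup_single when_def)
  qed
qed

text \<open>The invariant carried along a path. The coefficient at v is prescribed exactly and not
  up to a scalar, which makes the function unique; the conditions on \<tau> and v are included
  because \<open>edge\<close> does not impose them on its source.\<close>

definition vertex_function :: "tableau \<Rightarrow> nat list \<Rightarrow> vpol \<Rightarrow> bool" where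
  "vertex_function \<tau> v P \<longleftrightarrow> \<tau> \<in> RST lam \<and> length v = N \<and> P \<in> M_space lam \<and>
     (\<forall>i\<in>{1..N}. xi N i P = mscale (zeta v \<tau> i) P) \<and>
     coefficient (list_exponent v) P = vec_act N (sigma v) (tv \<tau>)"

lemma vertex_functionD:
  assumes "vertex_function \<tau> v P"
  shows "\<tau> \<in> RST lam" "length v = N" "P \<in> M_space lam" "P \<in> W_space" "tv \<tau> \<in> V_space"
    "sigma v permutes {1..N}" "\<And>i. i \<in> {1..N} \<Longrightarrow> xi N i P = mscale (zeta v \<tau> i) P"
    "coefficient (list_exponent v) P = vec_act N (sigma v) (tv \<tau>)"
  using assms M_space_W_space V_space_tv sigma_permutes[of v] by (auto simp: vertex_function_def)

lemma vertex_function_support: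
  assumes "vertex_function \<tau> v P" "m \<in> support P"
  shows "m = list_exponent v \<or> vlhd (exponent_list N m) v"
  using eigenfunction_support[of P v "\<lambda>i. CT \<tau> (sigma v i)" m] vertex_functionD[OF assms(1)] assms(2)
  unfolding zeta_def by blast

lemma vec_act_tv_nonzero:
  assumes "\<tau> \<in> RST lam" "\<omega> permutes {1..N}"
  shows "vec_act N \<omega> (tv \<tau>) \<noteq> 0"
proof
  assume 0: "vec_act N \<omega> (tv \<tau>) = 0"
  have "tv \<tau> = vec_act N (inv \<omega>) (vec_act N \<omega> (tv \<tau>))"
    using vec_act_inverse(2)[OF assms(2) V_space_tv[OF assms(1)]] by simp
  then have "tv \<tau> = 0" unfolding 0 using vlinear_0[OF vlinear_vec_act] by simp
  then show False by (metis tv_def lookup_single_eq lookup_zero zero_neq_one)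
qed

lemma vertex_function_nonzero: "vertex_function \<tau> v P \<Longrightarrow> P \<noteq> 0"
  using vec_act_tv_nonzero[of \<tau> "sigma v"] vertex_functionD[of \<tau> v P] by (auto simp: coefficient_simps)

lemma vertex_function_unique:
  assumes P: "vertex_function \<tau> v P" and Q: "vertex_function \<tau> v Q"
  shows "P = Q"
proof -
  note p = vertex_functionD[OF P] and q = vertex_functionD[OF Q]
  have "P - Q = 0"
  proof (rule eigenfunction_eq_0[where v = v and c = "\<lambda>i. CT \<tau> (sigma v i)"])
    show "P - Q \<in> M_space lam" using M.subspace_diff[OF M_space_subspace] p(3) q(3) by blast
    show "xi N i (P - Q) = mscale (alpha * of_nat (entry v i) + of_int (CT \<tau> (sigma v i))) (P - Q)"
        if "i \<in> {1..N}" for i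
      using p(7)[OF that] q(7)[OF that]
      by (simp add: mlinear_diff[OF mlinear_xi] M.scale_right_diff_distrib zeta_def)
    show "coefficient (list_exponent v) (P - Q) = 0" using p(8) q(8) by (simp add: coefficient_simps)
  qed (use p in simp)
  then show ?thesis by simp
qed

text \<open>The Euler and divided difference parts kill constants, so only a Jucys-Murphy element
  remains, and \<open>sigma\<close> of a constant vector is the identity.\<close>

lemma vertex_function_root:
  "vertex_function (root_tableau lam) (replicate N 0) (tensor 1 (tv (root_tableau lam)))"
proof -
  let ?\<tau> = "root_tableau lam"
  have \<tau>: "?\<tau> \<in> RST lam" by (rule root_tableau_RST)
  have one: "(1 :: mpol) = single 0 1" by simp
  have le: "list_exponent (replicate N 0) = 0"
    by (rule poly_mapping_eqI) (auto simp: lookup_list_exponent entry_def)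
  have co: "coefficient m (tensor 1 (tv ?\<tau>)) = (if m = 0 then tv ?\<tau> else 0)" for m
    by (simp add: coefficient_simps lookup_one when_def)
  have M: "tensor 1 (tv ?\<tau>) \<in> M_space lam"
    unfolding M_space_iff_coefficient by (auto simp: support_def co V_space_tv[OF \<tau>] split: if_splits)
  have "xi N i (tensor 1 (tv ?\<tau>)) = mscale (zeta (replicate N 0) ?\<tau> i) (tensor 1 (tv ?\<tau>))"
      if i: "i \<in> {1..N}" for i
  proof -
    have w: "weighted_diff i j 1 = 0" if "j \<in> {1..N} - {i}" for j
      unfolding one by (rule weighted_diff_single_equal) (use that in auto)
    have a: "pol_act (transpose i j) 1 = 1" for j
      using pol_act_single[of "transpose i j" 0 1] by (simp add: map_key_zero)
    have "euler i 1 = 0" unfolding one euler_single by simp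
    then have "xi N i (tensor 1 (tv ?\<tau>)) = (\<Sum>j\<in>{i<..N}. tensor 1 (vec_act N (transpose i j) (tv ?\<tau>)))"
      using i w a by (simp add: xi_eq equivariant_part_tensor diag_act_tensor tensor_simps)
    also have "\<dots> = tensor 1 (\<Sum>j\<in>{i<..N}. vec_act N (transpose i j) (tv ?\<tau>))"
      by (simp add: tensor_sum_right)
    also have "\<dots> = mscale (of_int (CT ?\<tau> i)) (tensor 1 (tv ?\<tau>))"
      using jucys_murphy[OF \<tau>, of i] i by (simp add: tensor_simps)
    also have "of_int (CT ?\<tau> i) = zeta (replicate N 0) ?\<tau> i"
    proof -
      have "i - 1 < N" using i by auto
      then have "entry (replicate N (0::nat)) i = 0" by (simp add: entry_def)
      then show ?thesis by (simp add: zeta_def sigma_replicate)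
    qed
    finally show ?thesis .
  qed
  then show ?thesis
    unfolding vertex_function_def using \<tau> M by (simp add: le co sigma_replicate vec_act_id V_space_tv)
qed

text \<open>The monomial relabelling carries the coefficient at v to the one at
  \<open>vPsi v\<close>, acted on by the rotation, which \<open>sigma_vPsi\<close> absorbs.\<close>

lemma vertex_function_affine:
  assumes "vertex_function \<tau> v P"
  shows "vertex_function \<tau> (vPsi v) (MPsi N P)"
proof -
  note p = vertex_functionD[OF assms]
  have ne: "v \<noteq> []" using p N_pos by auto
  have len: "length (vPsi v) = N" using length_vPsi[OF ne] p by simp
  have M: "MPsi N P \<in> M_space lam"
    unfolding MPsi_def using p N_pos by (intro pmul_var_M_space diag_act_M_space rotation_permutes) auto
  have "xi N j (MPsi N P) = mscale (zeta (vPsi v) \<tau> j) (MPsi N P)" if j: "j \<in> {1..N}" for j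
  proof (cases "j = N")
    case True
    have "xi N N (MPsi N P) = mscale (zeta v \<tau> 1 + alpha) (MPsi N P)"
      using p(7)[of 1] N_pos by (simp add: xi_MPsi_last[OF p(4)] mlinear_scale[OF mlinear_MPsi]
          M.scale_left_distrib)
    also have "zeta v \<tau> 1 + alpha = zeta (vPsi v) \<tau> N"
      using entry_vPsi[of N v] rotation_eq[of N] N_pos p(2)
      by (simp add: zeta_def sigma_vPsi[OF p(2)] distrib_left)
    finally show ?thesis using True by simp
  next
    case False
    then have j': "1 \<le> j" "j < N" using j by auto
    have "xi N j (MPsi N P) = mscale (zeta v \<tau> (Suc j)) (MPsi N P)"
      using p(7)[of "Suc j"] j' by (simp add: xi_MPsi_less[OF j' p(4)] mlinear_scale[OF mlinear_MPsi])
    also have "zeta v \<tau> (Suc j) = zeta (vPsi v) \<tau> j"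
      using entry_vPsi[of j v] rotation_eq[of j] j j' p(2)
      by (simp add: zeta_def sigma_vPsi[OF p(2)])
    finally show ?thesis .
  qed
  moreover have "coefficient (list_exponent (vPsi v)) (MPsi N P) = vec_act N (sigma (vPsi v)) (tv \<tau>)"
    unfolding list_exponent_vPsi[OF p(2)] MPsi_def pmul_var_coefficient(1)
      diag_act_coefficient(1)[OF rotation_permutes] p(8) sigma_vPsi[OF p(2)]
    by (rule vec_act_compose(1)[OF p(6) rotation_permutes p(5), symmetric])
  ultimately show ?thesis unfolding vertex_function_def using p(1) len M by blast
qed

text \<open>The exchange relations make the span of P and P s_i stable under all
  \<open>xi N j\<close>. In it P s_i + c P satisfies the eigenvalue equations with z(i) and z(i+1)
  exchanged once 1 + c z(i) = c z(i+1), which dictates c.\<close>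

lemma intertwiner_eigenfunction:
  assumes i: "1 \<le> i" "i < N" and P: "P \<in> W_space"
    and eig: "\<And>j. j \<in> {1..N} \<Longrightarrow> xi N j P = mscale (z j) P"
    and ne: "z (Suc i) \<noteq> z i" and j: "j \<in> {1..N}"
  defines "Q \<equiv> diag_act N (transpose i (Suc i)) P + mscale (1 / (z (Suc i) - z i)) P"
  shows "xi N j Q = mscale (z (transpose i (Suc i) j)) Q"
proof -
  let ?s = "transpose i (Suc i)" and ?c = "1 / (z (Suc i) - z i)"
  have d: "z (Suc i) - z i \<noteq> 0" using ne by simp
  have x: "xi N j Q = xi N j (diag_act N ?s P) + mscale (?c * z j) P"
    unfolding Q_def using eig[OF j] by (simp add: mlinear_add[OF mlinear_xi] mlinear_scale[OF
        mlinear_xi])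
  consider "j = i" | "j = Suc i" | "j \<noteq> i" "j \<noteq> Suc i" by blast
  then show ?thesis
  proof cases
    case 1
    have "1 + ?c * z i = z (Suc i) * ?c" using d by (simp add: field_simps)
    then have "mscale (1 + ?c * z i) P = mscale (z (Suc i) * ?c) P" by simp
    then show ?thesis
      using 1 i eig[of "Suc i"] unfolding x xi_diag_act_left[OF i P, folded 1]
      by (simp add: Q_def mlinear_scale[OF mlinear_diag_act] M.scale_right_distrib M.scale_left_distrib
          xi_diag_act_left[OF i P])
  next
    case 2
    have "?c * z (Suc i) = 1 + z i * ?c" using d by (simp add: field_simps)
    then have "mscale (?c * z (Suc i)) P = mscale (1 + z i * ?c) P" by simp
    then show ?thesis
      using 2 i eig[of i] unfolding x
      by (simp add: Q_def mlinear_scale[OF mlinear_diag_act] M.scale_right_distrib M.scale_left_distrib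
          xi_diag_act_right[OF i P])
  next
    case 3
    then show ?thesis
      using i eig[OF j] unfolding x
      by (simp add: Q_def mlinear_scale[OF mlinear_diag_act] M.scale_right_distrib
          xi_diag_act_other[OF i j _ _ P] mult.commute)
  qed
qed

lemma intertwiner_M_space:
  assumes "1 \<le> i" "i < N" "P \<in> M_space lam"
  shows "diag_act N (transpose i (Suc i)) P + mscale c P \<in> M_space lam"
  using assms diag_act_M_space[OF simple_permutes]
  by (intro M.subspace_add[OF M_space_subspace] M.subspace_scale[OF M_space_subspace]) auto

text \<open>Since v lies below v s_i, the old function has no monomial at v s_i, and the correction
  term leaves the coefficient there untouched.\<close>

lemma vertex_function_step:
  assumes P: "vertex_function \<tau> v P" and i: "1 \<le> i" "i < N" and less: "entry v i < entry v (Suc i)"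
  shows "vertex_function \<tau> (vswap i v)
    (diag_act N (transpose i (Suc i)) P + mscale (1 / (zeta v \<tau> (Suc i) - zeta v \<tau> i)) P)"
proof -
  note p = vertex_functionD[OF P]
  let ?s = "transpose i (Suc i)" and ?w = "vswap i v"
  have ne: "zeta v \<tau> (Suc i) \<noteq> zeta v \<tau> i" using less by (simp add: zeta_def alpha_linear_eq_iff)
  have \<sigma>: "sigma ?w = sigma v \<circ> ?s" using sigma_vswap[of i v] i less p by simp
  have z: "zeta v \<tau> (?s j) = zeta ?w \<tau> j" if "j \<in> {1..N}" for j
    using that i p entry_vswap[of i v j] by (simp add: zeta_def \<sigma>)
  have "vlhd v ?w"
  proof -
    have "?w ! (i - 1) = entry v (Suc i)" "?w ! i = entry v i"
      using i p by (auto simp: vswap_def entry_def nth_list_update)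
    moreover have "?w[i - 1 := entry v i, i := entry v (Suc i)] = v"
      using i p by (intro nth_equalityI) (auto simp: vswap_def entry_def nth_list_update)
    ultimately show ?thesis using vlhd_swap[of "i - 1" i ?w] i p less by simp
  qed
  then have "\<not> vlhd ?w v" using vlhd_trans[of v ?w v N] vlhd_irrefl p(2) by auto
  moreover have "?w \<noteq> v" using \<open>vlhd v ?w\<close> vlhd_irrefl by metis
  then have "list_exponent ?w \<noteq> list_exponent v"
    using exponent_list_list_exponent[of ?w N] exponent_list_list_exponent[of v N] p(2)
        by (metis length_vswap)
  ultimately have "list_exponent ?w \<notin> support P"
    using vertex_function_support[OF P, of "list_exponent ?w"] exponent_list_list_exponent[of ?w N]
        p(2) by auto
  then have c0: "coefficient (list_exponent ?w) P = 0" by (simp add: support_def)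
  have "coefficient (list_exponent ?w) (diag_act N ?s P) = vec_act N (sigma ?w) (tv \<tau>)"
    unfolding list_exponent_vswap[OF i p(2)] diag_act_coefficient(1)[OF simple_permutes[OF i]] p(8) \<sigma>
    by (rule vec_act_compose(1)[OF p(6) simple_permutes[OF i] p(5), symmetric])
  then show ?thesis
    unfolding vertex_function_def
    using p(1,2) intertwiner_M_space[OF i p(3)] intertwiner_eigenfunction[OF i p(4,7) ne] z c0
    by (simp add: coefficient_simps)
qed

context
  fixes \<tau> v P i
  assumes P: "vertex_function \<tau> v P" and i: "1 \<le> i" "i < N" and eq: "entry v i = entry v (Suc i)"
begin

lemma level_step_index: "1 \<le> sigma v i" "sigma v i < N" "sigma v (Suc i) = Suc (sigma v i)"
proof -
  note p = vertex_functionD[OF P]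
  show *: "sigma v (Suc i) = Suc (sigma v i)" using sigma_Suc[of i v] i p eq by simp
  have "sigma v i \<in> {1..N}" "sigma v (Suc i) \<in> {1..N}"
    using permutes_in_image[OF p(6)] i by auto
  then show "1 \<le> sigma v i" "sigma v i < N" using * by auto
qed

text \<open>For equal entries the \<alpha>-parts cancel and the denominator is a content difference;
  exchanging the eigenvalues amounts to interchanging two consecutive entries of the
  tableau.\<close>

lemma level_step_zeta:
  "zeta v \<tau> (Suc i) - zeta v \<tau> i = of_int (CT \<tau> (Suc (sigma v i)) - CT \<tau> (sigma v i))"
  "zeta v \<tau> (Suc i) \<noteq> zeta v \<tau> i"
  "j \<in> {1..N} \<Longrightarrow> zeta v \<tau> (transpose i (Suc i) j) = zeta v (tab_swap (sigma v i) \<tau>) j"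
proof -
  note p = vertex_functionD[OF P]
  show e: "zeta v \<tau> (Suc i) - zeta v \<tau> i = of_int (CT \<tau> (Suc (sigma v i)) - CT \<tau> (sigma v i))"
    by (simp add: zeta_def eq level_step_index(3))
  have "CT \<tau> (sigma v i) \<noteq> CT \<tau> (Suc (sigma v i))"
    by (rule CT_Suc_neq[OF p(1) level_step_index(1,2)])
  then show "zeta v \<tau> (Suc i) \<noteq> zeta v \<tau> i"
    by (simp add: zeta_def eq level_step_index(3) alpha_linear_eq_iff)
  have "entry v (transpose i (Suc i) j) = entry v j" using eq by (auto simp: transpose_def)
  moreover have "sigma v (transpose i (Suc i) j) = transpose (sigma v i) (Suc (sigma v i)) (sigma v j)"
    using transpose_permutes_conj[OF p(6), of i "Suc i"] level_step_index(3) by (metis comp_apply)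
  ultimately show "zeta v \<tau> (transpose i (Suc i) j) = zeta v (tab_swap (sigma v i) \<tau>) j"
    by (simp add: zeta_def CT_tab_swap)
qed

text \<open>s_i fixes x^v, and moving it through \<open>sigma v\<close> turns it into s_k with k =
  \<open>sigma v i\<close>. The added constant is - b, so the diagonal part of \<tau> s_k cancels
  and only the interchanged tableau remains; its factor is 1 at a \<open>tab_step\<close> edge and 0
  at a \<open>fall\<close>.\<close>

lemma level_step_coefficient:
  "coefficient (list_exponent v) (diag_act N (transpose i (Suc i)) P +
      mscale (1 / (zeta v \<tau> (Suc i) - zeta v \<tau> i)) P)
    = vscale (swap_coeff (sigma v i) \<tau>) (vec_act N (sigma v) (tv (tab_swap (sigma v i) \<tau>)))"
proof -
  note p = vertex_functionD[OF P] and k = level_step_index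
  let ?s = "transpose i (Suc i)" and ?k = "sigma v i"
  let ?c = "1 / (zeta v \<tau> (Suc i) - zeta v \<tau> i)"
  have "vswap i v = v"
    using i p(2) eq by (intro nth_equalityI) (auto simp: vswap_def entry_def nth_list_update)
  then have le: "map_key ?s (list_exponent v) = list_exponent v"
    using list_exponent_vswap[OF i p(2)] by simp
  have "coefficient (list_exponent v) (diag_act N ?s P) = vec_act N ?s (vec_act N (sigma v) (tv \<tau>))"
    using diag_act_coefficient(1)[OF simple_permutes[OF i], of "list_exponent v" P] le p(8) by simp
  also have "\<dots> = vec_act N (sigma v \<circ> ?s) (tv \<tau>)"
    by (rule vec_act_compose(1)[OF p(6) simple_permutes[OF i] p(5), symmetric])
  also have "sigma v \<circ> ?s = transpose ?k (Suc ?k) \<circ> sigma v"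
    using transpose_permutes_conj[OF p(6), of i "Suc i"] k(3) by simp
  also have "vec_act N \<dots> (tv \<tau>) = vec_act N (sigma v) (tab_gen ?k \<tau>)"
    using vec_act_compose(1)[OF simple_permutes[OF k(1,2)] p(6,5)] vec_act_simple[OF p(5) k(1,2)]
    by (simp add: vec_gen_tv)
  finally have "coefficient (list_exponent v) (diag_act N ?s P + mscale ?c P) =
      vec_act N (sigma v) (tab_gen ?k \<tau> + vscale ?c (tv \<tau>))"
    by (simp add: coefficient_simps p(8) vlinear_add[OF vlinear_vec_act] vlinear_scale[OF
        vlinear_vec_act])
  moreover have "?c = - diag_coeff ?k \<tau>"
    unfolding level_step_zeta(1) diag_coeff_def by (simp add: minus_divide_right)
  then have "tab_gen ?k \<tau> + vscale ?c (tv \<tau>) = vscale (swap_coeff ?k \<tau>) (tv (tab_swap ?k \<tau>))"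
    unfolding tab_gen_eq by (auto intro!: poly_mapping_eqI simp: lookup_add lookup_vscale)
  ultimately show ?thesis by (simp add: vlinear_scale[OF vlinear_vec_act])
qed

lemma vertex_function_tab_step:
  assumes "CT \<tau> (sigma v i) - CT \<tau> (sigma v i + 1) \<ge> 2"
  shows "vertex_function (tab_swap (sigma v i) \<tau>) v
    (diag_act N (transpose i (Suc i)) P + mscale (1 / (zeta v \<tau> (Suc i) - zeta v \<tau> i)) P)"
proof -
  note p = vertex_functionD[OF P]
  have far: "CT \<tau> (sigma v i) - CT \<tau> (Suc (sigma v i)) \<ge> 2" using assms by (simp add: Suc_eq_plus1)
  then have "tab_swap (sigma v i) \<tau> \<in> RST lam"
    by (intro tab_swap_RST[OF p(1) level_step_index(1,2)]) auto
  moreover have "swap_coeff (sigma v i) \<tau> = 1" using far by (simp add: swap_coeff_def)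
  ultimately show ?thesis
    unfolding vertex_function_def level_step_coefficient
    using p(2) intertwiner_M_space[OF i p(3)]
      intertwiner_eigenfunction[OF i p(4,7) level_step_zeta(2)] level_step_zeta(3) by simp
qed

lemma vertex_function_fall:
  assumes "tab_swap (sigma v i) \<tau> \<notin> RST lam"
  shows "diag_act N (transpose i (Suc i)) P + mscale (1 / (zeta v \<tau> (Suc i) - zeta v \<tau> i)) P = 0"
\<comment> \<open>The interchanged filling is no RST here; its contents merely supply the integers,
  which \<open>eigenfunction_eq_0\<close> leaves arbitrary.\<close>
proof (rule eigenfunction_eq_0[where v = v and c = "\<lambda>j. CT (tab_swap (sigma v i) \<tau>) (sigma v j)"])
  note p = vertex_functionD[OF P]
  let ?Q = "diag_act N (transpose i (Suc i)) P + mscale (1 / (zeta v \<tau> (Suc i) - zeta v \<tau> i)) P"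
  show "?Q \<in> M_space lam" by (rule intertwiner_M_space[OF i p(3)])
  show "xi N j ?Q = mscale (alpha * of_nat (entry v j) +
      of_int (CT (tab_swap (sigma v i) \<tau>) (sigma v j))) ?Q"
    if "j \<in> {1..N}" for j
    using intertwiner_eigenfunction[OF i p(4,7) level_step_zeta(2) that] level_step_zeta(3)[OF that]
    by (simp add: zeta_def)
  have "\<bar>CT \<tau> (sigma v i) - CT \<tau> (Suc (sigma v i))\<bar> = 1"
    using assms tab_swap_RST[OF p(1) level_step_index(1,2)] by blast
  then show "coefficient (list_exponent v) ?Q = 0"
    unfolding level_step_coefficient by (simp add: swap_coeff_eq_0)
  show "length v = N" by (rule p(2))
qed

end

fun vertex_invariant :: "vertex \<Rightarrow> vpol \<Rightarrow> bool" where
  "vertex_invariant None P \<longleftrightarrow> P = 0"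
| "vertex_invariant (Some (\<tau>, v)) P \<longleftrightarrow> vertex_function \<tau> v P"

lemma edge_op_invariant:
  assumes "edge lam x l y" "vertex_invariant x P"
  shows "vertex_invariant y (edge_op N (x, l, y) P)"
  using assms
proof cases
  case (affine \<tau> v)
  then show ?thesis using assms(2) vertex_function_affine by simp
next
  case (step i v \<tau>)
  then have "vertex_function \<tau> v P" "i < N" using assms(2) vertex_functionD(2) by auto
  then show ?thesis using step vertex_function_step[of \<tau> v P i] by simp
next
  case (tab_step i v \<tau>)
  then have "vertex_function \<tau> v P" "i < N" using assms(2) vertex_functionD(2) by auto
  then show ?thesis using tab_step vertex_function_tab_step[of \<tau> v P i] by simp
next
  case (fall i v \<tau>)
  then have "vertex_function \<tau> v P" "i < N" using assms(2) vertex_functionD(2) by auto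
  then show ?thesis using fall vertex_function_fall[of \<tau> v P i] by simp
qed

lemma walk_invariant:
  "walk lam x es y \<Longrightarrow> vertex_invariant x P \<Longrightarrow> vertex_invariant y (fold (edge_op N) es P)"
proof (induction es arbitrary: x P)
  case (Cons e es)
  obtain a l b where e: "e = (a, l, b)" by (cases e)
  then show ?case using Cons edge_op_invariant[of a l b P] by auto
qed simp

lemma J_path_invariant: "path_to lam es y \<Longrightarrow> vertex_invariant y (J_path lam es)"
  unfolding path_to_def J_path_def using walk_invariant vertex_function_root by simp

end

section \<open>Every vertex is reachable\<close>

context partition_shape
begin

lemma walk_append: "walk lam x es y \<Longrightarrow> walk lam y es' z \<Longrightarrow> walk lam x (es @ es') z"
  by (induction lam x es y rule: walk.induct) auto

lemma reach_edge:
  assumes "\<exists>es. path_to lam es x" "edge lam x l y"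
  shows "\<exists>es. path_to lam es y"
proof -
  obtain es where "path_to lam es x" using assms by blast
  then have "path_to lam (es @ [(x, l, y)]) y"
    using assms(2) walk_append[of _ es x "[(x, l, y)]" y] by (simp add: path_to_def)
  then show ?thesis by blast
qed

text \<open>Works backwards from \<tau>: undoing a descent moves the larger entry to the cell read
  earlier, which lowers the sum of entries weighted by reading ranks. By
  \<open>exists_descent\<close> the process can stop only at the root.\<close>

lemma reach_tableau:
  "\<tau> \<in> RST lam \<Longrightarrow> \<exists>es. path_to lam es (Some (\<tau>, replicate N 0))"
proof (induction "\<Sum>p\<in>diagram lam. \<tau> p * reading_rank p" arbitrary: \<tau> rule: less_induct)
  case less
  show ?case
  proof (cases "\<tau> = root_tableau lam")
    case True
    then have "path_to lam [] (Some (\<tau>, replicate N 0))" by (simp add: path_to_def)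
    then show ?thesis by blast
  next
    case False
    then obtain i p q where i: "1 \<le> i" "i < N" "p \<in> diagram lam" "q \<in> diagram lam" "\<tau> p = i" "\<tau> q =
        Suc i"
      "before p q" "CT \<tau> i - CT \<tau> (Suc i) \<le> - 2" using exists_descent[OF less.prems] by metis
    define \<rho> where "\<rho> = tab_swap i \<tau>"
    have \<rho>: "\<rho> \<in> RST lam" unfolding \<rho>_def by (rule tab_swap_RST[OF less.prems i(1,2)]) (use i(8) in
        linarith)
    have far: "CT \<rho> i - CT \<rho> (Suc i) \<ge> 2" using i(8) by (simp add: \<rho>_def CT_tab_swap)
    have "p \<noteq> q" using i by auto
    have split: "(\<Sum>x\<in>diagram lam. f x) = f p + f q + (\<Sum>x\<in>diagram lam - {p} - {q}. f x)"
        for f :: "nat \<times> nat \<Rightarrow> nat"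
      using i(3,4) \<open>p \<noteq> q\<close> sum.remove[of "diagram lam" p f] sum.remove[of "diagram lam - {p}" q f]
          by simp
    have rest: "\<rho> x = \<tau> x" if "x \<in> diagram lam - {p} - {q}" for x
    proof -
      have "\<tau> x \<noteq> i" "\<tau> x \<noteq> Suc i"
        using that RST_inj[OF less.prems, of x p] RST_inj[OF less.prems, of x q] i(3-6) by auto
      then show ?thesis by (simp add: \<rho>_def tab_swap_def transpose_def)
    qed
    have pq: "\<rho> p = Suc i" "\<rho> q = i" using i(5,6) by (simp_all add: \<rho>_def tab_swap_def)
    have "reading_rank p < reading_rank q" using reading_rank_less_iff[OF i(3,4)] i(7) by blast
    then have "(\<Sum>x\<in>diagram lam. \<rho> x * reading_rank x) < (\<Sum>x\<in>diagram lam. \<tau> x * reading_rank x)"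
      unfolding split[of "\<lambda>x. \<rho> x * reading_rank x"] split[of "\<lambda>x. \<tau> x * reading_rank x"] pq i(5,6)
      using rest by simp
    then have "\<exists>es. path_to lam es (Some (\<rho>, replicate N 0))" using less.hyps \<rho> by blast
    moreover have "edge lam (Some (\<rho>, replicate N 0)) (S i) (Some (tab_swap (sigma (replicate N 0)
        i) \<rho>, replicate N 0))"
    proof (rule edge.tab_step)
      have "i - 1 < N" using i by auto
      then show "entry (replicate N 0) i = entry (replicate N 0) (Suc i)"
          using i by (simp add: entry_def)
      show "2 \<le> CT \<rho> (sigma (replicate N 0) i) - CT \<rho> (sigma (replicate N 0) i + 1)"
        using far by (simp add: sigma_replicate Suc_eq_plus1)
    qed (use i in auto)
    ultimately show ?thesis using reach_edge by (auto simp: sigma_replicate \<rho>_def)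
  qed
qed

text \<open>Without a descent the entries would increase weakly to the last entry 0, hence all
  vanish.\<close>

lemma exists_descending_entry:
  fixes v :: "nat list"
  assumes "length v = N" "entry v N = 0" "v \<noteq> replicate N 0"
  obtains i where "1 \<le> i" "i < N" "entry v (Suc i) < entry v i"
proof -
  have "\<exists>i. 1 \<le> i \<and> i < N \<and> entry v (Suc i) < entry v i"
  proof (rule ccontr)
    assume "\<nexists>i. 1 \<le> i \<and> i < N \<and> entry v (Suc i) < entry v i"
    then have step: "entry v i \<le> entry v (Suc i)" if "1 \<le> i" "i < N" for i using that by (meson not_less)
    have "entry v i = 0" if "i \<le> N" "1 \<le> i" for i
      using that
    proof (induction i rule: inc_induct)
      case base
      then show ?case using assms(2) by simp
    next
      case (step n)
      then show ?case using \<open>\<And>i. 1 \<le> i \<Longrightarrow> i < N \<Longrightarrow> entry v i \<le> entry v (Suc i)\<close>[of n] by simp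
    qed
    then have "v ! p = 0" if "p < N" for p using that[unfolded Suc_le_eq[symmetric]]
        by (force simp: entry_def One_nat_def)
    then have "v = replicate N 0" using assms(1) by (intro nth_equalityI) auto
    then show False using assms(3) by blast
  qed
  then show ?thesis using that by blast
qed

text \<open>Works backwards as well: a positive last entry allows \<open>vPsi\<close> to be undone,
  which lowers the sum; otherwise a descent of v is undone, which keeps the sum and lowers v in
  \<open>vlhd\<close>.\<close>

lemma reach_vertex:
  assumes \<tau>: "\<tau> \<in> RST lam"
  shows "length v = N \<Longrightarrow> \<exists>es. path_to lam es (Some (\<tau>, v))"
proof (induction v rule: wf_induct_rule[OF wf_measures[of "[sum_list, \<lambda>v. card {u. length u = N \<and>
    vlhd u v}]"]])
  case (1 v)
  consider "v = replicate N 0" | "v \<noteq> replicate N 0" "entry v N = 0" | "entry v N > 0" by blast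
  then show ?case
  proof cases
    case 1
    then show ?thesis using reach_tableau[OF \<tau>] by simp
  next
    case 2
    then obtain i where i: "1 \<le> i" "i < N" "entry v (Suc i) < entry v i"
      using exists_descending_entry[of v] "1.prems" by blast
    define u where "u = vswap i v"
    have "u = v[i - 1 := v ! i, i := v ! (i - 1)]" by (simp add: u_def vswap_def entry_def)
    then have "vlhd u v" "mset u = mset v"
      using vlhd_swap[of "i - 1" i v] mset_swap[of i v "i - 1"] i "1.prems" by (auto simp: entry_def)
    have len: "length u = N" using "1.prems" by (simp add: u_def)
    have "{w. length w = N \<and> vlhd w u} \<subset> {w. length w = N \<and> vlhd w v}"
      using \<open>vlhd u v\<close> len "1.prems" vlhd_irrefl vlhd_trans by blast
    then have "card {w. length w = N \<and> vlhd w u} < card {w. length w = N \<and> vlhd w v}"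
      using finite_vlhd[of v] "1.prems" by (intro psubset_card_mono) auto
    moreover have "sum_list u = sum_list v" using \<open>mset u = mset v\<close> by (metis sum_mset_sum_list)
    ultimately have "\<exists>es. path_to lam es (Some (\<tau>, u))" using "1.IH"[of u] len by simp
    moreover have "edge lam (Some (\<tau>, u)) (S i) (Some (\<tau>, vswap i u))"
      by (rule edge.step) (use i len "1.prems" entry_vswap[of i v] in \<open>auto simp: u_def\<close>)
    moreover have "vswap i u = v"
      using i "1.prems" by (intro nth_equalityI) (auto simp: u_def vswap_def entry_def nth_list_update)
    ultimately show ?thesis using reach_edge by metis
  next
    case 3
    define u where "u = (last v - 1) # butlast v"
    have ne: "v \<noteq> []" using "1.prems" N_pos by auto
    have last: "last v > 0" using 3 ne "1.prems" by (simp add: entry_def last_conv_nth)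
    have len: "length u = N" using "1.prems" N_pos by (simp add: u_def)
    have "vPsi u = v" using last ne by (simp add: vPsi_def u_def)
    moreover have "sum_list v = sum_list (butlast v) + last v"
      using ne by (metis append_butlast_last_id sum_list_append sum_list.Cons sum_list.Nil add_0_right)
    then have "sum_list u < sum_list v" using last by (simp add: u_def)
    then have "\<exists>es. path_to lam es (Some (\<tau>, u))" using "1.IH"[of u] len by simp
    ultimately show ?thesis using reach_edge edge.affine by metis
  qed
qed

end

section \<open>The basis property\<close>

context partition_shape
begin

lemma xmon_eq:
  "length v = N \<Longrightarrow> xmon v \<tau> = tensor (single (list_exponent v) 1) (vec_act N (sigma v) (tv \<tau>))"
  by (simp add: xmon_def xpow_eq_single)

text \<open>\<open>sigma\<close> acts invertibly on the representation, so its images of the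
  tableaux span all coefficients at a given exponent.\<close>

lemma tensor_in_span_xmon:
  assumes m: "keys m \<subseteq> {1..N}" and t: "t \<in> V_space"
  shows "tensor (single m 1) t \<in> M.span {xmon (exponent_list N m) \<tau> |\<tau>. \<tau> \<in> RST lam}"
proof -
  define \<sigma> where "\<sigma> = sigma (exponent_list N m)"
  have \<sigma>: "\<sigma> permutes {1..N}" unfolding \<sigma>_def by (rule sigma_exponent_permutes)
  define s where "s = vec_act N (inv \<sigma>) t"
  have sV: "s \<in> V_space"
    unfolding s_def by (rule vec_act_V_space[OF permutes_inv[OF \<sigma>] permutes_inv[OF \<sigma>] t])
  have ts: "t = vec_act N \<sigma> s" unfolding s_def using vec_act_inverse(1)[OF \<sigma> t] by simp
  have exp: "s = (\<Sum>\<tau>\<in>keys s. vscale (lookup s \<tau>) (tv \<tau>))"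
    by (rule tv_expansion) auto
  have "tensor (single m 1) t =
      (\<Sum>\<tau>\<in>keys s. mscale (lookup s \<tau>) (xmon (exponent_list N m) \<tau>))"
    unfolding ts
    by (subst exp) (simp add: vlinear_sum[OF vlinear_vec_act] vlinear_scale[OF vlinear_vec_act]
        tensor_sum_right tensor_simps xmon_eq list_exponent_exponent_list[OF m] \<sigma>_def)
  also have "\<dots> \<in> M.span {xmon (exponent_list N m) \<tau> |\<tau>. \<tau> \<in> RST lam}"
    using V_space_keys[OF sV] by (intro M.span_sum M.span_scale M.span_base) blast
  finally show ?thesis .
qed

lemma vertex_function_leading:
  assumes "vertex_function \<tau> v P"
  shows "\<exists>R. P = xmon v \<tau> + R \<and>
    R \<in> M.span {xmon v' \<tau>' |v' \<tau>'. length v' = N \<and> \<tau>' \<in> RST lam \<and> vlhd v' v}"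
proof -
  note p = vertex_functionD[OF assms]
  let ?X = "{xmon v' \<tau>' |v' \<tau>'. length v' = N \<and> \<tau>' \<in> RST lam \<and> vlhd v' v}"
  let ?T = "\<lambda>m. tensor (single m 1) (coefficient m P)"
  let ?R = "\<Sum>m\<in>support P - {list_exponent v}. ?T m"
  have "list_exponent v \<in> support P"
    using p(8) vec_act_tv_nonzero[OF p(1,6)] by (simp add: support_def)
  then have "(\<Sum>m\<in>support P. ?T m) = ?T (list_exponent v) + ?R"
    by (simp add: sum.remove)
  then have "P = xmon v \<tau> + ?R"
    using coefficient_expansion[of P] p(8) xmon_eq[OF p(2)] by simp
  moreover have "?R \<in> M.span ?X"
  proof (rule M.span_sum)
    fix m assume m: "m \<in> support P - {list_exponent v}"
    then have "vlhd (exponent_list N m) v" using vertex_function_support[OF assms] by blast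
    then have "{xmon (exponent_list N m) \<tau> |\<tau>. \<tau> \<in> RST lam} \<subseteq> ?X" using length_exponent_list by blast
    moreover have "?T m \<in> M.span {xmon (exponent_list N m) \<tau> |\<tau>. \<tau> \<in> RST lam}"
      by (rule tensor_in_span_xmon) (use m p(3) in \<open>auto simp: M_space_iff_coefficient\<close>)
    ultimately show "?T m \<in> M.span ?X" using M.span_mono by blast
  qed
  ultimately show ?thesis by blast
qed

lemma M_space_eq_span_xmon:
  "M_space lam = M.span {xmon v \<tau> |v \<tau>. length v = N \<and> \<tau> \<in> RST lam}" (is "_ = M.span ?X")
proof
  show "M_space lam \<subseteq> M.span ?X"
  proof
    fix P assume P: "P \<in> M_space lam"
    have "(\<Sum>m\<in>support P. tensor (single m 1) (coefficient m P)) \<in> M.span ?X"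
    proof (rule M.span_sum)
      fix m assume m: "m \<in> support P"
      have "{xmon (exponent_list N m) \<tau> |\<tau>. \<tau> \<in> RST lam} \<subseteq> ?X" using length_exponent_list by blast
      moreover have "tensor (single m 1) (coefficient m P) \<in>
          M.span {xmon (exponent_list N m) \<tau> |\<tau>. \<tau> \<in> RST lam}"
        by (rule tensor_in_span_xmon) (use m P in \<open>auto simp: M_space_iff_coefficient\<close>)
      ultimately show "tensor (single m 1) (coefficient m P) \<in> M.span ?X"
        using M.span_mono by blast
    qed
    then show "P \<in> M.span ?X" using coefficient_expansion[of P] by simp
  qed
  have "xmon v \<tau> \<in> M_space lam" if v: "length v = N" and \<tau>: "\<tau> \<in> RST lam" for v \<tau>
  proof -
    have \<sigma>: "sigma v permutes {1..N}" using sigma_permutes[of v] v by simp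
    show ?thesis
      unfolding M_space_iff_coefficient xmon_eq[OF v]
      using vec_act_V_space[OF \<sigma> \<sigma> V_space_tv[OF \<tau>]] keys_list_exponent[of v] v
      by (auto simp: support_def coefficient_simps lookup_single when_def split: if_splits)
  qed
  then show "M.span ?X \<subseteq> M_space lam" by (intro M.span_minimal M_space_subspace) blast
qed

text \<open>Both exponents lie in the support and each dominates it, so they coincide; the tableau
  is then read off the coefficient there.\<close>

lemma vertex_function_inject:
  assumes P: "vertex_function \<tau> v P" and P': "vertex_function \<tau>' v' P"
  shows "v = v'" "\<tau> = \<tau>'"
proof -
  note p = vertex_functionD[OF P] and p' = vertex_functionD[OF P']
  have s: "list_exponent v \<in> support P" "list_exponent v' \<in> support P"
    using p(8) vec_act_tv_nonzero[OF p(1,6)] p'(8) vec_act_tv_nonzero[OF p'(1,6)]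
    by (simp_all add: support_def)
  have e: "exponent_list N (list_exponent v) = v" "exponent_list N (list_exponent v') = v'"
    by (rule exponent_list_list_exponent, rule p(2), rule exponent_list_list_exponent, rule p'(2))
  have "\<not> (vlhd v v' \<and> vlhd v' v)"
    using vlhd_trans[OF _ _ p(2) p'(2) p(2)] vlhd_irrefl by blast
  then have le: "list_exponent v = list_exponent v'"
    using vertex_function_support[OF P s(2)] vertex_function_support[OF P' s(1)] unfolding e by auto
  show v: "v = v'" using arg_cong[OF le, of "exponent_list N"] unfolding e .
  have E: "vec_act N (sigma v) (tv \<tau>) = vec_act N (sigma v) (tv \<tau>')" using p(8) p'(8) v by simp
  have "tv \<tau> = vec_act N (inv (sigma v)) (vec_act N (sigma v) (tv \<tau>))"
    by (rule vec_act_inverse(2)[OF p(6,5), symmetric])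
  also have "\<dots> = tv \<tau>'" unfolding E by (rule vec_act_inverse(2)[OF p(6) p'(5)])
  finally have "tv \<tau> = tv \<tau>'" .
  then have "keys (tv \<tau>) = keys (tv \<tau>')" by simp
  then show "\<tau> = \<tau>'" by (simp add: tv_def)
qed

text \<open>The coordinate belonging to \<open>xmon v \<tau>\<close>: undoing \<open>sigma v\<close>
  turns the coefficient back into a combination of tableaux.\<close>

definition dual_functional :: "nat list \<Rightarrow> tableau \<Rightarrow> vpol \<Rightarrow> ratfun" where
  "dual_functional v \<tau> P =
     lookup (vec_act N (inv (sigma v)) (coefficient (list_exponent v) P)) \<tau>"

lemma dual_functional_sum:
  "dual_functional v \<tau> (\<Sum>x\<in>A. mscale (c x) (f x)) = (\<Sum>x\<in>A. c x * dual_functional v \<tau> (f x))"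
  unfolding dual_functional_def
  by (simp add: coefficient_sum coefficient_simps vlinear_sum[OF vlinear_vec_act]
      vlinear_scale[OF vlinear_vec_act] lookup_sum lookup_vscale)

context
  fixes J :: "nat list \<Rightarrow> tableau \<Rightarrow> vpol" and I :: "(nat list \<times> tableau) set"
  assumes J: "\<And>v \<tau>. length v = N \<Longrightarrow> \<tau> \<in> RST lam \<Longrightarrow> vertex_function \<tau> v (J v \<tau>)"
  defines "I \<equiv> {v. length v = N} \<times> RST lam"
begin

lemma family_vertex_function: "(v, \<tau>) \<in> I \<Longrightarrow> vertex_function \<tau> v (J v \<tau>)"
  using J by (simp add: I_def)

lemma family_inj: "inj_on (\<lambda>(v, \<tau>). J v \<tau>) I"
proof (rule inj_onI, clarify)
  fix v \<tau> v' \<tau>' assume I: "(v, \<tau>) \<in> I" "(v', \<tau>') \<in> I" and eq: "J v \<tau> = J v' \<tau>'"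
  show "v = v' \<and> \<tau> = \<tau>'"
    using vertex_function_inject[OF family_vertex_function[OF I(1)]] family_vertex_function[OF I(2)]
        eq by simp
qed

text \<open>The support of \<open>J v \<tau>\<close> consists of v and smaller exponents, so the
  functionals are unitriangular against the family.\<close>

lemma dual_functional_J:
  assumes "(v, \<tau>) \<in> I" "(v', \<tau>') \<in> I" "\<not> vlhd v' v"
  shows "dual_functional v' \<tau>' (J v \<tau>) = (if v = v' \<and> \<tau> = \<tau>' then 1 else 0)"
proof (cases "v = v'")
  case True
  note p = vertex_functionD[OF family_vertex_function[OF assms(1)]]
  have "dual_functional v' \<tau>' (J v \<tau>) = lookup (tv \<tau>) \<tau>'"
    unfolding dual_functional_def True[symmetric] p(8) vec_act_inverse(2)[OF p(6,5)] ..
  then show ?thesis using True by (simp add: tv_def lookup_single when_def)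
next
  case False
  note p = vertex_functionD[OF family_vertex_function[OF assms(1)]]
  have v': "length v' = N" using assms(2) by (simp add: I_def)
  have "list_exponent v' \<noteq> list_exponent v"
    using False exponent_list_list_exponent[OF p(2)] exponent_list_list_exponent[OF v'] by metis
  then have "list_exponent v' \<notin> support (J v \<tau>)"
    using vertex_function_support[OF family_vertex_function[OF assms(1)], of "list_exponent v'"]
      exponent_list_list_exponent[OF v'] assms(3) by auto
  then show ?thesis
    using False by (simp add: dual_functional_def support_def vlinear_0[OF vlinear_vec_act])
qed

text \<open>In a vanishing combination, the functional at a maximal index with nonzero coefficient
  sees that coefficient alone.\<close>

lemma family_independent: "M.independent ((\<lambda>(v, \<tau>). J v \<tau>) ` I)"
proof
  let ?F = "\<lambda>(v, \<tau>). J v \<tau>"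
  assume "M.dependent (?F ` I)"
  then obtain S u where S: "finite S" "S \<subseteq> ?F ` I" "(\<Sum>b\<in>S. mscale (u b) b) = 0" "\<exists>b\<in>S. u b \<noteq> 0"
    unfolding M.dependent_explicit by blast
  \<comment> \<open>The relation is indexed by the functions themselves, whereas the order lives on
    their indices.\<close>
  define g where "g = inv_into I ?F"
  have g: "g b \<in> I" "J (fst (g b)) (snd (g b)) = b" if "b \<in> S" for b
    using that S(2) inv_into_into[of b ?F I] f_inv_into_f[of b ?F I] unfolding g_def
    by (auto simp: case_prod_beta)
  define T where "T = {b \<in> S. u b \<noteq> 0}"
  have len: "length (fst (g b)) = N" if "b \<in> T" for b
    using g(1)[of b] that by (auto simp: T_def I_def)
  obtain b where "b \<in> T" using S(4) by (auto simp: T_def)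
  obtain b0 where b0: "b0 \<in> T" "\<And>b. b \<in> T \<Longrightarrow> \<not> vlhd (fst (g b0)) (fst (g b))"
  proof (rule exists_maximal_above[of T b "\<lambda>a b. vlhd (fst (g a)) (fst (g b))"])
    show "finite T" using S(1) by (simp add: T_def)
    show "vlhd (fst (g x)) (fst (g z))" if "x \<in> T" "y \<in> T" "z \<in> T"
      "vlhd (fst (g x)) (fst (g y))" "vlhd (fst (g y)) (fst (g z))" for x y z
      by (rule vlhd_trans[OF that(4,5) len[OF that(1)] len[OF that(2)] len[OF that(3)]])
  qed (use \<open>b \<in> T\<close> vlhd_irrefl in blast)+
  have b0S: "b0 \<in> S" "u b0 \<noteq> 0" using b0(1) by (simp_all add: T_def)
  let ?d = "dual_functional (fst (g b0)) (snd (g b0))"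
  have "u b * ?d b = (if b = b0 then u b0 else 0)" if b: "b \<in> S" for b
  proof (cases "u b = 0")
    case False
    then have "\<not> vlhd (fst (g b0)) (fst (g b))" using b0(2) b by (simp add: T_def)
    then have "?d b = (if fst (g b) = fst (g b0) \<and> snd (g b) = snd (g b0) then 1 else 0)"
      using dual_functional_J[of "fst (g b)" "snd (g b)" "fst (g b0)"
          "snd (g b0)"] g[OF b] g[OF b0S(1)] by simp
    moreover have "fst (g b) = fst (g b0) \<and> snd (g b) = snd (g b0) \<longleftrightarrow> b = b0"
      using g(2)[OF b] g(2)[OF b0S(1)] by metis
    ultimately show ?thesis by simp
  qed (use b0S in auto)
  then have "?d (\<Sum>b\<in>S. mscale (u b) b) = (\<Sum>b\<in>S. if b = b0 then u b0 else 0)"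
    using dual_functional_sum[of "fst (g b0)" "snd (g b0)" u "\<lambda>b. b" S] by simp
  also have "\<dots> = u b0" using S(1) b0S(1) by (simp add: sum.delta)
  finally have "u b0 = ?d 0" using S(3) by simp
  then show False
    using b0S(2) by (simp add: dual_functional_def coefficient_simps vlinear_0[OF vlinear_vec_act])
qed

text \<open>Induction on the number of smaller exponents: \<open>xmon v \<tau>\<close> is
  \<open>J v \<tau>\<close> minus a combination of monomials already in the span.\<close>

lemma family_span: "M.span ((\<lambda>(v, \<tau>). J v \<tau>) ` I) = M_space lam"
proof
  let ?B = "(\<lambda>(v, \<tau>). J v \<tau>) ` I"
  have "J v \<tau> \<in> M_space lam" if "(v, \<tau>) \<in> I" for v \<tau>
    using vertex_functionD(3)[OF family_vertex_function[OF that]] .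
  then show "M.span ?B \<subseteq> M_space lam" by (intro M.span_minimal M_space_subspace) auto
  have "xmon v \<tau> \<in> M.span ?B" if "length v = N" "\<tau> \<in> RST lam" for v \<tau>
    using that
  proof (induction "card {u. length u = N \<and> vlhd u v}" arbitrary: v \<tau> rule: less_induct)
    case less
    have "vertex_function \<tau> v (J v \<tau>)" using J less.prems by blast
    then obtain R where R: "J v \<tau> = xmon v \<tau> + R"
      "R \<in> M.span {xmon v' \<tau>' |v' \<tau>'. length v' = N \<and> \<tau>' \<in> RST lam \<and> vlhd v' v}"
      using vertex_function_leading by blast
    have "xmon v' \<tau>' \<in> M.span ?B" if v': "length v' = N" "\<tau>' \<in> RST lam" "vlhd v' v" for v' \<tau>'
    proof (rule less.hyps)
      have "{w. length w = N \<and> vlhd w v'} \<subset> {w. length w = N \<and> vlhd w v}"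
        using v' less.prems(1) vlhd_irrefl vlhd_trans by blast
      then show "card {w. length w = N \<and> vlhd w v'} < card {w. length w = N \<and> vlhd w v}"
        using finite_vlhd[of v] less.prems(1) by (intro psubset_card_mono) auto
    qed (use v' in auto)
    then have "M.span {xmon v' \<tau>' |v' \<tau>'. length v' = N \<and> \<tau>' \<in> RST lam \<and> vlhd v' v} \<subseteq> M.span ?B"
      by (intro M.span_minimal M.subspace_span) blast
    then have "R \<in> M.span ?B" using R(2) by blast
    moreover have "J v \<tau> \<in> M.span ?B" using less.prems by (intro M.span_base) (auto simp: I_def)
    moreover have "xmon v \<tau> = J v \<tau> - R" using R(1) by simp
    ultimately show ?case using M.span_diff by metis
  qed
  then show "M_space lam \<subseteq> M.span ?B"
    unfolding M_space_eq_span_xmon by (intro M.span_minimal M.subspace_span) blast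
qed

end

lemma vertex_function_J_vertex:
  assumes "length v = N" "\<tau> \<in> RST lam"
  shows "vertex_function \<tau> v (J_vertex lam v \<tau>)"
proof -
  have "path_to lam (SOME es. path_to lam es (Some (\<tau>, v))) (Some (\<tau>, v))"
    by (rule someI_ex) (rule reach_vertex[OF assms(2,1)])
  then show ?thesis using J_path_invariant unfolding J_vertex_def by fastforce
qed

lemma vertex_function_simult_eigenfunction:
  "vertex_function \<tau> v P \<Longrightarrow> simult_eigenfunction lam (xi N) (zeta v \<tau>) P"
  using vertex_functionD[of \<tau> v P] vertex_function_nonzero by (simp add: simult_eigenfunction_def)

text \<open>\<open>xi\<close> is \<alpha> times \<open>Cherednik\<close> minus \<alpha>, and
  \<alpha> is invertible, so the eigenvalue equation can be solved for
  \<open>Cherednik\<close>.\<close>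

lemma simult_eigenfunction_Cherednik:
  assumes "simult_eigenfunction lam (xi N) z P"
  shows "simult_eigenfunction lam (Cherednik N) (\<lambda>i. z i / alpha + 1) P"
proof -
  have "Cherednik N i P = mscale (z i / alpha + 1) P" if "i \<in> {1..N}" for i
  proof -
    have "mscale alpha (Cherednik N i P) - mscale alpha P = mscale (z i) P"
      using assms that by (simp add: simult_eigenfunction_def xi_def)
    then have "mscale alpha (Cherednik N i P) = mscale (z i) P + mscale alpha P"
        by (simp add: algebra_simps)
    then have "mscale (1 / alpha) (mscale alpha (Cherednik N i P)) =
        mscale (1 / alpha) (mscale (z i + alpha) P)"
      by (simp add: M.scale_left_distrib)
    then show ?thesis by (simp add: add_divide_distrib)
  qed
  then show ?thesis using assms by (simp add: simult_eigenfunction_def)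
qed

lemma vertex_function_leading_monomial:
  assumes "vertex_function \<tau> v P" shows "leading_monomial lam P v \<tau>"
proof -
  obtain R where "P = xmon v \<tau> + R"
    "R \<in> M.span {xmon v' \<tau>' |v' \<tau>'. length v' = N \<and> \<tau>' \<in> RST lam \<and> vlhd v' v}"
    using vertex_function_leading[OF assms] by blast
  then show ?thesis unfolding leading_monomial_def sum_lam
    by (intro exI[of _ 1] exI[of _ R]) simp
qed

end

theorem theorem4p1:
  fixes lam :: "nat list" and N :: nat
  assumes "partition_of lam N" and "N \<ge> 1"
  shows "(\<forall>es \<tau> v. path_to lam es (Some (\<tau>, v)) \<longrightarrow>
            simult_eigenfunction lam (xi N) (zeta v \<tau>) (J_path lam es) \<and>
            leading_monomial lam (J_path lam es) v \<tau>) \<and>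
         (\<forall>es es' \<tau> v. path_to lam es (Some (\<tau>, v)) \<and> path_to lam es' (Some (\<tau>, v)) \<longrightarrow>
            J_path lam es = J_path lam es') \<and>
         (\<forall>v \<tau>. length v = N \<and> \<tau> \<in> RST lam \<longrightarrow> (\<exists>es. path_to lam es (Some (\<tau>, v)))) \<and>
         (let I = {v. length v = N} \<times> RST lam; B = (\<lambda>(v, \<tau>). J_vertex lam v \<tau>) ` I in
            inj_on (\<lambda>(v, \<tau>). J_vertex lam v \<tau>) I \<and> M.independent B \<and> M.span B = M_space lam) \<and>
         (\<forall>v \<tau>. length v = N \<and> \<tau> \<in> RST lam \<longrightarrow>
            simult_eigenfunction lam (xi N) (zeta v \<tau>) (J_vertex lam v \<tau>) \<and>
            (\<exists>z. simult_eigenfunction lam (Cherednik N) z (J_vertex lam v \<tau>))) \<and>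
         (\<forall>es. path_to lam es None \<longrightarrow> J_path lam es = 0)"
proof -
  interpret partition_shape lam N using assms by unfold_locales
  have path: "vertex_function \<tau> v (J_path lam es)" if "path_to lam es (Some (\<tau>, v))" for es \<tau> v
    using J_path_invariant[OF that] by simp
  let ?I = "{v. length v = N} \<times> RST lam" and ?F = "\<lambda>(v, \<tau>). J_vertex lam v \<tau>"
  have "inj_on ?F ?I" "M.independent (?F ` ?I)" "M.span (?F ` ?I) = M_space lam"
    using family_inj family_independent family_span vertex_function_J_vertex by blast+
  moreover have "simult_eigenfunction lam (xi N) (zeta v \<tau>) (J_path lam es) \<and>
      leading_monomial lam (J_path lam es) v \<tau>" if "path_to lam es (Some (\<tau>, v))" for es \<tau> v
    using path[OF that] vertex_function_simult_eigenfunction vertex_function_leading_monomial by blast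
  moreover have "J_path lam es = J_path lam es'"
    if "path_to lam es (Some (\<tau>, v))" "path_to lam es' (Some (\<tau>, v))" for es es' \<tau> v
    using path[OF that(1)] path[OF that(2)] vertex_function_unique by blast
  moreover have "\<exists>es. path_to lam es (Some (\<tau>, v))" if "length v = N" "\<tau> \<in> RST lam" for v \<tau>
    using reach_vertex that by blast
  moreover have "simult_eigenfunction lam (xi N) (zeta v \<tau>) (J_vertex lam v \<tau>) \<and>
      (\<exists>z. simult_eigenfunction lam (Cherednik N) z (J_vertex lam v \<tau>))"
    if "length v = N" "\<tau> \<in> RST lam" for v \<tau>
    using vertex_function_simult_eigenfunction[OF vertex_function_J_vertex[OF that]]
      simult_eigenfunction_Cherednik by blast
  moreover have "J_path lam es = 0" if "path_to lam es None" for es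
    using J_path_invariant[OF that] by simp
  ultimately show ?thesis unfolding Let_def by blast
qed

end
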